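(* Let $d=3$ and let $\Sigma\hookrightarrow(M,\boldsymbol c)$ be a conformally embedded surface in a conformal three-manifold. For $g\in\boldsymbol c$ set $$\mathcal P_{ab}:=P^\top_{ab}+H\mathring{\mathrm{II}}_{ab}+\tfrac12H^2\bar g_{ab}-\tfrac12K\bar g_{ab},\qquad \mathcal J:=\mathcal P_a{}^a .$$ Then the mapping $$ f\mapsto\bar\Delta^2f+4\bar\nabla^a\circ\mathcal P_{ab}\circ\bar\nabla^bf+\Big[2\bar\nabla\cdot\bar\nabla\cdot\mathcal P-\bar\Delta\mathcal J+2\mathcal P^2-\mathcal J^2+2\bar\nabla_a\big(\mathring{\mathrm{II}}{}^{ab}\bar\nabla\cdot\mathring{\mathrm{II}}_b\big)+2(\bar\nabla\cdot\mathring{\mathrm{II}})^2+\tfrac14K^2\Big]f $$ defines a conformal squared Laplacian operator $\Gamma(\mathcal E\Sigma[1])\to\Gamma(\mathcal E\Sigma[-3])$.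
   Context: Everything is smooth and Riemannian, $\boldsymbol c$ is a conformal class of metrics on $M$. A weight $w$ density on $\Sigma$ (section of $\mathcal E\Sigma[w]$) is a class $[\bar g;f]$ with $(\Omega^2\bar g,\Omega^wf)\sim(\bar g,f)$, where $\bar g$ ranges over metrics on $\Sigma$ induced from $g\in\boldsymbol c$. That the displayed formula, written for each $g\in\boldsymbol c$, defines such an operator means: if $g$ is replaced by $\Omega^2g$ and $f$ by $\Omega f$, the result is multiplied by $\Omega^{-3}|_\Sigma$. For $g\in\boldsymbol c$: $P$ is the Schouten tensor of $(M,g)$, defined by $Ric=(d-2)P+gJ$, $J=\mathrm{tr}_gP$; $P^\top$ is its projection (restriction) to $T\Sigma$; $\hat n$ is the unit conormal; $\bar g$ the induced metric with Levi-Civita connection $\bar\nabla$ and Laplacian $\bar\Delta=\bar\nabla^a\bar\nabla_a$; $\mathrm{II}_{ab}=\bar g_a{}^c\nabla_c\hat n_b$; $H=\frac1{d-1}\bar g^{ab}\mathrm{II}_{ab}$; $\mathring{\mathrm{II}}=\mathrm{II}-H\bar g$; $K=\mathring{\mathrm{II}}_{ab}\mathring{\mathrm{II}}{}^{ab}$; $\mathcal P^2=\mathcal P_{ab}\mathcal P^{ab}$; $\bar\nabla\cdot\mathring{\mathrm{II}}_b=\bar\nabla^a\mathring{\mathrm{II}}_{ab}$ and $(\bar\nabla\cdot\mathring{\mathrm{II}})^2$ its squared norm; $\bar\nabla\cdot\bar\nabla\cdot\mathcal P=\bar\nabla^a\bar\nabla^b\mathcal P_{ab}$. *)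

theory Defs
  imports "HOL-Analysis.Analysis"
begin

section \<open>Smooth maps between Euclidean spaces\<close>

definition pd :: "'n::finite \<Rightarrow> (real^'n \<Rightarrow> 'b::real_normed_vector) \<Rightarrow> real^'n \<Rightarrow> 'b" where
  "pd i F x = frechet_derivative F (at x) (axis i 1)"

(* Infinite differentiability on an open set: all iterated partial derivatives exist
   and are Frechet differentiable (hence continuous) there. *)
definition smooth_on :: "(real^'n::finite) set \<Rightarrow> (real^'n \<Rightarrow> 'b::real_normed_vector) \<Rightarrow> bool" where
  "smooth_on X F \<longleftrightarrow> open X \<and> (\<forall>ks. \<forall>x\<in>X. foldr pd ks F differentiable (at x))"


section \<open>Tensor calculus in one coordinate system\<close>

text \<open>
  Tensor fields on an open subset of coordinate space are given by their components, as functions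
  of the coordinates \<open>x\<close>; \<open>G x $ i $ j\<close> are the components of a Riemannian metric. The index type
  determines the dimension. Indices are summed explicitly.
\<close>

type_synonym 'n covector_field = "real^'n \<Rightarrow> real^'n"
type_synonym 'n tensor2_field = "real^'n \<Rightarrow> real^'n^'n"

definition ginv :: "'n::finite tensor2_field \<Rightarrow> 'n tensor2_field" where
  "ginv G x = matrix_inv (G x)"

(* christoffel G x k i j is Gamma^k_ij *)
definition christoffel :: "'n::finite tensor2_field \<Rightarrow> real^'n \<Rightarrow> 'n \<Rightarrow> 'n \<Rightarrow> 'n \<Rightarrow> real" where
  "christoffel G x k i j =
     (1/2) * (\<Sum>l\<in>UNIV. ginv G x $ k $ l *
        (pd i (\<lambda>z. G z $ l $ j) x + pd j (\<lambda>z. G z $ l $ i) x - pd l (\<lambda>z. G z $ i $ j) x))"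

(* (nabla_i w_j)_ij *)
definition cov1 :: "'n::finite tensor2_field \<Rightarrow> 'n covector_field \<Rightarrow> 'n tensor2_field" where
  "cov1 G w x = (\<chi> i j. pd i (\<lambda>z. w z $ j) x - (\<Sum>k\<in>UNIV. christoffel G x k i j * w x $ k))"

(* cov2 G T x c a b is nabla_c T_ab *)
definition cov2 :: "'n::finite tensor2_field \<Rightarrow> 'n tensor2_field \<Rightarrow> real^'n \<Rightarrow> 'n \<Rightarrow> 'n \<Rightarrow> 'n \<Rightarrow> real" where
  "cov2 G T x c a b = pd c (\<lambda>z. T z $ a $ b) x
      - (\<Sum>d\<in>UNIV. christoffel G x d c a * T x $ d $ b)
      - (\<Sum>d\<in>UNIV. christoffel G x d c b * T x $ a $ d)"

definition grad1 :: "(real^'n::finite \<Rightarrow> real) \<Rightarrow> 'n covector_field" where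
  "grad1 f x = (\<chi> i. pd i f x)"

definition tr2 :: "'n::finite tensor2_field \<Rightarrow> 'n tensor2_field \<Rightarrow> real^'n \<Rightarrow> real" where
  "tr2 G T x = (\<Sum>a\<in>UNIV. \<Sum>b\<in>UNIV. ginv G x $ a $ b * T x $ a $ b)"

definition norm1_sq :: "'n::finite tensor2_field \<Rightarrow> 'n covector_field \<Rightarrow> real^'n \<Rightarrow> real" where
  "norm1_sq G w x = (\<Sum>a\<in>UNIV. \<Sum>b\<in>UNIV. ginv G x $ a $ b * w x $ a * w x $ b)"

definition norm2_sq :: "'n::finite tensor2_field \<Rightarrow> 'n tensor2_field \<Rightarrow> real^'n \<Rightarrow> real" where
  "norm2_sq G T x = (\<Sum>a\<in>UNIV. \<Sum>b\<in>UNIV. \<Sum>c\<in>UNIV. \<Sum>d\<in>UNIV.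
      ginv G x $ a $ c * ginv G x $ b $ d * T x $ a $ b * T x $ c $ d)"

(* T_ab w^b *)
definition apply2 :: "'n::finite tensor2_field \<Rightarrow> 'n tensor2_field \<Rightarrow> 'n covector_field \<Rightarrow> 'n covector_field" where
  "apply2 G T w x = (\<chi> a. \<Sum>b\<in>UNIV. \<Sum>c\<in>UNIV. T x $ a $ b * ginv G x $ b $ c * w x $ c)"

(* nabla^a w_a *)
definition div1 :: "'n::finite tensor2_field \<Rightarrow> 'n covector_field \<Rightarrow> real^'n \<Rightarrow> real" where
  "div1 G w = tr2 G (cov1 G w)"

(* nabla^a T_ab *)
definition div2 :: "'n::finite tensor2_field \<Rightarrow> 'n tensor2_field \<Rightarrow> 'n covector_field" where
  "div2 G T x = (\<chi> b. \<Sum>c\<in>UNIV. \<Sum>a\<in>UNIV. ginv G x $ c $ a * cov2 G T x c a b)"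

definition lap :: "'n::finite tensor2_field \<Rightarrow> (real^'n \<Rightarrow> real) \<Rightarrow> real^'n \<Rightarrow> real" where
  "lap G f = div1 G (grad1 f)"

(* Sign convention: the Ricci tensor of a round sphere is positive. *)
definition ricci :: "'n::finite tensor2_field \<Rightarrow> 'n tensor2_field" where
  "ricci G x = (\<chi> i j.
       (\<Sum>k\<in>UNIV. pd k (\<lambda>z. christoffel G z k i j) x)
     - (\<Sum>k\<in>UNIV. pd j (\<lambda>z. christoffel G z k i k) x)
     + (\<Sum>k\<in>UNIV. \<Sum>l\<in>UNIV. christoffel G x k k l * christoffel G x l i j)
     - (\<Sum>k\<in>UNIV. \<Sum>l\<in>UNIV. christoffel G x k j l * christoffel G x l i k))"

(* The equation Ric = (d-2) P + g tr_g P determines P for d > 2: taking traces,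
   the scalar curvature is 2(d-1) tr_g P. *)
definition schouten :: "'n::finite tensor2_field \<Rightarrow> 'n tensor2_field" where
  "schouten G x = (THE P. ricci G x =
      (real CARD('n) - 2) *\<^sub>R P + (\<Sum>a\<in>UNIV. \<Sum>b\<in>UNIV. ginv G x $ a $ b * P $ a $ b) *\<^sub>R G x)"


section \<open>Hypersurface data in slice coordinates\<close>

text \<open>
  In a slice chart the surface is \<open>x $ 3 = 0\<close>, and \<open>(x $ 1, x $ 2)\<close> are coordinates on it, so
  restricting a covariant tensor to the tangent spaces of the surface means restricting its indices
  to 1 and 2. All operations with values on the surface are functions of \<open>y :: real^2\<close>.
\<close>

definition slice_emb :: "real^2 \<Rightarrow> real^3" where
  "slice_emb y = vector [y $ 1, y $ 2, 0]"

(* The numeral 2 of type 2 is 0; the two elements of the type are 1 and 2. *)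
definition tan_ix :: "2 \<Rightarrow> 3" where
  "tan_ix a = (if a = 1 then 1 else 2)"

definition tan_part :: "3 tensor2_field \<Rightarrow> 2 tensor2_field" where
  "tan_part T y = (\<chi> a b. T (slice_emb y) $ tan_ix a $ tan_ix b)"

(* The unit conormal dx^3 / |dx^3|, extended off the surface as conormal of the level sets of x^3.
   It depends on the chart through its sign; H and II change sign with it, so every quantity
   occurring in the operator is independent of that choice. *)
definition conormal :: "3 tensor2_field \<Rightarrow> 3 covector_field" where
  "conormal G x = axis 3 (1 / sqrt (ginv G x $ 3 $ 3))"

definition second_ff :: "3 tensor2_field \<Rightarrow> 2 tensor2_field" where
  "second_ff G = tan_part (cov1 G (conormal G))"

definition mean_curv :: "3 tensor2_field \<Rightarrow> real^2 \<Rightarrow> real" where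
  "mean_curv G y = (1/2) * tr2 (tan_part G) (second_ff G) y"

definition second_ff0 :: "3 tensor2_field \<Rightarrow> 2 tensor2_field" where
  "second_ff0 G y = second_ff G y - mean_curv G y *\<^sub>R tan_part G y"

definition K_inv :: "3 tensor2_field \<Rightarrow> real^2 \<Rightarrow> real" where
  "K_inv G = norm2_sq (tan_part G) (second_ff0 G)"

definition calP :: "3 tensor2_field \<Rightarrow> 2 tensor2_field" where
  "calP G y = tan_part (schouten G) y + mean_curv G y *\<^sub>R second_ff0 G y
      + (1/2 * (mean_curv G y)\<^sup>2) *\<^sub>R tan_part G y - (1/2 * K_inv G y) *\<^sub>R tan_part G y"

definition calJ :: "3 tensor2_field \<Rightarrow> real^2 \<Rightarrow> real" where
  "calJ G = tr2 (tan_part G) (calP G)"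

definition sqlap_coord :: "3 tensor2_field \<Rightarrow> (real^2 \<Rightarrow> real) \<Rightarrow> real^2 \<Rightarrow> real" where
  "sqlap_coord G f y = (let h = tan_part G; L = second_ff0 G in
      lap h (lap h f) y
    + 4 * div1 h (apply2 h (calP G) (grad1 f)) y
    + ( 2 * div1 h (div2 h (calP G)) y
      - lap h (calJ G) y
      + 2 * norm2_sq h (calP G) y
      - (calJ G y)\<^sup>2
      + 2 * div1 h (apply2 h L (div2 h L)) y
      + 2 * norm1_sq h (div2 h L) y
      + 1/4 * (K_inv G y)\<^sup>2 ) * f y)"


section \<open>Smooth three-manifolds, metrics, embedded surfaces\<close>

text \<open>A chart is a pair of an open set and a coordinate map, whose values off that set are
  irrelevant. The manifold is the whole type \<open>'m\<close>, with its topology.\<close>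

type_synonym 'm chart = "'m set \<times> ('m \<Rightarrow> real^3)"

definition chart_inv :: "'m chart \<Rightarrow> real^3 \<Rightarrow> 'm" where
  "chart_inv \<kappa> = inv_into (fst \<kappa>) (snd \<kappa>)"

definition is_chart :: "'m::topological_space chart \<Rightarrow> bool" where
  "is_chart \<kappa> \<longleftrightarrow> open (fst \<kappa>) \<and> open (snd \<kappa> ` fst \<kappa>) \<and>
     homeomorphism (fst \<kappa>) (snd \<kappa> ` fst \<kappa>) (snd \<kappa>) (chart_inv \<kappa>)"

definition transition :: "'m chart \<Rightarrow> 'm chart \<Rightarrow> real^3 \<Rightarrow> real^3" where
  "transition \<kappa> \<kappa>' = snd \<kappa>' \<circ> chart_inv \<kappa>"

definition compatible :: "'m chart \<Rightarrow> 'm chart \<Rightarrow> bool" where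
  "compatible \<kappa> \<kappa>' \<longleftrightarrow>
     smooth_on (snd \<kappa> ` (fst \<kappa> \<inter> fst \<kappa>')) (transition \<kappa> \<kappa>') \<and>
     smooth_on (snd \<kappa>' ` (fst \<kappa> \<inter> fst \<kappa>')) (transition \<kappa>' \<kappa>)"

definition smooth_structure :: "'m::topological_space chart set \<Rightarrow> bool" where
  "smooth_structure A \<longleftrightarrow>
     (\<forall>\<kappa>\<in>A. is_chart \<kappa>) \<and> (\<Union>\<kappa>\<in>A. fst \<kappa>) = UNIV \<and>
     (\<forall>\<kappa>\<in>A. \<forall>\<kappa>'\<in>A. compatible \<kappa> \<kappa>') \<and>
     (\<forall>\<kappa>. is_chart \<kappa> \<and> (\<forall>\<kappa>'\<in>A. compatible \<kappa> \<kappa>') \<longrightarrow> \<kappa> \<in> A)"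

definition smooth_fun :: "'m chart set \<Rightarrow> ('m \<Rightarrow> real) \<Rightarrow> bool" where
  "smooth_fun A u \<longleftrightarrow> (\<forall>\<kappa>\<in>A. smooth_on (snd \<kappa> ` fst \<kappa>) (u \<circ> chart_inv \<kappa>))"

(* A metric is the family of its component matrices with respect to all charts, as functions on the
   manifold; only the values at points of the chart domains matter. *)
type_synonym 'm metric = "'m chart \<Rightarrow> 'm \<Rightarrow> real^3^3"

definition metric_in :: "'m metric \<Rightarrow> 'm chart \<Rightarrow> 3 tensor2_field" where
  "metric_in g \<kappa> x = g \<kappa> (chart_inv \<kappa> x)"

definition riemannian_metric :: "'m chart set \<Rightarrow> 'm metric \<Rightarrow> bool" where
  "riemannian_metric A g \<longleftrightarrow>
     (\<forall>\<kappa>\<in>A. smooth_on (snd \<kappa> ` fst \<kappa>) (metric_in g \<kappa>)) \<and>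
     (\<forall>\<kappa>\<in>A. \<forall>p\<in>fst \<kappa>. transpose (g \<kappa> p) = g \<kappa> p \<and> (\<forall>v. v \<noteq> 0 \<longrightarrow> v \<bullet> (g \<kappa> p *v v) > 0)) \<and>
     (\<forall>\<kappa>\<in>A. \<forall>\<kappa>'\<in>A. \<forall>p\<in>fst \<kappa> \<inter> fst \<kappa>'.
        let D = matrix (frechet_derivative (transition \<kappa> \<kappa>') (at (snd \<kappa> p)))
        in g \<kappa> p = transpose D ** g \<kappa>' p ** D)"

definition rescale :: "('m \<Rightarrow> real) \<Rightarrow> 'm metric \<Rightarrow> 'm metric" where
  "rescale \<Omega> g \<kappa> p = (\<Omega> p)\<^sup>2 *\<^sub>R g \<kappa> p"

definition positive_fun :: "'m chart set \<Rightarrow> ('m \<Rightarrow> real) \<Rightarrow> bool" where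
  "positive_fun A \<Omega> \<longleftrightarrow> smooth_fun A \<Omega> \<and> (\<forall>p. \<Omega> p > 0)"

definition conformal_class :: "'m chart set \<Rightarrow> 'm metric set \<Rightarrow> bool" where
  "conformal_class A C \<longleftrightarrow> (\<exists>g0. riemannian_metric A g0 \<and>
     C = {g. riemannian_metric A g \<and>
             (\<exists>\<Omega>. positive_fun A \<Omega> \<and> (\<forall>\<kappa>\<in>A. \<forall>p\<in>fst \<kappa>. g \<kappa> p = rescale \<Omega> g0 \<kappa> p))})"

definition slice_charts :: "'m chart set \<Rightarrow> 'm set \<Rightarrow> 'm chart set" where
  "slice_charts A S = {\<kappa>\<in>A. snd \<kappa> ` (fst \<kappa> \<inter> S) = snd \<kappa> ` fst \<kappa> \<inter> {x. x $ 3 = 0}}"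

definition embedded_surface :: "'m chart set \<Rightarrow> 'm set \<Rightarrow> bool" where
  "embedded_surface A S \<longleftrightarrow> (\<forall>p\<in>S. \<exists>\<kappa>\<in>slice_charts A S. p \<in> fst \<kappa>)"

definition slice_dom :: "'m chart \<Rightarrow> (real^2) set" where
  "slice_dom \<kappa> = {y. slice_emb y \<in> snd \<kappa> ` fst \<kappa>}"

definition slice_param :: "'m chart \<Rightarrow> real^2 \<Rightarrow> 'm" where
  "slice_param \<kappa> y = chart_inv \<kappa> (slice_emb y)"

definition slice_coord :: "'m chart \<Rightarrow> 'm \<Rightarrow> real^2" where
  "slice_coord \<kappa> p = (\<chi> a. snd \<kappa> p $ tan_ix a)"

(* Smooth functions on S; being \<open>extensional\<close> they are determined by their values on S. *)
definition smooth_funs_on :: "'m chart set \<Rightarrow> 'm set \<Rightarrow> ('m \<Rightarrow> real) set" where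
  "smooth_funs_on A S = {f \<in> extensional S.
     \<forall>\<kappa>\<in>slice_charts A S. smooth_on (slice_dom \<kappa>) (f \<circ> slice_param \<kappa>)}"


section \<open>The operator\<close>

(* The value at p of the displayed expression: the number obtained in every slice chart around p. *)
definition sqlap :: "'m chart set \<Rightarrow> 'm set \<Rightarrow> 'm metric \<Rightarrow> ('m \<Rightarrow> real) \<Rightarrow> 'm \<Rightarrow> real" where
  "sqlap A S g f = (\<lambda>p\<in>S. THE v. \<forall>\<kappa>\<in>slice_charts A S. p \<in> fst \<kappa> \<longrightarrow>
      v = sqlap_coord (metric_in g \<kappa>) (f \<circ> slice_param \<kappa>) (slice_coord \<kappa> p))"


section \<open>Densities on the surface\<close>

type_synonym 'm surface_metric = "'m chart \<Rightarrow> 'm \<Rightarrow> real^2^2"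

(* Components in slice charts; set to 0 where they have no meaning, so that two induced metrics are
   equal as HOL objects iff they agree on S. *)
definition induced :: "'m chart set \<Rightarrow> 'm set \<Rightarrow> 'm metric \<Rightarrow> 'm surface_metric" where
  "induced A S g \<kappa> p = (if \<kappa> \<in> slice_charts A S \<and> p \<in> fst \<kappa> \<inter> S
      then \<chi> a b. g \<kappa> p $ tan_ix a $ tan_ix b else 0)"

definition density_class :: "'m chart set \<Rightarrow> 'm metric set \<Rightarrow> 'm set \<Rightarrow> real \<Rightarrow>
    'm surface_metric \<Rightarrow> ('m \<Rightarrow> real) \<Rightarrow> ('m surface_metric \<times> ('m \<Rightarrow> real)) set" where
  "density_class A C S w h f = {(h', f'). h' \<in> induced A S ` C \<and> f' \<in> extensional S \<and>
     (\<exists>\<Omega>\<in>smooth_funs_on A S. (\<forall>p\<in>S. \<Omega> p > 0) \<and>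
        (\<forall>\<kappa>. \<forall>p\<in>S. h' \<kappa> p = (\<Omega> p)\<^sup>2 *\<^sub>R h \<kappa> p) \<and>
        (\<forall>p\<in>S. f' p = \<Omega> p powr w * f p))}"

definition densities :: "'m chart set \<Rightarrow> 'm metric set \<Rightarrow> 'm set \<Rightarrow> real \<Rightarrow>
    ('m surface_metric \<times> ('m \<Rightarrow> real)) set set" where
  "densities A C S w = {density_class A C S w (induced A S g) f |g f. g \<in> C \<and> f \<in> smooth_funs_on A S}"

end

theory Submission
  imports Defs
begin

text \<open>
  Let \<open>h\<close> be the induced metric, \<open>L\<close> the trace-free second fundamental form, \<open>q = \<nabla>\<cdot>L\<close>, \<open>K = |L|\<^sup>2\<close>, and
  \<open>Q\<close> the trace-free part of \<open>calP\<close>. The Gauss equation gives \<open>calJ = \<kappa> - K/2\<close> with \<open>\<kappa>\<close> the Gauss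
  curvature of \<open>h\<close>. Put \<open>A = tf (\<nabla>\<nabla>f) + f Q\<close> and \<open>v = f q - L(\<nabla>f)\<close>, where \<open>tf\<close> is the trace-free part. By the
  Bochner formula and \<open>L\<^sub>a\<^sub>c L\<^sub>c\<^sub>b = (K/2) h\<^sub>a\<^sub>b\<close> (a trace-free symmetric tensor in dimension two squares to a
  multiple of the metric), the operator is
  \<open>2 (\<nabla>\<nabla> + Q)\<cdot>A + 2 (\<nabla>\<cdot>(L v) + q\<cdot>v) + K\<^sup>2 f / 4\<close>.
  Under \<open>g \<mapsto> \<Omega>\<^sup>2 g\<close>, \<open>f \<mapsto> \<Omega> f\<close>, with \<open>u = d (ln \<Omega>)\<close>, one has \<open>L \<mapsto> \<Omega> L\<close>, \<open>Q \<mapsto> Q - tf (\<nabla>u) + tf (u \<otimes> u)\<close> and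
  \<open>q \<mapsto> (q + L u) / \<Omega>\<close>, hence \<open>A \<mapsto> \<Omega> A\<close> and \<open>v \<mapsto> v\<close>, and each of the three summands is
  multiplied by \<open>\<Omega>\<^sup>-\<^sup>3\<close>.
\<close>

section \<open>Calculus of smooth functions\<close>

text \<open>The factorisation has a structural source. On trace-free symmetric \<open>T\<close> the
  map \<open>T \<mapsto> \<nabla>\<cdot>(\<nabla>\<cdot>T) + Q\<cdot>T\<close> is the formal adjoint
  of \<open>f \<mapsto> A\<close>, and \<open>w \<mapsto> \<nabla>\<cdot>(L w) + q\<cdot>w\<close>
  is that of \<open>f \<mapsto> v\<close>. Each differential summand is thus a covariant operator
  followed by its adjoint, and the cross terms in \<open>u\<close> cancel within each pair. The last
  summand is covariant because \<open>K\<close> has weight -2 and \<open>f\<close> weight 1. Two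
  obstacles shape the proof. The operator is read off in every slice chart, so each ingredient has
  to be natural under changes of slice coordinates. The conormal, and with it \<open>L\<close> and
  the mean curvature, is natural only up to a sign; this is harmless since \<open>L\<close> enters
  in pairs and the mean curvature enters squared or next to \<open>L\<close>. Secondly, in dimension
  three the curvature identities are rational in the metric; at a point where the metric is the
  identity they become polynomial. The normalising change of coordinates must preserve the slice,
  and naturality carries the result back.\<close>

lemma pd_eqI: "(F has_derivative F') (at x) \<Longrightarrow> pd i F x = F' (axis i 1)"
  unfolding pd_def by (simp add: frechet_derivative_at[symmetric])

lemma pd_cong_open:
  assumes "open X" "x \<in> X" "\<And>z. z \<in> X \<Longrightarrow> F z = G z"
  shows "pd i F x = pd i G x"
proof (cases "F differentiable (at x)")
  case True
  then obtain D where D: "(F has_derivative D) (at x)" unfolding differentiable_def by blast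
  have "(G has_derivative D) (at x)"
    by (rule has_derivative_transform_within_open[OF D assms(1,2)]) (use assms in auto)
  then show ?thesis using D by (simp add: pd_eqI)
next
  case False
  \<comment> \<open>\<open>frechet_derivative\<close> is a Hilbert choice among all derivatives at
    the point. Both functions have the same derivatives, so the same choice is made for
    both.\<close>
  have *: "(F has_derivative D) (at x) \<longleftrightarrow> (G has_derivative D) (at x)" for D
    using has_derivative_transform_within_open[OF _ assms(1,2)] assms(3) by metis
  show ?thesis unfolding pd_def frechet_derivative_def * ..
qed

lemma differentiable_cong_open:
  assumes "open X" "x \<in> X" "\<And>z. z \<in> X \<Longrightarrow> F z = G z"
  shows "F differentiable (at x) \<longleftrightarrow> G differentiable (at x)"
  unfolding differentiable_def
  using has_derivative_transform_within_open[OF _ assms(1,2)] assms(3) by metis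

lemma frechet_has_derivative: "F differentiable (at x) \<Longrightarrow> (F has_derivative frechet_derivative F (at x)) (at x)"
  by (simp add: frechet_derivative_works)

section \<open>Rules for partial derivatives\<close>

lemma pd_const [simp]: "pd i (\<lambda>z. c) x = 0"
  by (rule pd_eqI[where F'="\<lambda>_. 0"]) simp

lemma pd_add [simp]: "F differentiable (at x) \<Longrightarrow> G differentiable (at x) \<Longrightarrow>
    pd i (\<lambda>z. F z + G z) x = pd i F x + pd i G x"
  by (subst pd_eqI[OF has_derivative_add[OF frechet_has_derivative frechet_has_derivative]])
     (auto simp: pd_def)

lemma pd_diff [simp]: "F differentiable (at x) \<Longrightarrow> G differentiable (at x) \<Longrightarrow>
    pd i (\<lambda>z. F z - G z) x = pd i F x - pd i G x"
  by (subst pd_eqI[OF has_derivative_diff[OF frechet_has_derivative frechet_has_derivative]])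
     (auto simp: pd_def)

lemma pd_minus [simp]: "F differentiable (at x) \<Longrightarrow> pd i (\<lambda>z. - F z) x = - pd i F x"
  by (subst pd_eqI[OF has_derivative_minus[OF frechet_has_derivative]])
     (auto simp: pd_def)

lemma pd_mult [simp]:
  fixes F G :: "real^'n::finite \<Rightarrow> real"
  shows "F differentiable (at x) \<Longrightarrow> G differentiable (at x) \<Longrightarrow>
    pd i (\<lambda>z. F z * G z) x = pd i F x * G x + F x * pd i G x"
  by (subst pd_eqI[OF has_derivative_mult[OF frechet_has_derivative frechet_has_derivative]])
     (auto simp: pd_def)

lemma pd_sum [simp]:
  "(\<And>k. k \<in> I \<Longrightarrow> F k differentiable (at x)) \<Longrightarrow>
    pd i (\<lambda>z. \<Sum>k\<in>I. F k z) x = (\<Sum>k\<in>I. pd i (F k) x)"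
  by (subst pd_eqI[OF has_derivative_sum[OF frechet_has_derivative]])
     (auto simp: pd_def)

lemma pd_real_comp:
  fixes F :: "real^'n::finite \<Rightarrow> real"
  assumes "F differentiable (at x)" "(u has_real_derivative u') (at (F x))"
  shows "pd i (\<lambda>z. u (F z)) x = u' * pd i F x" "(\<lambda>z. u (F z)) differentiable (at x)"
proof -
  have "((\<lambda>z. u (F z)) has_derivative (\<lambda>h. u' * frechet_derivative F (at x) h)) (at x)"
    using has_derivative_compose[OF frechet_has_derivative[OF assms(1)] assms(2)[unfolded has_field_derivative_def]]
    by simp
  then show "pd i (\<lambda>z. u (F z)) x = u' * pd i F x" "(\<lambda>z. u (F z)) differentiable (at x)"
    by (auto simp: pd_eqI differentiable_def) (simp add: pd_def)
qed

lemma pd_inverse [simp]: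
  fixes F :: "real^'n::finite \<Rightarrow> real"
  assumes "F differentiable (at x)" "F x \<noteq> 0"
  shows "pd i (\<lambda>z. inverse (F z)) x = - (inverse (F x) * inverse (F x)) * pd i F x"
  using pd_real_comp(1)[OF assms(1) DERIV_inverse[OF assms(2)]] by (simp add: numeral_2_eq_2)

lemma pd_sqrt:
  fixes F :: "real^'n::finite \<Rightarrow> real"
  assumes "F differentiable (at x)" "F x > 0"
  shows "pd i (\<lambda>z. sqrt (F z)) x = inverse (sqrt (F x)) * (1/2) * pd i F x"
    and "(\<lambda>z. sqrt (F z)) differentiable (at x)"
  using pd_real_comp[OF assms(1) DERIV_real_sqrt[OF assms(2)]] by auto

lemma differentiable_nth [simp]:
  fixes F :: "real^'n::finite \<Rightarrow> 'b::euclidean_space^'m::finite"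
  assumes "F differentiable (at x)"
  shows "(\<lambda>z. F z $ j) differentiable (at x)"
  using bounded_linear.has_derivative[OF bounded_linear_vec_nth frechet_has_derivative[OF assms]]
  unfolding differentiable_def by blast

lemma pd_nth:
  fixes F :: "real^'n::finite \<Rightarrow> 'b::euclidean_space^'m::finite"
  assumes "F differentiable (at x)"
  shows "pd i (\<lambda>z. F z $ j) x = pd i F x $ j"
  using pd_eqI[OF bounded_linear.has_derivative[OF bounded_linear_vec_nth frechet_has_derivative[OF assms]]]
  by (simp add: pd_def)

lemma pd_coord [simp]: "pd i (\<lambda>z. z $ j) x = (if i = j then 1 else 0)"
  by (subst pd_eqI[OF bounded_linear.has_derivative[OF bounded_linear_vec_nth has_derivative_ident]])
     (simp add: axis_def eq_commute)

lemma linear_axis_sum: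
  fixes L :: "real^'n::finite \<Rightarrow> 'b::real_normed_vector"
  assumes "linear L"
  shows "L v = (\<Sum>j\<in>UNIV. v $ j *\<^sub>R L (axis j 1))"
proof -
  have "L v = L (\<Sum>j\<in>UNIV. v $ j *\<^sub>R axis j 1)"
    using basis_expansion[of v] by (simp add: scalar_mult_eq_scaleR)
  also have "\<dots> = (\<Sum>j\<in>UNIV. v $ j *\<^sub>R L (axis j 1))"
    using assms by (simp add: linear_sum linear_scale)
  finally show ?thesis .
qed

lemma frechet_derivative_axis_sum:
  assumes "F differentiable (at x)"
  shows "frechet_derivative F (at x) v = (\<Sum>j\<in>UNIV. v $ j *\<^sub>R pd j F x)"
  unfolding pd_def using linear_axis_sum[OF linear_frechet_derivative[OF assms]] .

lemma differentiable_vecI: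
  fixes \<phi> :: "real^'n::finite \<Rightarrow> real^'m::finite"
  assumes "\<And>j. (\<lambda>z. \<phi> z $ j) differentiable (at x)"
  shows "\<phi> differentiable (at x)"
proof -
  obtain D where D: "\<And>j. ((\<lambda>z. \<phi> z $ j) has_derivative D j) (at x)"
    using assms unfolding differentiable_def by metis
  have "(\<phi> has_derivative (\<lambda>h. \<chi> j. D j h)) (at x)"
    unfolding has_derivative_componentwise_within[of \<phi>]
    using D by (auto simp: Basis_vec_def inner_axis)
  then show ?thesis unfolding differentiable_def by blast
qed

lemma pd_comp:
  fixes \<phi> :: "real^'n::finite \<Rightarrow> real^'m::finite" and F :: "real^'m::finite \<Rightarrow> real"
  assumes "\<And>j. (\<lambda>z. \<phi> z $ j) differentiable (at x)" "F differentiable (at (\<phi> x))"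
  shows "pd i (\<lambda>z. F (\<phi> z)) x = (\<Sum>j\<in>UNIV. pd j F (\<phi> x) * pd i (\<lambda>z. \<phi> z $ j) x)"
    and "(\<lambda>z. F (\<phi> z)) differentiable (at x)"
proof -
  have d: "\<phi> differentiable (at x)" using assms(1) by (rule differentiable_vecI)
  have *: "((\<lambda>z. F (\<phi> z)) has_derivative (\<lambda>h. frechet_derivative F (at (\<phi> x)) (frechet_derivative \<phi> (at x) h))) (at x)"
    using has_derivative_compose[OF frechet_has_derivative[OF d] frechet_has_derivative[OF assms(2)]] .
  show "pd i (\<lambda>z. F (\<phi> z)) x = (\<Sum>j\<in>UNIV. pd j F (\<phi> x) * pd i (\<lambda>z. \<phi> z $ j) x)"
    by (simp add: pd_eqI[OF *] frechet_derivative_axis_sum[OF assms(2)] pd_nth[OF d])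
       (simp add: pd_def mult.commute)
  show "(\<lambda>z. F (\<phi> z)) differentiable (at x)" using * unfolding differentiable_def by blast
qed

section \<open>Iterated differentiability and closure properties of smooth functions\<close>

primrec diff_upto :: "nat \<Rightarrow> (real^'n::finite) set \<Rightarrow> (real^'n \<Rightarrow> 'b::real_normed_vector) \<Rightarrow> bool" where
  "diff_upto 0 X F \<longleftrightarrow> (\<forall>x\<in>X. F differentiable (at x))"
| "diff_upto (Suc k) X F \<longleftrightarrow> (\<forall>x\<in>X. F differentiable (at x)) \<and> (\<forall>i. diff_upto k X (pd i F))"

text \<open>The recursive form makes induction on the order possible: the derivative of a product,
  inverse, root or composite is built from the same kind of expression and from derivatives of the
  ingredients, all of one order less.\<close>

lemma diff_upto_iff:
  "diff_upto k X F \<longleftrightarrow> (\<forall>ks. length ks \<le> k \<longrightarrow> (\<forall>x\<in>X. foldr pd ks F differentiable (at x)))"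
proof (induction k arbitrary: F)
  case (Suc k)
  show ?case
  proof
    assume L: "diff_upto (Suc k) X F"
    show "\<forall>ks. length ks \<le> Suc k \<longrightarrow> (\<forall>x\<in>X. foldr pd ks F differentiable (at x))"
    proof (intro allI impI ballI)
      \<comment> \<open>\<open>foldr\<close> applies the last list entry first, so peeling the
        innermost derivative off means splitting the list at its end.\<close>
      fix ks x assume "length (ks :: 'a list) \<le> Suc k" "x \<in> X"
      then show "foldr pd ks F differentiable (at x)"
        using L Suc by (cases ks rule: rev_cases) auto
    qed
  next
    assume R: "\<forall>ks. length ks \<le> Suc k \<longrightarrow> (\<forall>x\<in>X. foldr pd ks F differentiable (at x))"
    have "diff_upto k X (pd i F)" for i
      unfolding Suc
    proof (intro allI impI ballI)
      fix ks x assume "length (ks :: 'a list) \<le> k" "x \<in> X"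
      then show "foldr pd ks (pd i F) differentiable (at x)"
        using R[rule_format, of "ks @ [i]" x] by auto
    qed
    then show "diff_upto (Suc k) X F" using R[rule_format, of "[]"] by auto
  qed
qed auto

lemma smooth_on_iff_upto: "smooth_on X F \<longleftrightarrow> open X \<and> (\<forall>k. diff_upto k X F)"
  unfolding smooth_on_def diff_upto_iff by auto

lemma diff_upto_cong:
  assumes "open X" "\<And>z. z \<in> X \<Longrightarrow> F z = G z"
  shows "diff_upto k X F \<longleftrightarrow> diff_upto k X G"
  using assms(2)
proof (induction k arbitrary: F G)
  case 0
  have "F differentiable (at x) \<longleftrightarrow> G differentiable (at x)" if "x \<in> X" for x
    by (rule differentiable_cong_open[OF assms(1) that 0])
  then show ?case by simp
next
  case (Suc k)
  have *: "F differentiable (at x) \<longleftrightarrow> G differentiable (at x)" if "x \<in> X" for x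
    by (rule differentiable_cong_open[OF assms(1) that Suc.prems])
  have "diff_upto k X (pd i F) \<longleftrightarrow> diff_upto k X (pd i G)" for i
    by (rule Suc.IH) (rule pd_cong_open[OF assms(1) _ Suc.prems])
  with * show ?case by simp
qed

lemma diff_upto_congI:
  assumes "open X" "diff_upto k X G" "\<And>z. z \<in> X \<Longrightarrow> F z = G z"
  shows "diff_upto k X F"
  using diff_upto_cong[OF assms(1,3)] assms(2) by simp

lemma diff_upto_SucD: "diff_upto (Suc k) X F \<Longrightarrow> diff_upto k X F"
  unfolding diff_upto_iff by auto

lemma diff_upto_diff: "diff_upto k X F \<Longrightarrow> x \<in> X \<Longrightarrow> F differentiable (at x)"
  by (cases k) auto

lemma diff_upto_const: "diff_upto k X (\<lambda>z. c)"
proof (induction k arbitrary: c)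
  case (Suc k)
  have *: "pd i (\<lambda>z. c) = (\<lambda>z. 0)" for i by (rule ext) simp
  have "diff_upto k X (pd i (\<lambda>z. c))" for i unfolding * by (rule Suc)
  then show ?case by simp
qed simp

lemma diff_upto_add:
  assumes "open X"
  shows "diff_upto k X F \<Longrightarrow> diff_upto k X G \<Longrightarrow> diff_upto k X (\<lambda>z. F z + G z)"
proof (induction k arbitrary: F G)
  case (Suc k)
  have "diff_upto k X (pd i (\<lambda>z. F z + G z))" for i
  proof (rule diff_upto_congI[OF assms])
    show "diff_upto k X (\<lambda>z. pd i F z + pd i G z)"
      by (intro Suc.IH) (use Suc.prems in simp_all)
  qed (use Suc.prems in simp)
  then show ?case using Suc.prems by simp
qed simp

lemma diff_upto_mult:
  fixes F G :: "real^'n::finite \<Rightarrow> real"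
  assumes "open X"
  shows "diff_upto k X F \<Longrightarrow> diff_upto k X G \<Longrightarrow> diff_upto k X (\<lambda>z. F z * G z)"
proof (induction k arbitrary: F G)
  case (Suc k)
  have "diff_upto k X (pd i (\<lambda>z. F z * G z))" for i
  proof (rule diff_upto_congI[OF assms])
    show "diff_upto k X (\<lambda>z. pd i F z * G z + F z * pd i G z)"
      by (intro diff_upto_add[OF assms] Suc.IH Suc.prems[THEN diff_upto_SucD]) (use Suc.prems in simp_all)
  qed (use Suc.prems in simp)
  then show ?case using Suc.prems by simp
qed simp

text \<open>The derivative of \<open>1/F\<close> is a product of \<open>F'\<close> with two copies
  of \<open>1/F\<close> itself, to which the induction hypothesis applies.\<close>

lemma diff_upto_inverse:
  fixes F :: "real^'n::finite \<Rightarrow> real"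
  assumes "open X" "\<And>x. x \<in> X \<Longrightarrow> F x \<noteq> 0"
  shows "diff_upto k X F \<Longrightarrow> diff_upto k X (\<lambda>z. inverse (F z))"
proof (induction k)
  case (Suc k)
  have k: "diff_upto k X (\<lambda>z. inverse (F z))" by (rule Suc.IH[OF diff_upto_SucD[OF Suc.prems]])
  have "diff_upto k X (pd i (\<lambda>z. inverse (F z)))" for i
  proof (rule diff_upto_congI[OF assms(1)])
    show "diff_upto k X (\<lambda>z. (- 1) * (inverse (F z) * inverse (F z)) * pd i F z)"
      by (intro diff_upto_mult[OF assms(1)] diff_upto_const k) (use Suc.prems in simp)
  qed (use Suc.prems assms(2) in simp)
  then show ?case using Suc.prems assms(2) by auto
qed (use assms(2) in auto)

lemma diff_upto_sqrt:
  fixes F :: "real^'n::finite \<Rightarrow> real"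
  assumes "open X" "\<And>x. x \<in> X \<Longrightarrow> F x > 0"
  shows "diff_upto k X F \<Longrightarrow> diff_upto k X (\<lambda>z. sqrt (F z))"
proof (induction k)
  case (Suc k)
  have k: "diff_upto k X (\<lambda>z. sqrt (F z))" by (rule Suc.IH[OF diff_upto_SucD[OF Suc.prems]])
  have k': "diff_upto k X (\<lambda>z. inverse (sqrt (F z)))"
    by (rule diff_upto_inverse[OF assms(1) _ k]) (use assms(2) in force)
  have "diff_upto k X (pd i (\<lambda>z. sqrt (F z)))" for i
  proof (rule diff_upto_congI[OF assms(1)])
    show "diff_upto k X (\<lambda>z. inverse (sqrt (F z)) * (1/2) * pd i F z)"
      by (intro diff_upto_mult[OF assms(1)] diff_upto_const k') (use Suc.prems in simp)
  qed (use Suc.prems assms(2) in \<open>simp add: pd_sqrt\<close>)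
  then show ?case using Suc.prems assms(2) by (auto intro: pd_sqrt(2))
qed (use assms(2) in \<open>auto intro: pd_sqrt(2)\<close>)

lemma diff_upto_sum:
  assumes "open X" "\<And>k. k \<in> I \<Longrightarrow> diff_upto m X (F k)"
  shows "diff_upto m X (\<lambda>z. \<Sum>k\<in>I. F k z)"
  using assms(2)
  by (induction I rule: infinite_finite_induct) (simp_all add: diff_upto_const diff_upto_add[OF assms(1)])

lemma diff_upto_comp:
  fixes F :: "real^'m::finite \<Rightarrow> real" and \<phi> :: "real^'n::finite \<Rightarrow> real^'m"
  assumes X: "open X" and sub: "\<phi> ` X \<subseteq> Y"
  shows "diff_upto k Y F \<Longrightarrow> (\<And>j. diff_upto k X (\<lambda>z. \<phi> z $ j)) \<Longrightarrow> diff_upto k X (\<lambda>z. F (\<phi> z))"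
proof (induction k arbitrary: F)
  case 0
  have "(\<lambda>z. F (\<phi> z)) differentiable (at x)" if "x \<in> X" for x
    by (rule pd_comp(2)[of \<phi> x F]) (use 0 that sub in auto)
  then show ?case by simp
next
  case (Suc k)
  have d1: "(\<lambda>z. \<phi> z $ j) differentiable (at x)" if "x \<in> X" for x j
    using Suc.prems(2)[of j] that by simp
  have d2: "F differentiable (at (\<phi> x))" if "x \<in> X" for x
    using Suc.prems(1) that sub by auto
  have d: "(\<lambda>z. F (\<phi> z)) differentiable (at x)" if "x \<in> X" for x
    by (rule pd_comp(2)[of \<phi> x F, OF d1[OF that] d2[OF that]])
  have "diff_upto k X (pd i (\<lambda>z. F (\<phi> z)))" for i
  proof (rule diff_upto_congI[OF X])
    have "diff_upto k X (\<lambda>z. pd j F (\<phi> z))" for j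
      by (rule Suc.IH) (use Suc.prems(1) diff_upto_SucD[OF Suc.prems(2)] in simp_all)
    moreover have "diff_upto k X (\<lambda>z. pd i (\<lambda>z. \<phi> z $ j) z)" for j
      using Suc.prems(2)[of j] by simp
    ultimately show "diff_upto k X (\<lambda>z. \<Sum>j\<in>UNIV. pd j F (\<phi> z) * pd i (\<lambda>z. \<phi> z $ j) z)"
      by (intro diff_upto_sum diff_upto_mult X)
  qed (rule pd_comp(1)[of \<phi> _ F, OF d1 d2])
  then show ?case using d by simp
qed

lemma smooth_on_open: "smooth_on X F \<Longrightarrow> open X"
  by (simp add: smooth_on_def)

lemma smooth_on_diff: "smooth_on X F \<Longrightarrow> x \<in> X \<Longrightarrow> F differentiable (at x)"
  unfolding smooth_on_iff_upto using diff_upto_diff by blast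

lemma smooth_on_pd: "smooth_on X F \<Longrightarrow> smooth_on X (\<lambda>z. pd i F z)"
  unfolding smooth_on_iff_upto by (metis diff_upto.simps(2))

lemma smooth_on_cong:
  assumes "smooth_on X F" "\<And>z. z \<in> X \<Longrightarrow> F z = G z"
  shows "smooth_on X G"
proof -
  have X: "open X" by (rule smooth_on_open[OF assms(1)])
  have "diff_upto k X F \<longleftrightarrow> diff_upto k X G" for k by (rule diff_upto_cong[OF X assms(2)])
  then show ?thesis using assms(1) unfolding smooth_on_iff_upto by blast
qed

lemma smooth_on_subset: "smooth_on X F \<Longrightarrow> open Y \<Longrightarrow> Y \<subseteq> X \<Longrightarrow> smooth_on Y F"
  unfolding smooth_on_def by auto

lemma smooth_on_const: "open X \<Longrightarrow> smooth_on X (\<lambda>z. c)"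
  by (simp add: smooth_on_iff_upto diff_upto_const)

lemma smooth_on_add: "smooth_on X F \<Longrightarrow> smooth_on X G \<Longrightarrow> smooth_on X (\<lambda>z. F z + G z)"
  by (simp add: smooth_on_iff_upto diff_upto_add)

lemma smooth_on_mult: "smooth_on X F \<Longrightarrow> smooth_on X G \<Longrightarrow> smooth_on X (\<lambda>z. F z * G z)"
  for F :: "real^'n::finite \<Rightarrow> real"
  by (simp add: smooth_on_iff_upto diff_upto_mult)

lemma smooth_on_minus: "smooth_on X F \<Longrightarrow> smooth_on X (\<lambda>z. - F z)"
  for F :: "real^'n::finite \<Rightarrow> real"
  using smooth_on_mult[OF smooth_on_const[of X "-1"], of F] smooth_on_open by auto

lemma smooth_on_sub: "smooth_on X F \<Longrightarrow> smooth_on X G \<Longrightarrow> smooth_on X (\<lambda>z. F z - G z)"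
  for F :: "real^'n::finite \<Rightarrow> real"
  using smooth_on_add[OF _ smooth_on_minus, of X F G] by auto

lemma smooth_on_inverse:
  "smooth_on X F \<Longrightarrow> (\<And>x. x \<in> X \<Longrightarrow> F x \<noteq> 0) \<Longrightarrow> smooth_on X (\<lambda>z. inverse (F z))"
  for F :: "real^'n::finite \<Rightarrow> real"
  by (simp add: smooth_on_iff_upto diff_upto_inverse)

lemma smooth_on_divide:
  "smooth_on X F \<Longrightarrow> smooth_on X G \<Longrightarrow> (\<And>x. x \<in> X \<Longrightarrow> G x \<noteq> 0) \<Longrightarrow> smooth_on X (\<lambda>z. F z / G z)"
  for F :: "real^'n::finite \<Rightarrow> real"
  unfolding divide_inverse by (intro smooth_on_mult smooth_on_inverse)

lemma smooth_on_sqrt: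
  "smooth_on X F \<Longrightarrow> (\<And>x. x \<in> X \<Longrightarrow> F x > 0) \<Longrightarrow> smooth_on X (\<lambda>z. sqrt (F z))"
  for F :: "real^'n::finite \<Rightarrow> real"
  by (simp add: smooth_on_iff_upto diff_upto_sqrt)

lemma smooth_on_sum:
  "open X \<Longrightarrow> (\<And>k. k \<in> I \<Longrightarrow> smooth_on X (F k)) \<Longrightarrow> smooth_on X (\<lambda>z. \<Sum>k\<in>I. F k z)"
  by (simp add: smooth_on_iff_upto diff_upto_sum)

lemma smooth_on_prod:
  "open X \<Longrightarrow> (\<And>k. k \<in> I \<Longrightarrow> smooth_on X (F k)) \<Longrightarrow> smooth_on X (\<lambda>z. \<Prod>k\<in>I. F k z)"
  for F :: "'a \<Rightarrow> real^'n::finite \<Rightarrow> real"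
  by (induction I rule: infinite_finite_induct) (auto intro: smooth_on_const smooth_on_mult)

lemma smooth_on_power: "smooth_on X F \<Longrightarrow> smooth_on X (\<lambda>z. F z ^ k)"
  for F :: "real^'n::finite \<Rightarrow> real"
  by (induction k) (auto intro: smooth_on_const smooth_on_mult smooth_on_open)

lemma smooth_on_comp:
  fixes F :: "real^'m::finite \<Rightarrow> real" and \<phi> :: "real^'n::finite \<Rightarrow> real^'m"
  assumes "smooth_on Y F" "\<And>j. smooth_on X (\<lambda>z. \<phi> z $ j)" "\<phi> ` X \<subseteq> Y"
  shows "smooth_on X (\<lambda>z. F (\<phi> z))"
  using assms(1,2) diff_upto_comp[OF _ assms(3)] unfolding smooth_on_iff_upto by simp

lemma smooth_on_coord: "open X \<Longrightarrow> smooth_on X (\<lambda>z. z $ j)"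
proof -
  assume X: "open X"
  have "diff_upto k X (\<lambda>z. z $ j)" for k
  proof (cases k)
    case (Suc k')
    have *: "pd i (\<lambda>z. z $ j) = (\<lambda>z. if i = j then 1 else 0)" for i by (rule ext) simp
    have "diff_upto k' X (pd i (\<lambda>z. z $ j))" for i unfolding * by (rule diff_upto_const)
    then show ?thesis using Suc by simp
  qed simp
  then show ?thesis using X by (simp add: smooth_on_iff_upto)
qed

lemma smooth_on_nth:
  fixes F :: "real^'n::finite \<Rightarrow> 'b::euclidean_space^'m::finite"
  assumes "smooth_on X F"
  shows "smooth_on X (\<lambda>z. F z $ j)"
proof -
  have "diff_upto k X F \<Longrightarrow> diff_upto k X (\<lambda>z. F z $ j)" for k
  proof (induction k arbitrary: F)
    case (Suc k)
    have d: "F differentiable (at x)" if "x \<in> X" for x using Suc.prems that by simp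
    have "diff_upto k X (\<lambda>z. pd i F z $ j)" for i
      by (rule Suc.IH) (use Suc.prems in simp)
    then have "diff_upto k X (pd i (\<lambda>z. F z $ j))" for i
      using diff_upto_cong[OF smooth_on_open[OF assms], of "pd i (\<lambda>z. F z $ j)" "\<lambda>z. pd i F z $ j"] pd_nth[OF d]
      by blast
    then show ?case using differentiable_nth[OF d] by simp
  qed simp
  then show ?thesis using assms by (simp add: smooth_on_iff_upto)
qed

lemmas smooth_intros = smooth_on_const smooth_on_add smooth_on_mult smooth_on_minus smooth_on_sub
  smooth_on_sum smooth_on_coord smooth_on_power smooth_on_pd

section \<open>Symmetry of second partial derivatives\<close>

lemma pd_line:
  fixes F :: "real^'n::finite \<Rightarrow> real"
  assumes "F differentiable (at (a + s *\<^sub>R axis i 1))"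
  shows "((\<lambda>s. F (a + s *\<^sub>R axis i 1)) has_real_derivative pd i F (a + s *\<^sub>R axis i 1)) (at s)"
proof -
  have "((\<lambda>s. a + s *\<^sub>R axis i 1) has_derivative (\<lambda>h. h *\<^sub>R axis i (1::real))) (at s)"
    by (auto intro!: derivative_eq_intros)
  from has_derivative_compose[OF this frechet_has_derivative[OF assms]]
  have "((\<lambda>s. F (a + s *\<^sub>R axis i 1)) has_derivative (\<lambda>h. frechet_derivative F (at (a + s *\<^sub>R axis i 1)) (h *\<^sub>R axis i 1))) (at s)" .
  moreover have "frechet_derivative F (at (a + s *\<^sub>R axis i 1)) (h *\<^sub>R axis i 1) = pd i F (a + s *\<^sub>R axis i 1) * h" for h
    by (simp add: pd_def linear_scale[OF linear_frechet_derivative[OF assms]])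
  ultimately show ?thesis unfolding has_field_derivative_def by simp
qed

text \<open>Two applications of the mean value theorem: in direction \<open>i\<close> to the
  increment of \<open>F\<close> in direction \<open>j\<close>, and in direction \<open>j\<close> to
  the derivative thus obtained.\<close>

lemma mixed_difference:
  fixes F :: "real^'n::finite \<Rightarrow> real"
  assumes X: "smooth_on X F" and h: "h > 0"
    and sub: "\<And>s t. 0 \<le> s \<Longrightarrow> s \<le> h \<Longrightarrow> 0 \<le> t \<Longrightarrow> t \<le> h \<Longrightarrow> x + s *\<^sub>R axis i 1 + t *\<^sub>R axis j 1 \<in> X"
  shows "\<exists>s t. 0 \<le> s \<and> s \<le> h \<and> 0 \<le> t \<and> t \<le> h \<and>
     F (x + h *\<^sub>R axis i 1 + h *\<^sub>R axis j 1) - F (x + h *\<^sub>R axis i 1) - F (x + h *\<^sub>R axis j 1) + F x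
     = h * (h * pd j (\<lambda>z. pd i F z) (x + s *\<^sub>R axis i 1 + t *\<^sub>R axis j 1))"
proof -
  define u where "u s = F (x + h *\<^sub>R axis j 1 + s *\<^sub>R axis i 1) - F (x + s *\<^sub>R axis i 1)" for s
  have in1: "x + h *\<^sub>R axis j 1 + s *\<^sub>R axis i 1 \<in> X" if "0 \<le> s" "s \<le> h" for s
    using sub[of s h] that h by (simp add: algebra_simps)
  have in2: "x + s *\<^sub>R axis i 1 \<in> X" if "0 \<le> s" "s \<le> h" for s
    using sub[of s 0] that h by (simp add: algebra_simps)
  have "\<exists>s. 0 < s \<and> s < h \<and> u h - u 0 = (h - 0) * (pd i F (x + h *\<^sub>R axis j 1 + s *\<^sub>R axis i 1) - pd i F (x + s *\<^sub>R axis i 1))"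
    unfolding u_def
    by (intro MVT2[OF h] DERIV_diff pd_line smooth_on_diff[OF X] in1 in2) auto
  then obtain s where s: "0 < s" "s < h"
    and us: "u h - u 0 = h * (pd i F (x + h *\<^sub>R axis j 1 + s *\<^sub>R axis i 1) - pd i F (x + s *\<^sub>R axis i 1))"
    by auto
  define w where "w t = pd i F (x + s *\<^sub>R axis i 1 + t *\<^sub>R axis j 1)" for t
  have "\<exists>t. 0 < t \<and> t < h \<and> w h - w 0 = (h - 0) * pd j (pd i F) (x + s *\<^sub>R axis i 1 + t *\<^sub>R axis j 1)"
    unfolding w_def
    by (intro MVT2[OF h] pd_line smooth_on_diff[OF smooth_on_pd[OF X]] sub) (use s in auto)
  then obtain t where t: "0 < t" "t < h" "w h - w 0 = h * pd j (pd i F) (x + s *\<^sub>R axis i 1 + t *\<^sub>R axis j 1)"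
    by auto
  have "F (x + h *\<^sub>R axis i 1 + h *\<^sub>R axis j 1) - F (x + h *\<^sub>R axis i 1) - F (x + h *\<^sub>R axis j 1) + F x = u h - u 0"
    by (simp add: u_def algebra_simps)
  also have "\<dots> = h * (w h - w 0)" unfolding us w_def by (simp add: algebra_simps)
  finally show ?thesis using s t by (intro exI[of _ s] exI[of _ t]) auto
qed

text \<open>The second difference of \<open>F\<close> over a small square is symmetric in the two
  directions. By \<open>mixed_difference\<close> it is \<open>h^2\<close> times either mixed
  derivative at some point of the square, and both derivatives are continuous.\<close>

lemma pd_commute:
  fixes F :: "real^'n::finite \<Rightarrow> real"
  assumes F: "smooth_on X F" and x: "x \<in> X"
  shows "pd i (\<lambda>z. pd j F z) x = pd j (\<lambda>z. pd i F z) x"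
proof (rule ccontr)
  let ?a = "\<lambda>z. pd i (\<lambda>z. pd j F z) z" and ?b = "\<lambda>z. pd j (\<lambda>z. pd i F z) z"
  assume neq: "?a x \<noteq> ?b x"
  \<comment> \<open>Half of the gap: two numbers closer than \<open>e\<close> to the two derivatives
    at \<open>x\<close> cannot coincide.\<close>
  define e where "e = \<bar>?a x - ?b x\<bar> / 2"
  have e: "e > 0" using neq by (simp add: e_def)
  have ca: "isCont ?a x" and cb: "isCont ?b x"
    by (rule differentiable_imp_continuous_within[OF smooth_on_diff[OF smooth_on_pd[OF smooth_on_pd[OF F]] x]])+
  obtain d1 where d1: "d1 > 0" "\<And>z. dist z x < d1 \<Longrightarrow> dist (?a z) (?a x) < e"
    using ca[unfolded continuous_at_eps_delta, rule_format, OF e] by blast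
  obtain d2 where d2: "d2 > 0" "\<And>z. dist z x < d2 \<Longrightarrow> dist (?b z) (?b x) < e"
    using cb[unfolded continuous_at_eps_delta, rule_format, OF e] by blast
  obtain d3 where d3: "d3 > 0" "ball x d3 \<subseteq> X" using openE[OF smooth_on_open[OF F] x] by blast
  \<comment> \<open>Points of the square are at distance at most \<open>2 * h\<close> from
    \<open>x\<close>, which a third of the least radius keeps strictly inside all three
    balls.\<close>
  define h where "h = min d1 (min d2 d3) / 3"
  have h: "h > 0" using d1(1) d2(1) d3(1) by (simp add: h_def)
  have hd: "2 * h < d1" "2 * h < d2" "2 * h < d3" using d1(1) d2(1) d3(1) by (auto simp: h_def min_def)
  have nrm: "dist (x + s *\<^sub>R axis k 1 + t *\<^sub>R axis l 1) x \<le> 2 * h"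
    if "0 \<le> s" "s \<le> h" "0 \<le> t" "t \<le> h" for s t :: real and k l :: 'n
  proof -
    have "norm (s *\<^sub>R axis k (1::real) + t *\<^sub>R axis l 1) \<le> \<bar>s\<bar> + \<bar>t\<bar>"
      by (rule order_trans[OF norm_triangle_ineq]) (simp add: norm_axis_1)
    then show ?thesis using that by (simp add: dist_norm algebra_simps)
  qed
  have sub: "x + s *\<^sub>R axis k 1 + t *\<^sub>R axis l 1 \<in> X"
    if "0 \<le> s" "s \<le> h" "0 \<le> t" "t \<le> h" for s t :: real and k l :: 'n
  proof -
    have "x + s *\<^sub>R axis k 1 + t *\<^sub>R axis l 1 \<in> ball x d3"
      using nrm[OF that, of k l] hd(3) by (simp add: dist_commute)
    then show ?thesis using d3(2) by blast
  qed
  obtain s t where st: "0 \<le> s" "s \<le> h" "0 \<le> t" "t \<le> h" and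
    E1: "F (x + h *\<^sub>R axis i 1 + h *\<^sub>R axis j 1) - F (x + h *\<^sub>R axis i 1) - F (x + h *\<^sub>R axis j 1) + F x
     = h * (h * ?b (x + s *\<^sub>R axis i 1 + t *\<^sub>R axis j 1))"
    using mixed_difference[of X F h x i j, OF F h sub] by blast
  obtain s' t' where st': "0 \<le> s'" "s' \<le> h" "0 \<le> t'" "t' \<le> h" and
    E2: "F (x + h *\<^sub>R axis j 1 + h *\<^sub>R axis i 1) - F (x + h *\<^sub>R axis j 1) - F (x + h *\<^sub>R axis i 1) + F x
     = h * (h * ?a (x + s' *\<^sub>R axis j 1 + t' *\<^sub>R axis i 1))"
    using mixed_difference[of X F h x j i, OF F h sub] by blast
  have "h * (h * ?b (x + s *\<^sub>R axis i 1 + t *\<^sub>R axis j 1)) = h * (h * ?a (x + s' *\<^sub>R axis j 1 + t' *\<^sub>R axis i 1))"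
    unfolding E1[symmetric] E2[symmetric] by (simp add: add.assoc add.commute[of "h *\<^sub>R axis i 1"])
  then have eq: "?b (x + s *\<^sub>R axis i 1 + t *\<^sub>R axis j 1) = ?a (x + s' *\<^sub>R axis j 1 + t' *\<^sub>R axis i 1)"
    using h by simp
  have "dist (?b (x + s *\<^sub>R axis i 1 + t *\<^sub>R axis j 1)) (?b x) < e"
    using nrm[OF st, of i j] hd by (intro d2(2)) auto
  moreover have "dist (?a (x + s' *\<^sub>R axis j 1 + t' *\<^sub>R axis i 1)) (?a x) < e"
    using nrm[OF st', of j i] hd by (intro d1(2)) auto
  ultimately show False unfolding eq e_def dist_real_def by argo
qed

section \<open>Metrics and the Levi-Civita connection\<close>

abbreviation kd :: "'n \<Rightarrow> 'n \<Rightarrow> real" where "kd i j \<equiv> (if i = j then 1 else 0)"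

text \<open>The Christoffel symbols of the first kind, with the lowered index first. They are linear
  in the derivatives of the metric and free of its inverse, so their transformation rules come
  before those of \<open>christoffel\<close>.\<close>

definition christ1 :: "'n::finite tensor2_field \<Rightarrow> real^'n \<Rightarrow> 'n \<Rightarrow> 'n \<Rightarrow> 'n \<Rightarrow> real" where
  "christ1 G x l i j =
     (1/2) * (pd i (\<lambda>z. G z $ l $ j) x + pd j (\<lambda>z. G z $ l $ i) x - pd l (\<lambda>z. G z $ i $ j) x)"

lemma christoffel_christ1:
  "christoffel G x k i j = (\<Sum>l\<in>UNIV. ginv G x $ k $ l * christ1 G x l i j)"
  unfolding christoffel_def christ1_def sum_distrib_left by (simp only: mult.left_commute)

lemma sum_kd_left: "(\<Sum>k\<in>UNIV. kd i k * f k) = f i" for i :: "'n::finite"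
  by (simp add: if_distrib[of "\<lambda>t. t * _"] cong: if_cong)

lemma sum_kd_right: "(\<Sum>k\<in>UNIV. f k * kd k i) = f i" for i :: "'n::finite"
  by (simp add: if_distrib[of "\<lambda>t. _ * t"] cong: if_cong)

text \<open>Smoothness is asked of the components, since the calculus above is mostly about
  real-valued functions.\<close>

definition metric_on :: "(real^'n::finite) set \<Rightarrow> 'n tensor2_field \<Rightarrow> bool" where
  "metric_on X G \<longleftrightarrow> open X \<and> (\<forall>i j. smooth_on X (\<lambda>x. G x $ i $ j)) \<and>
     (\<forall>x\<in>X. transpose (G x) = G x \<and> (\<forall>v. v \<noteq> 0 \<longrightarrow> v \<bullet> (G x *v v) > 0))"

section \<open>Inverse matrices and their smooth dependence on the entries\<close>

lemma matrix_inv_unique: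
  fixes A B :: "real^'n::finite^'n"
  assumes "A ** B = mat 1" "B ** A = mat 1"
  shows "matrix_inv A = B"
proof -
  have "A ** matrix_inv A = mat 1 \<and> matrix_inv A ** A = mat 1"
    unfolding matrix_inv_def by (rule someI[of _ B]) (use assms in simp)
  then show ?thesis using assms by (metis matrix_mul_assoc matrix_mul_lid matrix_mul_rid)
qed

lemma matrix_inv_works:
  fixes A :: "real^'n::finite^'n"
  assumes "det A \<noteq> 0"
  shows "A ** matrix_inv A = mat 1" "matrix_inv A ** A = mat 1"
proof -
  obtain B where B: "A ** B = mat 1" "B ** A = mat 1"
    using assms unfolding invertible_det_nz[symmetric] invertible_def by blast
  show "A ** matrix_inv A = mat 1" "matrix_inv A ** A = mat 1"
    unfolding matrix_inv_unique[OF B] by (rule B)+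
qed

lemma smooth_on_det:
  fixes M :: "real^'n::finite \<Rightarrow> real^'m::finite^'m"
  assumes "open X" "\<And>i j. smooth_on X (\<lambda>x. M x $ i $ j)"
  shows "smooth_on X (\<lambda>x. det (M x))"
  unfolding det_def
  by (intro smooth_on_sum smooth_on_mult smooth_on_prod smooth_on_const assms)

text \<open>Cramer's rule for the columns of the inverse. It exhibits the entries as quotients of
  polynomials in the entries of \<open>A\<close>, hence as smooth functions of them.\<close>

lemma matrix_inv_component:
  fixes A :: "real^'n::finite^'n"
  assumes "det A \<noteq> 0"
  shows "matrix_inv A $ k $ l = det (\<chi> i j. if j = k then kd l i else A $ i $ j) / det A"
proof -
  have "A *v (matrix_inv A *v axis l 1) = axis l 1"
    by (simp add: matrix_vector_mul_assoc matrix_inv_works[OF assms])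
  then have "matrix_inv A *v axis l 1 = (\<chi> k. det (\<chi> i j. if j = k then axis l 1 $ i else A $ i $ j) / det A)"
    unfolding cramer[OF assms] .
  then have "(matrix_inv A *v axis l 1) $ k = det (\<chi> i j. if j = k then axis l 1 $ i else A $ i $ j) / det A"
    by simp
  moreover have "(matrix_inv A *v axis l 1) $ k = matrix_inv A $ k $ l"
    by (simp add: matrix_vector_mul_component inner_axis)
  moreover have "axis l (1::real) $ i = kd l i" for i by (simp add: axis_def eq_commute)
  ultimately show ?thesis by (simp cong: if_cong)
qed

lemma smooth_on_matrix_inv:
  fixes M :: "real^'n::finite \<Rightarrow> real^'m::finite^'m"
  assumes X: "open X" and M: "\<And>i j. smooth_on X (\<lambda>x. M x $ i $ j)" and d: "\<And>x. x \<in> X \<Longrightarrow> det (M x) \<noteq> 0"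
  shows "smooth_on X (\<lambda>x. matrix_inv (M x) $ k $ l)"
proof (rule smooth_on_cong)
  show "smooth_on X (\<lambda>x. det (\<chi> i j. if j = k then kd l i else M x $ i $ j) / det (M x))"
  proof (intro smooth_on_divide smooth_on_det X M d)
    show "smooth_on X (\<lambda>x. (\<chi> i j. if j = k then kd l i else M x $ i $ j) $ i $ j)" for i j
      by (cases "j = k") (simp_all add: smooth_on_const X M)
  qed
qed (simp add: matrix_inv_component d)

section \<open>The inverse metric and the Levi-Civita connection\<close>

context
  fixes X :: "(real^'n::finite) set" and G :: "'n tensor2_field"
  assumes G: "metric_on X G"

begin

lemma metric_open: "open X" using G by (simp add: metric_on_def)

lemma metric_smooth: "smooth_on X (\<lambda>x. G x $ i $ j)" using G by (simp add: metric_on_def)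

lemma metric_sym: "x \<in> X \<Longrightarrow> G x $ i $ j = G x $ j $ i"
proof -
  assume "x \<in> X"
  then have "transpose (G x) = G x" using G by (simp add: metric_on_def)
  from arg_cong[OF this, of "\<lambda>M. M $ j $ i"] show ?thesis by (simp add: transpose_def)
qed

lemma metric_pos: "x \<in> X \<Longrightarrow> v \<noteq> 0 \<Longrightarrow> v \<bullet> (G x *v v) > 0"
  using G by (simp add: metric_on_def)

lemma metric_det: "x \<in> X \<Longrightarrow> det (G x) \<noteq> 0"
proof -
  assume x: "x \<in> X"
  have "v = 0" if "G x *v v = 0" for v
    using metric_pos[OF x, of v] that by auto
  then show ?thesis
    using matrix_left_invertible_ker[of "G x"] by (simp add: invertible_left_inverse invertible_det_nz[symmetric])
qed

lemma ginv_matrix: "x \<in> X \<Longrightarrow> G x ** ginv G x = mat 1" "x \<in> X \<Longrightarrow> ginv G x ** G x = mat 1"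
  unfolding ginv_def using matrix_inv_works[OF metric_det] by auto

lemma ginv_right: "x \<in> X \<Longrightarrow> (\<Sum>k\<in>UNIV. G x $ i $ k * ginv G x $ k $ j) = kd i j"
  using ginv_matrix(1)[of x] by (simp add: matrix_matrix_mult_def mat_def vec_eq_iff)

lemma ginv_left: "x \<in> X \<Longrightarrow> (\<Sum>k\<in>UNIV. ginv G x $ i $ k * G x $ k $ j) = kd i j"
  using ginv_matrix(2)[of x] by (simp add: matrix_matrix_mult_def mat_def vec_eq_iff)

lemma ginv_smooth: "smooth_on X (\<lambda>x. ginv G x $ i $ j)"
  unfolding ginv_def by (rule smooth_on_matrix_inv[OF metric_open metric_smooth metric_det])

lemma ginv_sym: assumes x: "x \<in> X" shows "ginv G x $ i $ j = ginv G x $ j $ i"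
proof -
  have s: "transpose (G x) = G x" using G x by (simp add: metric_on_def)
  have "G x ** transpose (ginv G x) = mat 1"
    using arg_cong[OF ginv_matrix(2)[OF x], of transpose] by (simp add: matrix_transpose_mul s)
  moreover have "transpose (ginv G x) ** G x = mat 1"
    using arg_cong[OF ginv_matrix(1)[OF x], of transpose] by (simp add: matrix_transpose_mul s)
  ultimately have "ginv G x = transpose (ginv G x)"
    unfolding ginv_def by (rule matrix_inv_unique)
  from arg_cong[OF this, of "\<lambda>M. M $ i $ j"] show ?thesis by (simp add: transpose_def)
qed

lemma ginv_diag_pos: assumes x: "x \<in> X" shows "ginv G x $ i $ i > 0"
proof -
  let ?v = "ginv G x *v axis i 1"
  have e: "G x *v ?v = axis i 1" by (simp add: matrix_vector_mul_assoc ginv_matrix[OF x])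
  have "?v \<noteq> 0"
  proof
    assume "?v = 0"
    with e have "axis i (1::real) = (0::real^'n)" by simp
    then show False by (simp add: axis_eq_0_iff)
  qed
  then have "?v \<bullet> axis i 1 > 0" using metric_pos[OF x, of ?v] by (simp add: e)
  then show ?thesis by (simp add: inner_axis matrix_vector_mul_component)
qed

lemma metric_diff: "x \<in> X \<Longrightarrow> (\<lambda>x. G x $ i $ j) differentiable (at x)"
  using smooth_on_diff[OF metric_smooth] .

lemma ginv_diff: "x \<in> X \<Longrightarrow> (\<lambda>x. ginv G x $ i $ j) differentiable (at x)"
  using smooth_on_diff[OF ginv_smooth] .

lemma pd_metric_sym: "x \<in> X \<Longrightarrow> pd k (\<lambda>z. G z $ i $ j) x = pd k (\<lambda>z. G z $ j $ i) x"
  by (rule pd_cong_open[OF metric_open]) (auto intro: metric_sym)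

lemma christ1_sym: assumes x: "x \<in> X" shows "christ1 G x l i j = christ1 G x l j i"
  unfolding christ1_def pd_metric_sym[OF x, of l i j] by (simp only: add.commute)

lemma christoffel_sym: "x \<in> X \<Longrightarrow> christoffel G x k i j = christoffel G x k j i"
  unfolding christoffel_christ1 by (simp only: christ1_sym[of x _ i j])

lemma christoffel_smooth: "smooth_on X (\<lambda>x. christoffel G x k i j)"
  unfolding christoffel_def by (intro smooth_intros metric_open metric_smooth ginv_smooth)

lemma christoffel_diff: "x \<in> X \<Longrightarrow> (\<lambda>x. christoffel G x k i j) differentiable (at x)"
  using smooth_on_diff[OF christoffel_smooth] .

lemma christoffel_lower:
  assumes x: "x \<in> X"
  shows "(\<Sum>k\<in>UNIV. G x $ m $ k * christoffel G x k i j) = christ1 G x m i j"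
proof -
  have "(\<Sum>k\<in>UNIV. G x $ m $ k * christoffel G x k i j) = (\<Sum>k\<in>UNIV. \<Sum>l\<in>UNIV. G x $ m $ k * ginv G x $ k $ l * christ1 G x l i j)"
    by (simp only: christoffel_christ1 sum_distrib_left mult.assoc)
  also have "\<dots> = (\<Sum>l\<in>UNIV. (\<Sum>k\<in>UNIV. G x $ m $ k * ginv G x $ k $ l) * christ1 G x l i j)"
    by (subst sum.swap) (simp only: sum_distrib_right)
  also have "\<dots> = christ1 G x m i j" by (simp only: ginv_right[OF x] sum_kd_left)
  finally show ?thesis .
qed

text \<open>The metric is parallel. In the sum of the two lowered Christoffel symbols the wanted
  derivative occurs twice with factor 1/2, and the other terms cancel in pairs.\<close>

lemma metric_compat:
  assumes x: "x \<in> X"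
  shows "pd k (\<lambda>z. G z $ i $ j) x =
    (\<Sum>l\<in>UNIV. G x $ j $ l * christoffel G x l k i) + (\<Sum>l\<in>UNIV. G x $ i $ l * christoffel G x l k j)"
proof -
  have "c = (1/2) * (c + b - a) + (1/2) * (c + a - b)" for a b c :: real by (simp add: field_simps)
  from this[of "pd k (\<lambda>z. G z $ i $ j) x" "pd i (\<lambda>z. G z $ k $ j) x" "pd j (\<lambda>z. G z $ k $ i) x"]
  show ?thesis
    unfolding christoffel_lower[OF x] christ1_def
    using pd_metric_sym[OF x, of k j i] pd_metric_sym[OF x, of i j k] pd_metric_sym[OF x, of j i k]
    by simp
qed

text \<open>Differentiate the relation \<open>ginv_left\<close> and multiply by the inverse metric
  from the right.\<close>

lemma pd_ginv:
  assumes x: "x \<in> X"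
  shows "pd k (\<lambda>z. ginv G z $ i $ j) x = - (\<Sum>a\<in>UNIV. \<Sum>b\<in>UNIV. ginv G x $ i $ a * pd k (\<lambda>z. G z $ a $ b) x * ginv G x $ b $ j)"
proof -
  have 0: "(\<Sum>a\<in>UNIV. pd k (\<lambda>z. ginv G z $ i $ a) x * G x $ a $ b) = - (\<Sum>a\<in>UNIV. ginv G x $ i $ a * pd k (\<lambda>z. G z $ a $ b) x)" for b
  proof -
    have "pd k (\<lambda>z. \<Sum>a\<in>UNIV. ginv G z $ i $ a * G z $ a $ b) x = pd k (\<lambda>z. kd i b) x"
      by (rule pd_cong_open[OF metric_open x]) (rule ginv_left)
    then have "(\<Sum>a\<in>UNIV. pd k (\<lambda>z. ginv G z $ i $ a) x * G x $ a $ b) + (\<Sum>a\<in>UNIV. ginv G x $ i $ a * pd k (\<lambda>z. G z $ a $ b) x) = 0"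
      by (simp add: metric_diff[OF x] ginv_diff[OF x] sum.distrib)
    then show ?thesis by linarith
  qed
  have "pd k (\<lambda>z. ginv G z $ i $ j) x = (\<Sum>a\<in>UNIV. pd k (\<lambda>z. ginv G z $ i $ a) x * kd a j)"
    by (simp only: sum_kd_right)
  also have "\<dots> = (\<Sum>a\<in>UNIV. \<Sum>b\<in>UNIV. pd k (\<lambda>z. ginv G z $ i $ a) x * G x $ a $ b * ginv G x $ b $ j)"
    by (simp only: ginv_right[OF x, symmetric] sum_distrib_left mult.assoc)
  also have "\<dots> = (\<Sum>b\<in>UNIV. (\<Sum>a\<in>UNIV. pd k (\<lambda>z. ginv G z $ i $ a) x * G x $ a $ b) * ginv G x $ b $ j)"
    by (subst sum.swap) (simp only: sum_distrib_right)
  also have "\<dots> = - (\<Sum>b\<in>UNIV. \<Sum>a\<in>UNIV. ginv G x $ i $ a * pd k (\<lambda>z. G z $ a $ b) x * ginv G x $ b $ j)"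
    by (simp only: 0 sum_distrib_right sum_negf mult_minus_left)
  finally show ?thesis by (subst (asm) sum.swap)
qed

text \<open>The inverse metric is parallel too. In this form its derivatives combine with the
  Christoffel terms of covariant derivatives.\<close>

lemma pd_ginv_christoffel:
  assumes x: "x \<in> X"
  shows "pd k (\<lambda>z. ginv G z $ i $ j) x =
    - (\<Sum>l\<in>UNIV. christoffel G x i k l * ginv G x $ l $ j) - (\<Sum>l\<in>UNIV. christoffel G x j k l * ginv G x $ l $ i)"
proof -
  define \<Gamma> where "\<Gamma> = christoffel G x"
  have A: "(\<Sum>a\<in>UNIV. ginv G x $ i $ a * (\<Sum>l\<in>UNIV. G x $ a $ l * \<Gamma> l k b)) = \<Gamma> i k b" for i b
  proof -
    have "(\<Sum>a\<in>UNIV. ginv G x $ i $ a * (\<Sum>l\<in>UNIV. G x $ a $ l * \<Gamma> l k b)) =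
      (\<Sum>l\<in>UNIV. (\<Sum>a\<in>UNIV. ginv G x $ i $ a * G x $ a $ l) * \<Gamma> l k b)"
      unfolding sum_distrib_left by (subst sum.swap) (simp only: sum_distrib_right mult.assoc)
    also have "\<dots> = \<Gamma> i k b" by (simp only: ginv_left[OF x] sum_kd_left)
    finally show ?thesis .
  qed
  have "(\<Sum>a\<in>UNIV. \<Sum>b\<in>UNIV. ginv G x $ i $ a * pd k (\<lambda>z. G z $ a $ b) x * ginv G x $ b $ j)
    = (\<Sum>a\<in>UNIV. \<Sum>b\<in>UNIV. ginv G x $ i $ a * (\<Sum>l\<in>UNIV. G x $ b $ l * \<Gamma> l k a) * ginv G x $ b $ j)
     + (\<Sum>a\<in>UNIV. \<Sum>b\<in>UNIV. ginv G x $ i $ a * (\<Sum>l\<in>UNIV. G x $ a $ l * \<Gamma> l k b) * ginv G x $ b $ j)"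
    by (simp only: metric_compat[OF x] \<Gamma>_def distrib_left distrib_right sum.distrib)
  also have "(\<Sum>a\<in>UNIV. \<Sum>b\<in>UNIV. ginv G x $ i $ a * (\<Sum>l\<in>UNIV. G x $ a $ l * \<Gamma> l k b) * ginv G x $ b $ j)
     = (\<Sum>b\<in>UNIV. \<Gamma> i k b * ginv G x $ b $ j)"
    by (subst sum.swap) (simp only: A sum_distrib_right[symmetric])
  also have "(\<Sum>a\<in>UNIV. \<Sum>b\<in>UNIV. ginv G x $ i $ a * (\<Sum>l\<in>UNIV. G x $ b $ l * \<Gamma> l k a) * ginv G x $ b $ j)
     = (\<Sum>a\<in>UNIV. (\<Sum>b\<in>UNIV. ginv G x $ j $ b * (\<Sum>l\<in>UNIV. G x $ b $ l * \<Gamma> l k a)) * ginv G x $ a $ i)"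
    unfolding sum_distrib_right
  proof (intro sum.cong refl)
    fix a b
    show "ginv G x $ i $ a * (\<Sum>l\<in>UNIV. G x $ b $ l * \<Gamma> l k a) * ginv G x $ b $ j =
      ginv G x $ j $ b * (\<Sum>l\<in>UNIV. G x $ b $ l * \<Gamma> l k a) * ginv G x $ a $ i"
      using ginv_sym[OF x, of i a] ginv_sym[OF x, of b j] by (simp only: mult_ac)
  qed
  also have "\<dots> = (\<Sum>a\<in>UNIV. \<Gamma> j k a * ginv G x $ a $ i)" by (simp only: A)
  finally show ?thesis unfolding pd_ginv[OF x] \<Gamma>_def by simp
qed

lemma pd_ginv_at_1:
  assumes x: "x \<in> X" and 1: "G x = mat 1"
  shows "ginv G x = mat 1" "pd k (\<lambda>z. ginv G z $ i $ j) x = - pd k (\<lambda>z. G z $ i $ j) x"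
proof -
  show *: "ginv G x = mat 1" unfolding ginv_def by (rule matrix_inv_unique) (simp_all add: 1)
  show "pd k (\<lambda>z. ginv G z $ i $ j) x = - pd k (\<lambda>z. G z $ i $ j) x"
    unfolding pd_ginv[OF x] * mat_def
    by (simp only: vec_lambda_beta mult.assoc sum_distrib_left[symmetric] sum_kd_left sum_kd_right)
qed

end

section \<open>Change of coordinates\<close>

lemma sum_swap_pairs:
  fixes f :: "'a::finite \<Rightarrow> 'b::finite \<Rightarrow> 'c::finite \<Rightarrow> 'd::finite \<Rightarrow> real"
  shows "(\<Sum>a\<in>UNIV. \<Sum>b\<in>UNIV. \<Sum>m\<in>UNIV. \<Sum>n\<in>UNIV. f a b m n) = (\<Sum>m\<in>UNIV. \<Sum>n\<in>UNIV. \<Sum>a\<in>UNIV. \<Sum>b\<in>UNIV. f a b m n)"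
proof -
  have pair: "(\<Sum>a\<in>UNIV. \<Sum>b\<in>UNIV. g a b) = (\<Sum>p\<in>UNIV. g (fst p) (snd p))"
    for g :: "'e::finite \<Rightarrow> 'f::finite \<Rightarrow> real"
    by (simp add: sum.cartesian_product case_prod_beta)
  have "(\<Sum>a\<in>UNIV. \<Sum>b\<in>UNIV. \<Sum>m\<in>UNIV. \<Sum>n\<in>UNIV. f a b m n)
      = (\<Sum>p\<in>UNIV. \<Sum>m\<in>UNIV. \<Sum>n\<in>UNIV. f (fst p) (snd p) m n)"
    by (rule pair)
  also have "\<dots> = (\<Sum>m\<in>UNIV. \<Sum>p\<in>UNIV. \<Sum>n\<in>UNIV. f (fst p) (snd p) m n)"
    by (rule sum.swap)
  also have "\<dots> = (\<Sum>m\<in>UNIV. \<Sum>n\<in>UNIV. \<Sum>p\<in>UNIV. f (fst p) (snd p) m n)"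
    by (intro sum.cong refl) (rule sum.swap)
  also have "\<dots> = (\<Sum>m\<in>UNIV. \<Sum>n\<in>UNIV. \<Sum>a\<in>UNIV. \<Sum>b\<in>UNIV. f a b m n)"
    by (intro sum.cong refl) (rule pair[symmetric])
  finally show ?thesis .
qed

text \<open>Contraction of a pulled back pair of indices: the Jacobians move from \<open>t\<close>
  onto \<open>g\<close>. With \<open>g\<close> the inverse metric, \<open>ginv_pull\<close> then
  absorbs them into the inverse metric of the target.\<close>

lemma sum_pull_pair:
  fixes P g t :: "'a::finite \<Rightarrow> 'a \<Rightarrow> real" and D :: "'a \<Rightarrow> 'a \<Rightarrow> real"
  assumes "\<And>m n. (\<Sum>a\<in>UNIV. \<Sum>b\<in>UNIV. D m a * D n b * g a b) = P m n"
  shows "(\<Sum>a\<in>UNIV. \<Sum>b\<in>UNIV. g a b * (\<Sum>m\<in>UNIV. \<Sum>n\<in>UNIV. D m a * D n b * t m n)) = (\<Sum>m\<in>UNIV. \<Sum>n\<in>UNIV. P m n * t m n)"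
proof -
  have "(\<Sum>a\<in>UNIV. \<Sum>b\<in>UNIV. g a b * (\<Sum>m\<in>UNIV. \<Sum>n\<in>UNIV. D m a * D n b * t m n))
    = (\<Sum>a\<in>UNIV. \<Sum>b\<in>UNIV. \<Sum>m\<in>UNIV. \<Sum>n\<in>UNIV. D m a * D n b * g a b * t m n)"
    by (simp only: sum_distrib_left mult_ac)
  also have "\<dots> = (\<Sum>m\<in>UNIV. \<Sum>n\<in>UNIV. \<Sum>a\<in>UNIV. \<Sum>b\<in>UNIV. D m a * D n b * g a b * t m n)"
    by (rule sum_swap_pairs)
  also have "\<dots> = (\<Sum>m\<in>UNIV. \<Sum>n\<in>UNIV. P m n * t m n)"
    by (simp only: assms[symmetric] sum_distrib_right)
  finally show ?thesis .
qed

text \<open>All operations are local, so the setting is that of a smooth map with invertible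
  Jacobian. Transition maps, their restrictions to the slice, the affine normalising maps and the
  identity are instances.\<close>

locale pullback =
  fixes X Y :: "(real^'n::finite) set" and \<phi> :: "real^'n \<Rightarrow> real^'n" and G G' :: "'n tensor2_field"
  assumes X: "open X"
    and \<phi>: "\<And>i. smooth_on X (\<lambda>x. \<phi> x $ i)"
    and sub: "\<And>x. x \<in> X \<Longrightarrow> \<phi> x \<in> Y"
    and jac: "\<And>x. x \<in> X \<Longrightarrow> det (\<chi> i a. pd a (\<lambda>z. \<phi> z $ i) x) \<noteq> 0"
    and G': "metric_on Y G'"
    and pull: "\<And>x a b. x \<in> X \<Longrightarrow>
      G x $ a $ b = (\<Sum>i\<in>UNIV. \<Sum>j\<in>UNIV. pd a (\<lambda>z. \<phi> z $ i) x * pd b (\<lambda>z. \<phi> z $ j) x * G' (\<phi> x) $ i $ j)"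

begin

text \<open>\<open>D\<close> is the Jacobian with the target index first, \<open>E\<close> holds the
  second derivatives of \<open>\<phi>\<close>, which form the inhomogeneous term in the law for
  Christoffel symbols, and \<open>B\<close> is the inverse Jacobian.\<close>

definition D where "D x i a = pd a (\<lambda>z. \<phi> z $ i) x"

definition E where "E x i a b = pd b (\<lambda>z. D z i a) x"

definition B where "B x = matrix_inv (\<chi> i a. D x i a)"

lemma D_smooth: "smooth_on X (\<lambda>x. D x i a)"
  unfolding D_def by (rule smooth_on_pd[OF \<phi>])

lemma D_diff: "x \<in> X \<Longrightarrow> (\<lambda>x. D x i a) differentiable (at x)"
  by (rule smooth_on_diff[OF D_smooth])

lemma E_smooth: "smooth_on X (\<lambda>x. E x i a b)"
  unfolding E_def by (rule smooth_on_pd[OF D_smooth])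

lemma E_diff: "x \<in> X \<Longrightarrow> (\<lambda>x. E x i a b) differentiable (at x)"
  by (rule smooth_on_diff[OF E_smooth])

lemma E_sym: "x \<in> X \<Longrightarrow> E x i a b = E x i b a"
  unfolding E_def D_def by (rule pd_commute[OF \<phi>])

lemma BD: "x \<in> X \<Longrightarrow> (\<Sum>i\<in>UNIV. B x $ a $ i * D x i b) = kd a b"
  and DB: "x \<in> X \<Longrightarrow> (\<Sum>a\<in>UNIV. D x i a * B x $ a $ j) = kd i j"
  using matrix_inv_works[OF jac[of x]] unfolding B_def D_def
  by (simp_all add: matrix_matrix_mult_def mat_def vec_eq_iff)

lemma chain: 
  assumes x: "x \<in> X" and F: "F differentiable (at (\<phi> x))"
  shows "pd c (\<lambda>z. F (\<phi> z)) x = (\<Sum>r\<in>UNIV. D x r c * pd r F (\<phi> x))"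
    and "(\<lambda>z. F (\<phi> z)) differentiable (at x)"
  using pd_comp[of \<phi> x F, OF smooth_on_diff[OF \<phi> x] F] by (simp_all add: D_def mult.commute)

lemma smooth_comp: "smooth_on Y F \<Longrightarrow> smooth_on X (\<lambda>z. F (\<phi> z))" for F :: "_ \<Rightarrow> real"
  by (rule smooth_on_comp[OF _ \<phi>]) (use sub in auto)

lemma pull': "x \<in> X \<Longrightarrow> G x $ a $ b = (\<Sum>i\<in>UNIV. \<Sum>j\<in>UNIV. D x i a * D x j b * G' (\<phi> x) $ i $ j)"
  unfolding D_def by (rule pull)

lemma pull_matrix:
  assumes x: "x \<in> X"
  shows "G x = transpose (\<chi> i a. D x i a) ** G' (\<phi> x) ** (\<chi> i a. D x i a)"
proof -
  have "(\<Sum>i\<in>UNIV. \<Sum>j\<in>UNIV. D x i a * D x j b * G' (\<phi> x) $ i $ j)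
    = (\<Sum>j\<in>UNIV. (\<Sum>i\<in>UNIV. D x i a * G' (\<phi> x) $ i $ j) * D x j b)" for a b
    unfolding sum_distrib_right by (subst sum.swap) (simp only: mult_ac)
  then show ?thesis
    by (simp add: vec_eq_iff matrix_matrix_mult_def transpose_def pull'[OF x])
qed

lemma metric: "metric_on X G"
  unfolding metric_on_def
proof (intro conjI allI ballI impI)
  show "open X" by (rule X)
  show "smooth_on X (\<lambda>x. G x $ i $ j)" for i j
    by (rule smooth_on_cong[OF _ pull'[symmetric]])
       (intro smooth_intros X D_smooth smooth_comp metric_smooth[OF G'])
  fix x assume x: "x \<in> X"
  let ?D = "\<chi> i a. D x i a"
  have s: "transpose (G' (\<phi> x)) = G' (\<phi> x)" using G' sub[OF x] by (simp add: metric_on_def)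
  show "transpose (G x) = G x"
    unfolding pull_matrix[OF x] by (simp only: matrix_transpose_mul s transpose_transpose matrix_mul_assoc)
  fix v :: "real^'n" assume v: "v \<noteq> 0"
  have "B x *v (?D *v v) = v"
    using matrix_inv_works(2)[OF jac[OF x]] by (simp add: B_def D_def matrix_vector_mul_assoc)
  then have "?D *v v \<noteq> 0" using v by auto
  then have "(?D *v v) \<bullet> (G' (\<phi> x) *v (?D *v v)) > 0" by (rule metric_pos[OF G' sub[OF x]])
  then show "v \<bullet> (G x *v v) > 0"
    unfolding pull_matrix[OF x] matrix_vector_mul_assoc[symmetric] transpose_matrix_vector
    by (simp only: inner_commute[of v] dot_lmul_matrix) (simp only: inner_commute)
qed

text \<open>The inverse metric is pushed forward. This form contains no inverse Jacobian, so
  contractions of pulled back tensors never meet \<open>B\<close>.\<close>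

lemma ginv_pull:
  assumes x: "x \<in> X"
  shows "(\<Sum>a\<in>UNIV. \<Sum>b\<in>UNIV. D x m a * D x n b * ginv G x $ a $ b) = ginv G' (\<phi> x) $ m $ n"
proof -
  let ?D = "\<chi> i a. D x i a"
  have BD': "B x ** ?D = mat 1" "?D ** B x = mat 1"
    using matrix_inv_works[OF jac[OF x]] by (simp_all add: B_def D_def)
  \<comment> \<open>Inserting \<open>?D ** B x\<close>, which is the identity, on the right produces
    the pulled back metric \<open>G x\<close> next to its inverse.\<close>
  have "(?D ** ginv G x ** transpose ?D) ** G' (\<phi> x) = ?D ** ginv G x ** (transpose ?D ** G' (\<phi> x) ** ?D) ** B x"
    by (simp add: matrix_mul_assoc[symmetric] BD')
  also have "\<dots> = mat 1"
    unfolding pull_matrix[OF x, symmetric]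
    by (simp add: matrix_mul_assoc[symmetric] ginv_matrix(2)[OF metric x] BD')
  finally have 1: "(?D ** ginv G x ** transpose ?D) ** G' (\<phi> x) = mat 1" .
  then have "G' (\<phi> x) ** (?D ** ginv G x ** transpose ?D) = mat 1"
    by (simp only: matrix_left_right_inverse)
  then have "ginv G' (\<phi> x) = ?D ** ginv G x ** transpose ?D"
    unfolding ginv_def[of G'] using 1 by (rule matrix_inv_unique)
  then have "ginv G' (\<phi> x) $ m $ n = (\<Sum>b\<in>UNIV. (\<Sum>a\<in>UNIV. D x m a * ginv G x $ a $ b) * D x n b)"
    by (simp add: matrix_matrix_mult_def transpose_def)
  also have "\<dots> = (\<Sum>a\<in>UNIV. \<Sum>b\<in>UNIV. D x m a * D x n b * ginv G x $ a $ b)"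
    unfolding sum_distrib_right by (subst sum.swap) (simp only: mult_ac)
  finally show ?thesis by simp
qed

lemma pd_pull_G:
  assumes x: "x \<in> X"
  shows "pd c (\<lambda>z. G z $ a $ b) x =
      (\<Sum>m\<in>UNIV. D x m b * (\<Sum>n\<in>UNIV. E x n a c * G' (\<phi> x) $ m $ n))
    + (\<Sum>m\<in>UNIV. D x m a * (\<Sum>n\<in>UNIV. E x n b c * G' (\<phi> x) $ m $ n))
    + (\<Sum>m\<in>UNIV. \<Sum>n\<in>UNIV. \<Sum>r\<in>UNIV. D x m a * D x n b * D x r c * pd r (\<lambda>z. G' z $ m $ n) (\<phi> x))"
proof -
  note d = D_diff[OF x] chain[OF x metric_diff[OF G' sub[OF x]]]
  have "pd c (\<lambda>z. G z $ a $ b) x = pd c (\<lambda>z. \<Sum>i\<in>UNIV. \<Sum>j\<in>UNIV. D z i a * D z j b * G' (\<phi> z) $ i $ j) x"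
    by (rule pd_cong_open[OF X x]) (rule pull')
  also have "\<dots> = (\<Sum>m\<in>UNIV. \<Sum>n\<in>UNIV. E x m a c * D x n b * G' (\<phi> x) $ m $ n)
     + (\<Sum>m\<in>UNIV. \<Sum>n\<in>UNIV. D x m a * E x n b c * G' (\<phi> x) $ m $ n)
     + (\<Sum>m\<in>UNIV. \<Sum>n\<in>UNIV. \<Sum>r\<in>UNIV. D x m a * D x n b * D x r c * pd r (\<lambda>z. G' z $ m $ n) (\<phi> x))"
    by (simp add: d E_def[symmetric] sum.distrib distrib_right distrib_left sum_distrib_left mult.assoc)
  also have "(\<Sum>m\<in>UNIV. \<Sum>n\<in>UNIV. E x m a c * D x n b * G' (\<phi> x) $ m $ n) = (\<Sum>m\<in>UNIV. D x m b * (\<Sum>n\<in>UNIV. E x n a c * G' (\<phi> x) $ m $ n))"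
    unfolding sum_distrib_left by (subst sum.swap) (simp only: metric_sym[OF G' sub[OF x]] mult_ac)
  also have "(\<Sum>m\<in>UNIV. \<Sum>n\<in>UNIV. D x m a * E x n b c * G' (\<phi> x) $ m $ n) = (\<Sum>m\<in>UNIV. D x m a * (\<Sum>n\<in>UNIV. E x n b c * G' (\<phi> x) $ m $ n))"
    unfolding sum_distrib_left by (simp only: mult_ac)
  finally show ?thesis .
qed

text \<open>Each derivative of the pulled back metric has two terms with second derivatives of
  \<open>\<phi>\<close> and one tensorial term. \<open>P\<close> collects the former and
  \<open>T\<close> the latter.\<close>

lemma christ1_pull:
  assumes x: "x \<in> X"
  shows "christ1 G x l i j = (\<Sum>m\<in>UNIV. D x m l * ((\<Sum>n\<in>UNIV. G' (\<phi> x) $ m $ n * E x n i j)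
     + (\<Sum>a\<in>UNIV. \<Sum>b\<in>UNIV. D x a i * D x b j * christ1 G' (\<phi> x) m a b)))"
proof -
  define P where "P l i j = (\<Sum>m\<in>UNIV. D x m l * (\<Sum>n\<in>UNIV. E x n i j * G' (\<phi> x) $ m $ n))" for l i j
  define q where "q m a b = (\<lambda>r. pd r (\<lambda>z. G' z $ m $ a) (\<phi> x)) b" for m a b
  define T where "T a b c = (\<Sum>m\<in>UNIV. \<Sum>n\<in>UNIV. \<Sum>r\<in>UNIV. D x m a * D x n b * D x r c * q m n r)" for a b c
  have Ps: "P l i j = P l j i" for l i j unfolding P_def using E_sym[OF x, of _ i j] by simp
  have pG: "pd c (\<lambda>z. G z $ a $ b) x = P b a c + P a b c + T a b c" for a b c
    unfolding pd_pull_G[OF x] P_def T_def q_def by simp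
  have T1: "T l j i = (\<Sum>m\<in>UNIV. \<Sum>a\<in>UNIV. \<Sum>b\<in>UNIV. D x m l * D x a i * D x b j * q m b a)"
    unfolding T_def by (rule sum.cong[OF refl], subst sum.swap) (simp only: mult_ac)
  have T2: "T l i j = (\<Sum>m\<in>UNIV. \<Sum>a\<in>UNIV. \<Sum>b\<in>UNIV. D x m l * D x a i * D x b j * q m a b)"
    unfolding T_def by (simp only: mult_ac)
  have T3: "T i j l = (\<Sum>m\<in>UNIV. \<Sum>a\<in>UNIV. \<Sum>b\<in>UNIV. D x m l * D x a i * D x b j * q a b m)"
  proof -
    have "T i j l = (\<Sum>a\<in>UNIV. \<Sum>m\<in>UNIV. \<Sum>b\<in>UNIV. D x m l * D x a i * D x b j * q a b m)"
      unfolding T_def by (rule sum.cong[OF refl], subst sum.swap) (simp only: mult_ac)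
    also have "\<dots> = (\<Sum>m\<in>UNIV. \<Sum>a\<in>UNIV. \<Sum>b\<in>UNIV. D x m l * D x a i * D x b j * q a b m)"
      by (rule sum.swap)
    finally show ?thesis .
  qed
  \<comment> \<open>Since \<open>P\<close> is symmetric in its last two arguments,
    \<open>P j l i\<close> and \<open>P i l j\<close> cancel against the third derivative, and two
    copies of \<open>P l i j\<close> survive the factor 1/2.\<close>
  have "christ1 G x l i j = P l i j + (1/2) * (T l j i + T l i j - T i j l)"
    unfolding christ1_def pG using Ps[of i l j] Ps[of j l i] Ps[of l i j] by simp
  also have "(1/2) * (T l j i + T l i j - T i j l) =
     (\<Sum>m\<in>UNIV. \<Sum>a\<in>UNIV. \<Sum>b\<in>UNIV. D x m l * D x a i * D x b j * ((1/2) * (q m b a + q m a b - q a b m)))"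
    unfolding T1 T2 T3
    by (simp add: sum.distrib sum_subtractf algebra_simps sum_divide_distrib add_divide_distrib diff_divide_distrib)
  also have "\<dots> = (\<Sum>m\<in>UNIV. D x m l * (\<Sum>a\<in>UNIV. \<Sum>b\<in>UNIV. D x a i * D x b j * christ1 G' (\<phi> x) m a b))"
    unfolding christ1_def q_def by (simp only: sum_distrib_left mult.assoc)
  finally show ?thesis unfolding P_def by (simp only: sum.distrib distrib_left mult.commute[of "E x _ i j"])
qed

text \<open>The upper index stays contracted with the Jacobian. Raising the index of
  \<open>christ1_pull\<close> then uses only \<open>ginv_pull\<close>, and the law can be
  differentiated without the inverse Jacobian.\<close>

lemma christoffel_pull:
  assumes x: "x \<in> X"
  shows "(\<Sum>c\<in>UNIV. D x k c * christoffel G x c i j) =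
    E x k i j + (\<Sum>a\<in>UNIV. \<Sum>b\<in>UNIV. christoffel G' (\<phi> x) k a b * D x a i * D x b j)"
proof -
  define Q where "Q m = (\<Sum>n\<in>UNIV. G' (\<phi> x) $ m $ n * E x n i j)
     + (\<Sum>a\<in>UNIV. \<Sum>b\<in>UNIV. D x a i * D x b j * christ1 G' (\<phi> x) m a b)" for m
  have "(\<Sum>c\<in>UNIV. D x k c * christoffel G x c i j) = (\<Sum>c\<in>UNIV. \<Sum>l\<in>UNIV. D x k c * (ginv G x $ c $ l * (\<Sum>m\<in>UNIV. D x m l * Q m)))"
    unfolding christoffel_christ1 christ1_pull[OF x] Q_def[symmetric] by (simp only: sum_distrib_left)
  also have "\<dots> = (\<Sum>c\<in>UNIV. \<Sum>m\<in>UNIV. \<Sum>l\<in>UNIV. D x k c * D x m l * ginv G x $ c $ l * Q m)"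
    unfolding sum_distrib_left by (subst sum.swap) (simp only: mult_ac)
  also have "\<dots> = (\<Sum>m\<in>UNIV. (\<Sum>c\<in>UNIV. \<Sum>l\<in>UNIV. D x k c * D x m l * ginv G x $ c $ l) * Q m)"
    by (subst sum.swap) (simp only: sum_distrib_right)
  also have "\<dots> = (\<Sum>m\<in>UNIV. ginv G' (\<phi> x) $ k $ m * Q m)"
    by (simp only: ginv_pull[OF x])
  also have "\<dots> = (\<Sum>m\<in>UNIV. ginv G' (\<phi> x) $ k $ m * (\<Sum>n\<in>UNIV. G' (\<phi> x) $ m $ n * E x n i j))
     + (\<Sum>m\<in>UNIV. ginv G' (\<phi> x) $ k $ m * (\<Sum>a\<in>UNIV. \<Sum>b\<in>UNIV. D x a i * D x b j * christ1 G' (\<phi> x) m a b))"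
    unfolding Q_def by (simp only: distrib_left sum.distrib)
  also have "(\<Sum>m\<in>UNIV. ginv G' (\<phi> x) $ k $ m * (\<Sum>n\<in>UNIV. G' (\<phi> x) $ m $ n * E x n i j))
     = (\<Sum>n\<in>UNIV. (\<Sum>m\<in>UNIV. ginv G' (\<phi> x) $ k $ m * G' (\<phi> x) $ m $ n) * E x n i j)"
    unfolding sum_distrib_left by (subst sum.swap) (simp only: sum_distrib_right mult.assoc)
  also have "\<dots> = E x k i j"
    by (simp only: ginv_left[OF G' sub[OF x]] sum_kd_left)
  also have "(\<Sum>m\<in>UNIV. ginv G' (\<phi> x) $ k $ m * (\<Sum>a\<in>UNIV. \<Sum>b\<in>UNIV. D x a i * D x b j * christ1 G' (\<phi> x) m a b))
     = (\<Sum>a\<in>UNIV. \<Sum>m\<in>UNIV. \<Sum>b\<in>UNIV. ginv G' (\<phi> x) $ k $ m * (D x a i * D x b j * christ1 G' (\<phi> x) m a b))"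
    unfolding sum_distrib_left by (rule sum.swap)
  also have "\<dots> = (\<Sum>a\<in>UNIV. \<Sum>b\<in>UNIV. \<Sum>m\<in>UNIV. ginv G' (\<phi> x) $ k $ m * (D x a i * D x b j * christ1 G' (\<phi> x) m a b))"
    by (rule sum.cong[OF refl]) (rule sum.swap)
  also have "\<dots> = (\<Sum>a\<in>UNIV. \<Sum>b\<in>UNIV. christoffel G' (\<phi> x) k a b * D x a i * D x b j)"
    unfolding christoffel_christ1 by (simp only: sum_distrib_right sum_distrib_left mult_ac)
  finally show ?thesis .
qed

end

section \<open>Naturality of gradient, covariant derivatives, divergence and trace\<close>

lemma sum_rot3: "(\<Sum>a\<in>A. \<Sum>b\<in>B. \<Sum>c\<in>C. f a b c) = (\<Sum>c\<in>C. \<Sum>a\<in>A. \<Sum>b\<in>B. f a b c)"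
proof -
  have "(\<Sum>a\<in>A. \<Sum>b\<in>B. \<Sum>c\<in>C. f a b c) = (\<Sum>a\<in>A. \<Sum>c\<in>C. \<Sum>b\<in>B. f a b c)"
    by (rule sum.cong[OF refl]) (rule sum.swap)
  then show ?thesis by (simp only: sum.swap[of _ A C])
qed

lemma sum_rot4: "(\<Sum>a\<in>A. \<Sum>b\<in>B. \<Sum>c\<in>C. \<Sum>d\<in>D. f a b c d) = (\<Sum>d\<in>D. \<Sum>a\<in>A. \<Sum>b\<in>B. \<Sum>c\<in>C. f a b c d)"
proof -
  have "(\<Sum>a\<in>A. \<Sum>b\<in>B. \<Sum>c\<in>C. \<Sum>d\<in>D. f a b c d) = (\<Sum>a\<in>A. \<Sum>d\<in>D. \<Sum>b\<in>B. \<Sum>c\<in>C. f a b c d)"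
    by (rule sum.cong[OF refl]) (rule sum_rot3)
  then show ?thesis by (simp only: sum.swap[of _ A D])
qed

context pullback

begin

text \<open>Relations instead of a pullback function: the field on the source is usually given by
  its own formula, and naturality of an operator means that it preserves the relation.\<close>

definition pb1 :: "'n covector_field \<Rightarrow> 'n covector_field \<Rightarrow> bool" where
  "pb1 w w' \<longleftrightarrow> (\<forall>x\<in>X. \<forall>a. w x $ a = (\<Sum>i\<in>UNIV. D x i a * w' (\<phi> x) $ i))"

definition pb2 :: "'n tensor2_field \<Rightarrow> 'n tensor2_field \<Rightarrow> bool" where
  "pb2 T T' \<longleftrightarrow> (\<forall>x\<in>X. \<forall>a b. T x $ a $ b = (\<Sum>i\<in>UNIV. \<Sum>j\<in>UNIV. D x i a * D x j b * T' (\<phi> x) $ i $ j))"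

lemma pb2_metric: "pb2 G G'"
  unfolding pb2_def using pull' by blast

lemma pb1_grad1:
  assumes f: "\<And>x. x \<in> X \<Longrightarrow> f x = f' (\<phi> x)" and f': "smooth_on Y f'"
  shows "pb1 (grad1 f) (grad1 f')"
  unfolding pb1_def grad1_def
proof (intro ballI allI)
  fix x a assume x: "x \<in> X"
  have "pd a f x = pd a (\<lambda>z. f' (\<phi> z)) x"
    by (rule pd_cong_open[OF X x f])
  then show "(\<chi> i. pd i f x) $ a = (\<Sum>i\<in>UNIV. D x i a * (\<chi> i. pd i f' (\<phi> x)) $ i)"
    using chain(1)[OF x smooth_on_diff[OF f' sub[OF x]]] by simp
qed

lemma christoffel_D:
  assumes x: "x \<in> X"
  shows "(\<Sum>k\<in>UNIV. christoffel G x k b a * (\<Sum>i\<in>UNIV. D x i k * u i)) =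
    (\<Sum>i\<in>UNIV. (E x i b a + (\<Sum>r\<in>UNIV. \<Sum>s\<in>UNIV. christoffel G' (\<phi> x) i r s * D x r b * D x s a)) * u i)"
proof -
  have "(\<Sum>k\<in>UNIV. christoffel G x k b a * (\<Sum>i\<in>UNIV. D x i k * u i)) =
     (\<Sum>i\<in>UNIV. (\<Sum>k\<in>UNIV. D x i k * christoffel G x k b a) * u i)"
    unfolding sum_distrib_left sum_distrib_right by (subst sum.swap) (simp only: mult_ac)
  then show ?thesis by (simp only: christoffel_pull[OF x])
qed

text \<open>Differentiating the Jacobian in front of \<open>w'\<close> gives a term in
  \<open>E\<close>, which cancels against the inhomogeneous term of the Christoffel law.\<close>

lemma pb2_cov1:
  assumes w: "pb1 w w'" and w': "\<And>i. smooth_on Y (\<lambda>z. w' z $ i)"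
  shows "pb2 (cov1 G w) (cov1 G' w')"
  unfolding pb2_def
proof (intro ballI allI)
  fix x b a assume x: "x \<in> X"
  let ?\<Gamma>' = "christoffel G' (\<phi> x)" and ?w' = "\<lambda>i. w' (\<phi> x) $ i"
  note d = D_diff[OF x] chain[OF x smooth_on_diff[OF w' sub[OF x]]]
  have wx: "w x $ a = (\<Sum>i\<in>UNIV. D x i a * ?w' i)" for a using w x by (simp add: pb1_def)
  have "pd b (\<lambda>z. w z $ a) x = pd b (\<lambda>z. \<Sum>i\<in>UNIV. D z i a * w' (\<phi> z) $ i) x"
    by (rule pd_cong_open[OF X x]) (use w in \<open>simp add: pb1_def\<close>)
  also have "\<dots> = (\<Sum>i\<in>UNIV. E x i b a * ?w' i) + (\<Sum>i\<in>UNIV. \<Sum>r\<in>UNIV. D x i a * (D x r b * pd r (\<lambda>z. w' z $ i) (\<phi> x)))"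
    by (simp add: d E_def[symmetric] sum.distrib sum_distrib_left E_sym[OF x, of _ a b])
  finally have "cov1 G w x $ b $ a = (\<Sum>i\<in>UNIV. \<Sum>r\<in>UNIV. D x i a * (D x r b * pd r (\<lambda>z. w' z $ i) (\<phi> x)))
      - (\<Sum>i\<in>UNIV. \<Sum>r\<in>UNIV. \<Sum>s\<in>UNIV. ?\<Gamma>' i r s * D x r b * D x s a * ?w' i)"
    by (simp add: cov1_def wx christoffel_D[OF x] distrib_right sum.distrib sum_distrib_right)
  also have "(\<Sum>i\<in>UNIV. \<Sum>r\<in>UNIV. D x i a * (D x r b * pd r (\<lambda>z. w' z $ i) (\<phi> x)))
     = (\<Sum>r\<in>UNIV. \<Sum>s\<in>UNIV. D x r b * D x s a * pd r (\<lambda>z. w' z $ s) (\<phi> x))"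
    by (subst sum.swap) (simp only: mult_ac)
  also have "(\<Sum>i\<in>UNIV. \<Sum>r\<in>UNIV. \<Sum>s\<in>UNIV. ?\<Gamma>' i r s * D x r b * D x s a * ?w' i)
     = (\<Sum>r\<in>UNIV. \<Sum>s\<in>UNIV. \<Sum>i\<in>UNIV. ?\<Gamma>' i r s * D x r b * D x s a * ?w' i)"
    by (rule sum_rot3[symmetric])
  also have "\<dots> = (\<Sum>r\<in>UNIV. \<Sum>s\<in>UNIV. D x r b * D x s a * (\<Sum>i\<in>UNIV. ?\<Gamma>' i r s * ?w' i))"
    by (simp only: sum_distrib_left mult_ac)
  finally show "cov1 G w x $ b $ a = (\<Sum>r\<in>UNIV. \<Sum>s\<in>UNIV. D x r b * D x s a * cov1 G' w' (\<phi> x) $ r $ s)"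
    by (simp only: sum_subtractf[symmetric] right_diff_distrib[symmetric] cov1_def vec_lambda_beta)
qed

lemma cov2_pull:
  assumes T: "pb2 T T'" and T': "\<And>i j. smooth_on Y (\<lambda>z. T' z $ i $ j)" and x: "x \<in> X"
  shows "cov2 G T x c a b = (\<Sum>r\<in>UNIV. \<Sum>m\<in>UNIV. \<Sum>n\<in>UNIV. D x r c * D x m a * D x n b * cov2 G' T' (\<phi> x) r m n)"
proof -
  let ?\<Gamma>' = "christoffel G' (\<phi> x)" and ?T = "\<lambda>i j. T' (\<phi> x) $ i $ j"
  note d = D_diff[OF x] chain[OF x smooth_on_diff[OF T' sub[OF x]]]
  have Tx1: "T x $ a $ b = (\<Sum>m\<in>UNIV. D x m a * (\<Sum>n\<in>UNIV. D x n b * ?T m n))" for a b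
    using T x by (simp add: pb2_def sum_distrib_left mult.assoc)
  have Tx2: "T x $ a $ b = (\<Sum>n\<in>UNIV. D x n b * (\<Sum>m\<in>UNIV. D x m a * ?T m n))" for a b
    unfolding Tx1 sum_distrib_left by (subst sum.swap) (simp only: mult_ac)
  \<comment> \<open>\<open>A1\<close> and \<open>A2\<close> are the terms in \<open>E\<close>
    belonging to the two indices of \<open>T\<close>. Each occurs once in the derivative and once in
    a Christoffel term, with opposite signs.\<close>
  define A1 where "A1 = (\<Sum>m\<in>UNIV. E x m c a * (\<Sum>n\<in>UNIV. D x n b * ?T m n))"
  define A2 where "A2 = (\<Sum>n\<in>UNIV. E x n c b * (\<Sum>m\<in>UNIV. D x m a * ?T m n))"
  have "pd c (\<lambda>z. T z $ a $ b) x = pd c (\<lambda>z. \<Sum>m\<in>UNIV. \<Sum>n\<in>UNIV. D z m a * D z n b * T' (\<phi> z) $ m $ n) x"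
    by (rule pd_cong_open[OF X x]) (use T in \<open>simp add: pb2_def\<close>)
  also have "\<dots> = (\<Sum>m\<in>UNIV. \<Sum>n\<in>UNIV. E x m c a * D x n b * ?T m n)
     + (\<Sum>m\<in>UNIV. \<Sum>n\<in>UNIV. D x m a * E x n c b * ?T m n)
     + (\<Sum>m\<in>UNIV. \<Sum>n\<in>UNIV. \<Sum>r\<in>UNIV. D x m a * D x n b * D x r c * pd r (\<lambda>z. T' z $ m $ n) (\<phi> x))"
    by (simp add: d E_def[symmetric] sum.distrib distrib_right distrib_left sum_distrib_left mult.assoc E_sym[OF x, of _ _ c])
  also have "(\<Sum>m\<in>UNIV. \<Sum>n\<in>UNIV. E x m c a * D x n b * ?T m n) = A1"
    unfolding A1_def sum_distrib_left by (simp only: mult_ac)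
  also have "(\<Sum>m\<in>UNIV. \<Sum>n\<in>UNIV. D x m a * E x n c b * ?T m n) = A2"
    unfolding A2_def sum_distrib_left by (subst sum.swap) (simp only: mult_ac)
  finally have 1: "pd c (\<lambda>z. T z $ a $ b) x = A1 + A2
     + (\<Sum>m\<in>UNIV. \<Sum>n\<in>UNIV. \<Sum>r\<in>UNIV. D x m a * D x n b * D x r c * pd r (\<lambda>z. T' z $ m $ n) (\<phi> x))" .
  have 2: "(\<Sum>d\<in>UNIV. christoffel G x d c a * T x $ d $ b) = A1
     + (\<Sum>m\<in>UNIV. \<Sum>r\<in>UNIV. \<Sum>s\<in>UNIV. \<Sum>n\<in>UNIV. ?\<Gamma>' m r s * D x r c * D x s a * D x n b * ?T m n)"
    unfolding Tx1 christoffel_D[OF x] A1_def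
    by (simp only: distrib_right sum.distrib, simp only: sum_distrib_right, simp only: sum_distrib_left mult.assoc)
  have 3: "(\<Sum>d\<in>UNIV. christoffel G x d c b * T x $ a $ d) = A2
     + (\<Sum>n\<in>UNIV. \<Sum>r\<in>UNIV. \<Sum>s\<in>UNIV. \<Sum>m\<in>UNIV. ?\<Gamma>' n r s * D x r c * D x s b * D x m a * ?T m n)"
    unfolding Tx2 christoffel_D[OF x] A2_def
    by (simp only: distrib_right sum.distrib, simp only: sum_distrib_right, simp only: sum_distrib_left mult.assoc)
  have 4: "(\<Sum>m\<in>UNIV. \<Sum>r\<in>UNIV. \<Sum>s\<in>UNIV. \<Sum>n\<in>UNIV. ?\<Gamma>' m r s * D x r c * D x s a * D x n b * ?T m n)
     = (\<Sum>r\<in>UNIV. \<Sum>m\<in>UNIV. \<Sum>n\<in>UNIV. D x r c * D x m a * D x n b * (\<Sum>d\<in>UNIV. ?\<Gamma>' d r m * ?T d n))"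
    by (subst sum_rot4[symmetric]) (simp only: sum_distrib_left mult_ac)
  have "(\<Sum>n\<in>UNIV. \<Sum>r\<in>UNIV. \<Sum>s\<in>UNIV. \<Sum>m\<in>UNIV. ?\<Gamma>' n r s * D x r c * D x s b * D x m a * ?T m n)
     = (\<Sum>r\<in>UNIV. \<Sum>s\<in>UNIV. \<Sum>m\<in>UNIV. \<Sum>n\<in>UNIV. ?\<Gamma>' n r s * D x r c * D x s b * D x m a * ?T m n)"
    by (rule sum_rot4[symmetric])
  also have "\<dots> = (\<Sum>r\<in>UNIV. \<Sum>m\<in>UNIV. \<Sum>s\<in>UNIV. \<Sum>n\<in>UNIV. ?\<Gamma>' n r s * D x r c * D x s b * D x m a * ?T m n)"
    by (rule sum.cong[OF refl]) (rule sum.swap)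
  also have "\<dots> = (\<Sum>r\<in>UNIV. \<Sum>m\<in>UNIV. \<Sum>n\<in>UNIV. D x r c * D x m a * D x n b * (\<Sum>d\<in>UNIV. ?\<Gamma>' d r n * ?T m d))"
    by (simp only: sum_distrib_left mult_ac)
  finally have 5: "(\<Sum>n\<in>UNIV. \<Sum>r\<in>UNIV. \<Sum>s\<in>UNIV. \<Sum>m\<in>UNIV. ?\<Gamma>' n r s * D x r c * D x s b * D x m a * ?T m n)
     = (\<Sum>r\<in>UNIV. \<Sum>m\<in>UNIV. \<Sum>n\<in>UNIV. D x r c * D x m a * D x n b * (\<Sum>d\<in>UNIV. ?\<Gamma>' d r n * ?T m d))" .
  have 6: "(\<Sum>m\<in>UNIV. \<Sum>n\<in>UNIV. \<Sum>r\<in>UNIV. D x m a * D x n b * D x r c * pd r (\<lambda>z. T' z $ m $ n) (\<phi> x))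
     = (\<Sum>r\<in>UNIV. \<Sum>m\<in>UNIV. \<Sum>n\<in>UNIV. D x r c * D x m a * D x n b * pd r (\<lambda>z. T' z $ m $ n) (\<phi> x))"
    by (subst sum_rot3) (simp only: mult_ac)
  show ?thesis
    unfolding cov2_def 1 2 3 4 5 6
    by (simp only: right_diff_distrib sum_subtractf)
qed

lemma pb_tr2:
  assumes T: "pb2 T T'" and x: "x \<in> X"
  shows "tr2 G T x = tr2 G' T' (\<phi> x)"
proof -
  have *: "T x $ a $ b = (\<Sum>i\<in>UNIV. \<Sum>j\<in>UNIV. D x i a * D x j b * T' (\<phi> x) $ i $ j)" for a b
    using T x by (simp add: pb2_def)
  show ?thesis unfolding tr2_def * by (rule sum_pull_pair) (rule ginv_pull[OF x])
qed

lemma pb_div1: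
  assumes "pb1 w w'" "\<And>i. smooth_on Y (\<lambda>z. w' z $ i)" "x \<in> X"
  shows "div1 G w x = div1 G' w' (\<phi> x)"
  unfolding div1_def by (intro pb_tr2 pb2_cov1 assms)

lemma pb1_apply2:
  assumes T: "pb2 T T'" and w: "pb1 w w'"
  shows "pb1 (apply2 G T w) (apply2 G' T' w')"
  unfolding pb1_def
proof (intro ballI allI)
  fix x a assume x: "x \<in> X"
  let ?u = "\<lambda>m. \<Sum>n\<in>UNIV. \<Sum>r\<in>UNIV. ginv G' (\<phi> x) $ n $ r * (T' (\<phi> x) $ m $ n * w' (\<phi> x) $ r)"
  have 1: "T x $ a $ b * ginv G x $ b $ c * w x $ c =
      (\<Sum>m\<in>UNIV. D x m a * (ginv G x $ b $ c * (\<Sum>n\<in>UNIV. \<Sum>r\<in>UNIV. D x n b * D x r c * (T' (\<phi> x) $ m $ n * w' (\<phi> x) $ r))))" for b c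
  proof -
    have "T x $ a $ b * w x $ c = (\<Sum>m\<in>UNIV. \<Sum>n\<in>UNIV. \<Sum>r\<in>UNIV. D x m a * (D x n b * D x r c * (T' (\<phi> x) $ m $ n * w' (\<phi> x) $ r)))"
      using T w x by (simp add: pb2_def pb1_def sum_distrib_left sum_distrib_right mult_ac)
    then have "ginv G x $ b $ c * (T x $ a $ b * w x $ c) =
      (\<Sum>m\<in>UNIV. D x m a * (ginv G x $ b $ c * (\<Sum>n\<in>UNIV. \<Sum>r\<in>UNIV. D x n b * D x r c * (T' (\<phi> x) $ m $ n * w' (\<phi> x) $ r))))"
      by (simp only: sum_distrib_left mult_ac)
    then show ?thesis by (simp only: mult_ac)
  qed
  have "apply2 G T w x $ a = (\<Sum>m\<in>UNIV. D x m a * (\<Sum>b\<in>UNIV. \<Sum>c\<in>UNIV. (ginv G x $ b $ c * (\<Sum>n\<in>UNIV. \<Sum>r\<in>UNIV. D x n b * D x r c * (T' (\<phi> x) $ m $ n * w' (\<phi> x) $ r)))))"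
    unfolding apply2_def vec_lambda_beta 1 by (subst sum_rot3) (simp only: sum_distrib_left)
  also have "\<dots> = (\<Sum>m\<in>UNIV. D x m a * ?u m)"
    by (subst sum_pull_pair[OF ginv_pull[OF x]]) rule
  also have "\<dots> = (\<Sum>m\<in>UNIV. D x m a * apply2 G' T' w' (\<phi> x) $ m)"
    unfolding apply2_def by (simp add: mult_ac)
  finally show "apply2 G T w x $ a = (\<Sum>m\<in>UNIV. D x m a * apply2 G' T' w' (\<phi> x) $ m)" .
qed

lemma pb1_div2:
  assumes T: "pb2 T T'" and T': "\<And>i j. smooth_on Y (\<lambda>z. T' z $ i $ j)"
  shows "pb1 (div2 G T) (div2 G' T')"
  unfolding pb1_def
proof (intro ballI allI)
  fix x b assume x: "x \<in> X"
  have 1: "ginv G x $ c $ a * cov2 G T x c a b =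
     (\<Sum>n\<in>UNIV. D x n b * (ginv G x $ c $ a * (\<Sum>r\<in>UNIV. \<Sum>m\<in>UNIV. D x r c * D x m a * cov2 G' T' (\<phi> x) r m n)))" for c a
    unfolding cov2_pull[OF T T' x] sum_distrib_left
    by (subst sum_rot3) (simp only: mult_ac)
  have "div2 G T x $ b = (\<Sum>n\<in>UNIV. D x n b * (\<Sum>c\<in>UNIV. \<Sum>a\<in>UNIV. (ginv G x $ c $ a * (\<Sum>r\<in>UNIV. \<Sum>m\<in>UNIV. D x r c * D x m a * cov2 G' T' (\<phi> x) r m n))))"
    unfolding div2_def vec_lambda_beta 1 by (subst sum_rot3) (simp only: sum_distrib_left)
  also have "\<dots> = (\<Sum>n\<in>UNIV. D x n b * div2 G' T' (\<phi> x) $ n)"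
    unfolding div2_def vec_lambda_beta by (subst sum_pull_pair[OF ginv_pull[OF x]]) rule
  finally show "div2 G T x $ b = (\<Sum>n\<in>UNIV. D x n b * div2 G' T' (\<phi> x) $ n)" .
qed

end

section \<open>Inner products and curvature\<close>

definition ip1 :: "'n::finite tensor2_field \<Rightarrow> 'n covector_field \<Rightarrow> 'n covector_field \<Rightarrow> real^'n \<Rightarrow> real" where
  "ip1 G v w x = (\<Sum>a\<in>UNIV. \<Sum>b\<in>UNIV. ginv G x $ a $ b * (v x $ a * w x $ b))"

text \<open>The polarisation of \<open>norm2_sq\<close>. The nesting of the sums allows
  \<open>sum_pull_pair\<close> to be applied to the inner pair of indices and afterwards to the
  outer one.\<close>

definition ip2 :: "'n::finite tensor2_field \<Rightarrow> 'n tensor2_field \<Rightarrow> 'n tensor2_field \<Rightarrow> real^'n \<Rightarrow> real" where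
  "ip2 G S T x = (\<Sum>a\<in>UNIV. \<Sum>c\<in>UNIV. ginv G x $ a $ c *
     (\<Sum>b\<in>UNIV. \<Sum>d\<in>UNIV. ginv G x $ b $ d * (S x $ a $ b * T x $ c $ d)))"

lemma norm1_sq_ip1: "norm1_sq G w x = ip1 G w w x"
  unfolding norm1_sq_def ip1_def by (simp only: mult.assoc)

lemma norm2_sq_ip2: "norm2_sq G T x = ip2 G T T x"
  unfolding norm2_sq_def ip2_def
  by (simp only: sum_distrib_left mult.assoc, rule sum.cong[OF refl], rule sum.swap)

text \<open>The curvature component with upper index \<open>k\<close> and lower indices
  \<open>i\<close>, \<open>d\<close>, \<open>j\<close>, antisymmetric in \<open>d\<close> and
  \<open>j\<close>. The Ricci tensor contracts \<open>k\<close> with \<open>d\<close>.\<close>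

definition riem :: "'n::finite tensor2_field \<Rightarrow> real^'n \<Rightarrow> 'n \<Rightarrow> 'n \<Rightarrow> 'n \<Rightarrow> 'n \<Rightarrow> real" where
  "riem G x k i d j = pd d (\<lambda>z. christoffel G z k i j) x - pd j (\<lambda>z. christoffel G z k i d) x
     + (\<Sum>l\<in>UNIV. christoffel G x k d l * christoffel G x l i j)
     - (\<Sum>l\<in>UNIV. christoffel G x k j l * christoffel G x l i d)"

lemma ricci_riem: "ricci G x $ i $ j = (\<Sum>k\<in>UNIV. riem G x k i k j)"
  unfolding ricci_def riem_def by (simp add: sum.distrib sum_subtractf)

context pullback

begin

lemma pb_ip1:
  assumes "pb1 v v'" "pb1 w w'" and x: "x \<in> X"
  shows "ip1 G v w x = ip1 G' v' w' (\<phi> x)"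
proof -
  have "v x $ a * w x $ b = (\<Sum>i\<in>UNIV. \<Sum>j\<in>UNIV. D x i a * D x j b * (v' (\<phi> x) $ i * w' (\<phi> x) $ j))" for a b
    using assms by (simp add: pb1_def sum_product mult_ac)
  then show ?thesis unfolding ip1_def by (simp only: sum_pull_pair[OF ginv_pull[OF x]])
qed

lemma pb_ip2:
  assumes S: "pb2 S S'" and T: "pb2 T T'" and x: "x \<in> X"
  shows "ip2 G S T x = ip2 G' S' T' (\<phi> x)"
proof -
  have S1: "S x $ a $ b = (\<Sum>j\<in>UNIV. D x j b * (\<Sum>i\<in>UNIV. D x i a * S' (\<phi> x) $ i $ j))" for a b
    using S x unfolding pb2_def sum_distrib_left by (subst sum.swap) (simp only: mult_ac)
  have T1: "T x $ a $ b = (\<Sum>j\<in>UNIV. D x j b * (\<Sum>i\<in>UNIV. D x i a * T' (\<phi> x) $ i $ j))" for a b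
    using T x unfolding pb2_def sum_distrib_left by (subst sum.swap) (simp only: mult_ac)
  have *: "(\<Sum>j\<in>UNIV. D x j b * A j) * (\<Sum>j\<in>UNIV. D x j d * C j) = (\<Sum>i\<in>UNIV. \<Sum>j\<in>UNIV. D x i b * D x j d * (A i * C j))"
    for A C :: "'n \<Rightarrow> real" and b d
    unfolding sum_product by (simp only: mult_ac)
  have "S x $ a $ b * T x $ c $ d = (\<Sum>i\<in>UNIV. \<Sum>j\<in>UNIV. D x i b * D x j d *
      ((\<Sum>m\<in>UNIV. D x m a * S' (\<phi> x) $ m $ i) * (\<Sum>n\<in>UNIV. D x n c * T' (\<phi> x) $ n $ j)))" for a b c d
    unfolding S1 T1 by (rule *)
  then have 1: "(\<Sum>b\<in>UNIV. \<Sum>d\<in>UNIV. ginv G x $ b $ d * (S x $ a $ b * T x $ c $ d)) =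
    (\<Sum>i\<in>UNIV. \<Sum>j\<in>UNIV. ginv G' (\<phi> x) $ i $ j * ((\<Sum>m\<in>UNIV. D x m a * S' (\<phi> x) $ m $ i) * (\<Sum>n\<in>UNIV. D x n c * T' (\<phi> x) $ n $ j)))" for a c
    by (simp only: sum_pull_pair[OF ginv_pull[OF x]])
  have 2: "(\<Sum>i\<in>UNIV. \<Sum>j\<in>UNIV. ginv G' (\<phi> x) $ i $ j * ((\<Sum>m\<in>UNIV. D x m a * S' (\<phi> x) $ m $ i) * (\<Sum>n\<in>UNIV. D x n c * T' (\<phi> x) $ n $ j)))
    = (\<Sum>m\<in>UNIV. \<Sum>n\<in>UNIV. D x m a * D x n c *
     (\<Sum>i\<in>UNIV. \<Sum>j\<in>UNIV. ginv G' (\<phi> x) $ i $ j * (S' (\<phi> x) $ m $ i * T' (\<phi> x) $ n $ j)))" for a c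
  proof -
    have "(\<Sum>i\<in>UNIV. \<Sum>j\<in>UNIV. ginv G' (\<phi> x) $ i $ j * ((\<Sum>m\<in>UNIV. D x m a * S' (\<phi> x) $ m $ i) * (\<Sum>n\<in>UNIV. D x n c * T' (\<phi> x) $ n $ j)))
      = (\<Sum>i\<in>UNIV. \<Sum>j\<in>UNIV. \<Sum>m\<in>UNIV. \<Sum>n\<in>UNIV. D x m a * D x n c * (ginv G' (\<phi> x) $ i $ j * (S' (\<phi> x) $ m $ i * T' (\<phi> x) $ n $ j)))"
      by (simp only: sum_product, simp only: sum_distrib_left mult_ac)
    also have "\<dots> = (\<Sum>m\<in>UNIV. \<Sum>n\<in>UNIV. \<Sum>i\<in>UNIV. \<Sum>j\<in>UNIV. D x m a * D x n c * (ginv G' (\<phi> x) $ i $ j * (S' (\<phi> x) $ m $ i * T' (\<phi> x) $ n $ j)))"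
      by (rule sum_swap_pairs)
    finally show ?thesis by (simp only: sum_distrib_left)
  qed
  show ?thesis unfolding ip2_def 1 2 by (rule sum_pull_pair) (rule ginv_pull[OF x])
qed

text \<open>One half of the curvature, obtained by differentiating \<open>christoffel_pull\<close>.
  All terms that are not tensorial are symmetric in \<open>b\<close> and \<open>d\<close>, so they
  vanish on antisymmetrisation in \<open>riem_pull\<close>.\<close>

lemma riem_pull_aux:
  assumes x: "x \<in> X"
  shows "(\<Sum>c\<in>UNIV. D x k c * (pd d (\<lambda>z. christoffel G z c a b) x + (\<Sum>l\<in>UNIV. christoffel G x c d l * christoffel G x l a b)))
    = pd d (\<lambda>z. E z k a b) x
    + (\<Sum>i\<in>UNIV. \<Sum>j\<in>UNIV. christoffel G' (\<phi> x) k i j * (E x i a d * D x j b + D x i a * E x j b d + E x i a b * D x j d))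
    + (\<Sum>i\<in>UNIV. \<Sum>e\<in>UNIV. \<Sum>f\<in>UNIV. D x i a * D x e d * D x f b *
        (pd e (\<lambda>z. christoffel G' z k i f) (\<phi> x) + (\<Sum>l\<in>UNIV. christoffel G' (\<phi> x) k e l * christoffel G' (\<phi> x) l i f)))"
proof -
  let ?\<Gamma> = "christoffel G x" and ?\<Gamma>' = "christoffel G' (\<phi> x)"
  note d = D_diff[OF x] E_diff[OF x] chain[OF x christoffel_diff[OF G' sub[OF x]]] christoffel_diff[OF metric x]
  have "pd d (\<lambda>z. \<Sum>c\<in>UNIV. D z k c * christoffel G z c a b) x =
    pd d (\<lambda>z. E z k a b + (\<Sum>i\<in>UNIV. \<Sum>j\<in>UNIV. christoffel G' (\<phi> z) k i j * D z i a * D z j b)) x"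
    by (rule pd_cong_open[OF X x]) (rule christoffel_pull)
  moreover have "pd d (\<lambda>z. \<Sum>c\<in>UNIV. D z k c * christoffel G z c a b) x =
     (\<Sum>c\<in>UNIV. E x k c d * ?\<Gamma> c a b) + (\<Sum>c\<in>UNIV. D x k c * pd d (\<lambda>z. christoffel G z c a b) x)"
    by (simp add: d E_def[symmetric] sum.distrib)
  moreover have "pd d (\<lambda>z. E z k a b + (\<Sum>i\<in>UNIV. \<Sum>j\<in>UNIV. christoffel G' (\<phi> z) k i j * D z i a * D z j b)) x
    = pd d (\<lambda>z. E z k a b) x + ((\<Sum>i\<in>UNIV. \<Sum>j\<in>UNIV. \<Sum>e\<in>UNIV. D x e d * pd e (\<lambda>z. christoffel G' z k i j) (\<phi> x) * (D x i a * D x j b))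
     + (\<Sum>i\<in>UNIV. \<Sum>j\<in>UNIV. ?\<Gamma>' k i j * E x i a d * D x j b) + (\<Sum>i\<in>UNIV. \<Sum>j\<in>UNIV. ?\<Gamma>' k i j * D x i a * E x j b d))"
    by (simp add: d E_def[symmetric] sum.distrib distrib_right distrib_left sum_distrib_right mult.assoc)
  ultimately have 1: "(\<Sum>c\<in>UNIV. D x k c * pd d (\<lambda>z. christoffel G z c a b) x) + (\<Sum>c\<in>UNIV. E x k c d * ?\<Gamma> c a b)
     = pd d (\<lambda>z. E z k a b) x + ((\<Sum>i\<in>UNIV. \<Sum>j\<in>UNIV. \<Sum>e\<in>UNIV. D x e d * pd e (\<lambda>z. christoffel G' z k i j) (\<phi> x) * (D x i a * D x j b))
     + (\<Sum>i\<in>UNIV. \<Sum>j\<in>UNIV. ?\<Gamma>' k i j * E x i a d * D x j b) + (\<Sum>i\<in>UNIV. \<Sum>j\<in>UNIV. ?\<Gamma>' k i j * D x i a * E x j b d))"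
    by linarith
  \<comment> \<open>The Christoffel law solved for the second derivatives of \<open>\<phi>\<close>.
    Substituting it turns products of \<open>E\<close> with Christoffel symbols into the quadratic
    terms of the curvature.\<close>
  have E1: "E x k c d = (\<Sum>e\<in>UNIV. D x k e * ?\<Gamma> e d c) - (\<Sum>j\<in>UNIV. D x j d * (\<Sum>i\<in>UNIV. ?\<Gamma>' k i j * D x i c))" for c
  proof -
    have "(\<Sum>i\<in>UNIV. \<Sum>j\<in>UNIV. ?\<Gamma>' k i j * D x i c * D x j d) = (\<Sum>j\<in>UNIV. D x j d * (\<Sum>i\<in>UNIV. ?\<Gamma>' k i j * D x i c))"
      unfolding sum_distrib_left by (subst sum.swap) (simp only: mult_ac)
    then show ?thesis using christoffel_pull[OF x, of k c d] by (simp add: christoffel_sym[OF metric x, of _ c d])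
  qed
  have "(\<Sum>c\<in>UNIV. (\<Sum>j\<in>UNIV. D x j d * (\<Sum>i\<in>UNIV. ?\<Gamma>' k i j * D x i c)) * ?\<Gamma> c a b)
     = (\<Sum>c\<in>UNIV. \<Sum>j\<in>UNIV. \<Sum>i\<in>UNIV. ?\<Gamma>' k i j * D x j d * (D x i c * ?\<Gamma> c a b))"
    by (simp only: sum_distrib_right sum_distrib_left mult_ac)
  also have "\<dots> = (\<Sum>j\<in>UNIV. \<Sum>i\<in>UNIV. ?\<Gamma>' k i j * D x j d * (\<Sum>c\<in>UNIV. D x i c * ?\<Gamma> c a b))"
    by (subst sum_rot3[symmetric]) (simp only: sum_distrib_left)
  also have "\<dots> = (\<Sum>i\<in>UNIV. \<Sum>j\<in>UNIV. ?\<Gamma>' k i j * D x j d * E x i a b)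
      + (\<Sum>j\<in>UNIV. \<Sum>i\<in>UNIV. ?\<Gamma>' k i j * D x j d * (\<Sum>r\<in>UNIV. \<Sum>s\<in>UNIV. ?\<Gamma>' i r s * D x r a * D x s b))"
    unfolding christoffel_pull[OF x] distrib_left sum.distrib by (simp only: sum.swap[of "\<lambda>i j. ?\<Gamma>' k i j * D x j d * E x i a b"])
  finally have 2: "(\<Sum>c\<in>UNIV. (\<Sum>j\<in>UNIV. D x j d * (\<Sum>i\<in>UNIV. ?\<Gamma>' k i j * D x i c)) * ?\<Gamma> c a b)
     = (\<Sum>i\<in>UNIV. \<Sum>j\<in>UNIV. ?\<Gamma>' k i j * D x j d * E x i a b)
      + (\<Sum>j\<in>UNIV. \<Sum>i\<in>UNIV. ?\<Gamma>' k i j * D x j d * (\<Sum>r\<in>UNIV. \<Sum>s\<in>UNIV. ?\<Gamma>' i r s * D x r a * D x s b))" .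
  have 3: "(\<Sum>c\<in>UNIV. (\<Sum>e\<in>UNIV. D x k e * ?\<Gamma> e d c) * ?\<Gamma> c a b) = (\<Sum>c\<in>UNIV. D x k c * (\<Sum>l\<in>UNIV. ?\<Gamma> c d l * ?\<Gamma> l a b))"
    unfolding sum_distrib_left sum_distrib_right by (subst sum.swap) (simp only: mult_ac)
  have 4: "(\<Sum>c\<in>UNIV. E x k c d * ?\<Gamma> c a b) = (\<Sum>c\<in>UNIV. D x k c * (\<Sum>l\<in>UNIV. ?\<Gamma> c d l * ?\<Gamma> l a b))
     - ((\<Sum>i\<in>UNIV. \<Sum>j\<in>UNIV. ?\<Gamma>' k i j * D x j d * E x i a b)
      + (\<Sum>j\<in>UNIV. \<Sum>i\<in>UNIV. ?\<Gamma>' k i j * D x j d * (\<Sum>r\<in>UNIV. \<Sum>s\<in>UNIV. ?\<Gamma>' i r s * D x r a * D x s b)))"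
    unfolding E1 left_diff_distrib sum_subtractf 2 3 ..
  have 5: "(\<Sum>i\<in>UNIV. \<Sum>j\<in>UNIV. \<Sum>e\<in>UNIV. D x e d * pd e (\<lambda>z. christoffel G' z k i j) (\<phi> x) * (D x i a * D x j b))
     = (\<Sum>i\<in>UNIV. \<Sum>e\<in>UNIV. \<Sum>f\<in>UNIV. D x i a * D x e d * D x f b * pd e (\<lambda>z. christoffel G' z k i f) (\<phi> x))"
    by (rule sum.cong[OF refl], subst sum.swap) (simp only: mult_ac)
  have "(\<Sum>j\<in>UNIV. \<Sum>i\<in>UNIV. ?\<Gamma>' k i j * D x j d * (\<Sum>r\<in>UNIV. \<Sum>s\<in>UNIV. ?\<Gamma>' i r s * D x r a * D x s b))
     = (\<Sum>e\<in>UNIV. \<Sum>l\<in>UNIV. \<Sum>i\<in>UNIV. \<Sum>f\<in>UNIV. D x i a * D x e d * D x f b * (?\<Gamma>' k e l * ?\<Gamma>' l i f))"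
    by (simp only: sum_distrib_left mult_ac christoffel_sym[OF G' sub[OF x], of k])
  also have "\<dots> = (\<Sum>e\<in>UNIV. \<Sum>i\<in>UNIV. \<Sum>f\<in>UNIV. \<Sum>l\<in>UNIV. D x i a * D x e d * D x f b * (?\<Gamma>' k e l * ?\<Gamma>' l i f))"
    by (rule sum.cong[OF refl]) (rule sum_rot3[symmetric])
  also have "\<dots> = (\<Sum>i\<in>UNIV. \<Sum>e\<in>UNIV. \<Sum>f\<in>UNIV. \<Sum>l\<in>UNIV. D x i a * D x e d * D x f b * (?\<Gamma>' k e l * ?\<Gamma>' l i f))"
    by (rule sum.swap)
  finally have 6: "(\<Sum>j\<in>UNIV. \<Sum>i\<in>UNIV. ?\<Gamma>' k i j * D x j d * (\<Sum>r\<in>UNIV. \<Sum>s\<in>UNIV. ?\<Gamma>' i r s * D x r a * D x s b))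
     = (\<Sum>i\<in>UNIV. \<Sum>e\<in>UNIV. \<Sum>f\<in>UNIV. D x i a * D x e d * D x f b * (\<Sum>l\<in>UNIV. ?\<Gamma>' k e l * ?\<Gamma>' l i f))"
    by (simp only: sum_distrib_left)
  have "(\<Sum>c\<in>UNIV. D x k c * (pd d (\<lambda>z. christoffel G z c a b) x + (\<Sum>l\<in>UNIV. ?\<Gamma> c d l * ?\<Gamma> l a b)))
     = (\<Sum>c\<in>UNIV. D x k c * pd d (\<lambda>z. christoffel G z c a b) x) + (\<Sum>c\<in>UNIV. D x k c * (\<Sum>l\<in>UNIV. ?\<Gamma> c d l * ?\<Gamma> l a b))"
    by (simp only: distrib_left sum.distrib)
  also have "\<dots> = pd d (\<lambda>z. E z k a b) x
    + ((\<Sum>i\<in>UNIV. \<Sum>j\<in>UNIV. ?\<Gamma>' k i j * E x i a d * D x j b) + (\<Sum>i\<in>UNIV. \<Sum>j\<in>UNIV. ?\<Gamma>' k i j * D x i a * E x j b d)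
       + (\<Sum>i\<in>UNIV. \<Sum>j\<in>UNIV. ?\<Gamma>' k i j * D x j d * E x i a b))
    + ((\<Sum>i\<in>UNIV. \<Sum>e\<in>UNIV. \<Sum>f\<in>UNIV. D x i a * D x e d * D x f b * pd e (\<lambda>z. christoffel G' z k i f) (\<phi> x))
      + (\<Sum>i\<in>UNIV. \<Sum>e\<in>UNIV. \<Sum>f\<in>UNIV. D x i a * D x e d * D x f b * (\<Sum>l\<in>UNIV. ?\<Gamma>' k e l * ?\<Gamma>' l i f)))"
    using 1 4 unfolding 5 6 by linarith
  also have "(\<Sum>i\<in>UNIV. \<Sum>j\<in>UNIV. ?\<Gamma>' k i j * E x i a d * D x j b) + (\<Sum>i\<in>UNIV. \<Sum>j\<in>UNIV. ?\<Gamma>' k i j * D x i a * E x j b d)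
       + (\<Sum>i\<in>UNIV. \<Sum>j\<in>UNIV. ?\<Gamma>' k i j * D x j d * E x i a b)
    = (\<Sum>i\<in>UNIV. \<Sum>j\<in>UNIV. ?\<Gamma>' k i j * (E x i a d * D x j b + D x i a * E x j b d + E x i a b * D x j d))"
    by (simp only: distrib_left sum.distrib mult_ac)
  also have "(\<Sum>i\<in>UNIV. \<Sum>e\<in>UNIV. \<Sum>f\<in>UNIV. D x i a * D x e d * D x f b * pd e (\<lambda>z. christoffel G' z k i f) (\<phi> x))
      + (\<Sum>i\<in>UNIV. \<Sum>e\<in>UNIV. \<Sum>f\<in>UNIV. D x i a * D x e d * D x f b * (\<Sum>l\<in>UNIV. ?\<Gamma>' k e l * ?\<Gamma>' l i f))
      = (\<Sum>i\<in>UNIV. \<Sum>e\<in>UNIV. \<Sum>f\<in>UNIV. D x i a * D x e d * D x f b *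
        (pd e (\<lambda>z. christoffel G' z k i f) (\<phi> x) + (\<Sum>l\<in>UNIV. ?\<Gamma>' k e l * ?\<Gamma>' l i f)))"
    by (simp only: distrib_left sum.distrib)
  finally show ?thesis .
qed

lemma riem_pull:
  assumes x: "x \<in> X"
  shows "(\<Sum>c\<in>UNIV. D x k c * riem G x c a d b) =
    (\<Sum>i\<in>UNIV. \<Sum>e\<in>UNIV. \<Sum>f\<in>UNIV. D x i a * D x e d * D x f b * riem G' (\<phi> x) k i e f)"
proof -
  let ?\<Gamma> = "christoffel G x" and ?\<Gamma>' = "christoffel G' (\<phi> x)"
  have r: "riem G x c a d b = (pd d (\<lambda>z. christoffel G z c a b) x + (\<Sum>l\<in>UNIV. ?\<Gamma> c d l * ?\<Gamma> l a b))
     - (pd b (\<lambda>z. christoffel G z c a d) x + (\<Sum>l\<in>UNIV. ?\<Gamma> c b l * ?\<Gamma> l a d))" for c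
    unfolding riem_def by simp
  define W where "W i e f = pd e (\<lambda>z. christoffel G' z k i f) (\<phi> x) + (\<Sum>l\<in>UNIV. ?\<Gamma>' k e l * ?\<Gamma>' l i f)" for i e f
  have r': "riem G' (\<phi> x) k i e f = W i e f - W i f e" for i e f
    unfolding riem_def W_def by simp
  have F: "pd d (\<lambda>z. E z k a b) x = pd b (\<lambda>z. E z k a d) x"
    unfolding E_def by (rule pd_commute[OF D_smooth x])
  have S: "E x i a d * D x j b + D x i a * E x j b d + E x i a b * D x j d
     = E x i a b * D x j d + D x i a * E x j d b + E x i a d * D x j b" for i j
    using E_sym[OF x, of j b d] by simp
  have T: "(\<Sum>i\<in>UNIV. \<Sum>e\<in>UNIV. \<Sum>f\<in>UNIV. D x i a * D x e b * D x f d * W i e f)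
    = (\<Sum>i\<in>UNIV. \<Sum>e\<in>UNIV. \<Sum>f\<in>UNIV. D x i a * D x e d * D x f b * W i f e)"
    by (rule sum.cong[OF refl], subst sum.swap) (simp only: mult_ac)
  have "(\<Sum>c\<in>UNIV. D x k c * riem G x c a d b) =
      (\<Sum>i\<in>UNIV. \<Sum>e\<in>UNIV. \<Sum>f\<in>UNIV. D x i a * D x e d * D x f b * W i e f)
    - (\<Sum>i\<in>UNIV. \<Sum>e\<in>UNIV. \<Sum>f\<in>UNIV. D x i a * D x e b * D x f d * W i e f)"
    unfolding r right_diff_distrib sum_subtractf riem_pull_aux[OF x] W_def[symmetric] F S by simp
  then show ?thesis unfolding T r' right_diff_distrib sum_subtractf .
qed

text \<open>\<open>B\<close> frees the upper index of \<open>riem_pull\<close>. In the trace it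
  meets the Jacobian of the lower index that is summed, and the two cancel.\<close>

lemma pb2_ricci: "pb2 (ricci G) (ricci G')"
  unfolding pb2_def
proof (intro ballI allI)
  fix x a b assume x: "x \<in> X"
  have *: "riem G x c a d b = (\<Sum>k\<in>UNIV. B x $ c $ k * (\<Sum>i\<in>UNIV. \<Sum>e\<in>UNIV. \<Sum>f\<in>UNIV. D x i a * D x e d * D x f b * riem G' (\<phi> x) k i e f))" for c d
  proof -
    have "(\<Sum>k\<in>UNIV. B x $ c $ k * (\<Sum>l\<in>UNIV. D x k l * riem G x l a d b)) = (\<Sum>l\<in>UNIV. (\<Sum>k\<in>UNIV. B x $ c $ k * D x k l) * riem G x l a d b)"
      unfolding sum_distrib_left by (subst sum.swap) (simp only: sum_distrib_right mult.assoc)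
    then show ?thesis by (simp only: BD[OF x] sum_kd_left riem_pull[OF x])
  qed
  let ?h = "\<lambda>k i e f. D x i a * D x f b * riem G' (\<phi> x) k i e f"
  have "ricci G x $ a $ b = (\<Sum>c\<in>UNIV. \<Sum>k\<in>UNIV. \<Sum>i\<in>UNIV. \<Sum>e\<in>UNIV. \<Sum>f\<in>UNIV. D x e c * B x $ c $ k * ?h k i e f)"
    unfolding ricci_riem * by (simp only: sum_distrib_left mult_ac)
  also have "\<dots> = (\<Sum>k\<in>UNIV. \<Sum>i\<in>UNIV. \<Sum>e\<in>UNIV. \<Sum>f\<in>UNIV. \<Sum>c\<in>UNIV. D x e c * B x $ c $ k * ?h k i e f)"
    by (subst sum.swap, rule sum.cong[OF refl], rule sum_rot4[symmetric])
  also have "\<dots> = (\<Sum>k\<in>UNIV. \<Sum>i\<in>UNIV. \<Sum>e\<in>UNIV. \<Sum>f\<in>UNIV. kd e k * ?h k i e f)"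
    by (simp only: sum_distrib_right[symmetric] DB[OF x])
  also have "\<dots> = (\<Sum>k\<in>UNIV. \<Sum>i\<in>UNIV. \<Sum>f\<in>UNIV. \<Sum>e\<in>UNIV. ?h k i e f * kd e k)"
    by (rule sum.cong[OF refl], rule sum.cong[OF refl], subst sum.swap) (simp only: mult_ac)
  also have "\<dots> = (\<Sum>k\<in>UNIV. \<Sum>i\<in>UNIV. \<Sum>f\<in>UNIV. ?h k i k f)"
    by (simp only: sum_kd_right)
  also have "\<dots> = (\<Sum>i\<in>UNIV. \<Sum>f\<in>UNIV. D x i a * D x f b * ricci G' (\<phi> x) $ i $ f)"
    unfolding ricci_riem by (subst sum_rot3[symmetric]) (simp only: sum_distrib_left)
  finally show "ricci G x $ a $ b = (\<Sum>i\<in>UNIV. \<Sum>f\<in>UNIV. D x i a * D x f b * ricci G' (\<phi> x) $ i $ f)" .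
qed

end

section \<open>Smoothness and locality of the tensor operations\<close>

definition sm1 :: "(real^'n::finite) set \<Rightarrow> 'n covector_field \<Rightarrow> bool" where
  "sm1 X w \<longleftrightarrow> (\<forall>i. smooth_on X (\<lambda>x. w x $ i))"

definition sm2 :: "(real^'n::finite) set \<Rightarrow> 'n tensor2_field \<Rightarrow> bool" where
  "sm2 X T \<longleftrightarrow> (\<forall>i j. smooth_on X (\<lambda>x. T x $ i $ j))"

lemma sm1D: "sm1 X w \<Longrightarrow> smooth_on X (\<lambda>x. w x $ i)" by (simp add: sm1_def)

lemma sm2D: "sm2 X T \<Longrightarrow> smooth_on X (\<lambda>x. T x $ i $ j)" by (simp add: sm2_def)

lemma sm1_diff: "sm1 X w \<Longrightarrow> x \<in> X \<Longrightarrow> (\<lambda>z. w z $ i) differentiable (at x)"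
  by (rule smooth_on_diff[OF sm1D])

lemma sm2_diff: "sm2 X T \<Longrightarrow> x \<in> X \<Longrightarrow> (\<lambda>z. T z $ i $ j) differentiable (at x)"
  by (rule smooth_on_diff[OF sm2D])

lemma sm1_grad1: "smooth_on X f \<Longrightarrow> sm1 X (grad1 f)"
  by (simp add: sm1_def grad1_def smooth_on_pd)

context
  fixes X :: "(real^'n::finite) set" and G :: "'n tensor2_field"
  assumes G: "metric_on X G"

begin

lemmas sm_intros = smooth_intros metric_open[OF G] metric_smooth[OF G] ginv_smooth[OF G] christoffel_smooth[OF G]

lemma sm2_metric: "sm2 X G"
  by (simp add: sm2_def metric_smooth[OF G])

lemma sm2_cov1: "sm1 X w \<Longrightarrow> sm2 X (cov1 G w)"
  unfolding sm2_def cov1_def vec_lambda_beta by (intro allI sm_intros sm1D)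

lemma smooth_cov2: "sm2 X T \<Longrightarrow> smooth_on X (\<lambda>x. cov2 G T x c a b)"
  unfolding cov2_def by (intro sm_intros sm2D)

lemma sm1_div2: "sm2 X T \<Longrightarrow> sm1 X (div2 G T)"
  unfolding sm1_def div2_def vec_lambda_beta by (intro allI sm_intros smooth_cov2)

lemma sm1_apply2: "sm2 X T \<Longrightarrow> sm1 X w \<Longrightarrow> sm1 X (apply2 G T w)"
  unfolding sm1_def[of _ "apply2 G T w"] apply2_def vec_lambda_beta by (intro allI sm_intros sm1D sm2D)

lemma smooth_tr2: "sm2 X T \<Longrightarrow> smooth_on X (\<lambda>x. tr2 G T x)"
  unfolding tr2_def by (intro sm_intros sm2D)

lemma smooth_div1: "sm1 X w \<Longrightarrow> smooth_on X (\<lambda>x. div1 G w x)"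
  unfolding div1_def by (intro smooth_tr2 sm2_cov1)

lemma smooth_lap: "smooth_on X f \<Longrightarrow> smooth_on X (\<lambda>x. lap G f x)"
  unfolding lap_def by (intro smooth_div1 sm1_grad1)

lemma smooth_ip1: "sm1 X v \<Longrightarrow> sm1 X w \<Longrightarrow> smooth_on X (\<lambda>x. ip1 G v w x)"
  unfolding ip1_def by (intro sm_intros sm1D)

lemma smooth_ip2: "sm2 X S \<Longrightarrow> sm2 X T \<Longrightarrow> smooth_on X (\<lambda>x. ip2 G S T x)"
  unfolding ip2_def by (intro sm_intros sm2D)

lemma sm2_ricci: "sm2 X (ricci G)"
  unfolding sm2_def ricci_def vec_lambda_beta by (intro allI sm_intros)

end

section \<open>Locality of the operations\<close>

lemma christoffel_cong:
  assumes X: "open X" "x \<in> X" and eq: "\<And>z. z \<in> X \<Longrightarrow> G z = G' z"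
  shows "christoffel G x k i j = christoffel G' x k i j"
proof -
  have "pd a (\<lambda>z. G z $ b $ c) x = pd a (\<lambda>z. G' z $ b $ c) x" for a b c
    by (rule pd_cong_open[OF X]) (simp add: eq)
  then show ?thesis unfolding christoffel_def ginv_def eq[OF X(2)] by presburger
qed

lemma cov1_cong:
  assumes X: "open X" "x \<in> X" and eq: "\<And>z. z \<in> X \<Longrightarrow> G z = G' z" and w: "\<And>z. z \<in> X \<Longrightarrow> w z = w' z"
  shows "cov1 G w x = cov1 G' w' x"
proof -
  have *: "pd a (\<lambda>z. w z $ b) x = pd a (\<lambda>z. w' z $ b) x" for a b
    by (rule pd_cong_open[OF X]) (simp add: w)
  have c: "christoffel G x k i j = christoffel G' x k i j" for k i j
    by (rule christoffel_cong[OF X]) (rule eq)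
  from * show ?thesis unfolding cov1_def c w[OF X(2)] by simp
qed

lemma div1_cong:
  assumes X: "open X" "x \<in> X" and eq: "\<And>z. z \<in> X \<Longrightarrow> G z = G' z" and w: "\<And>z. z \<in> X \<Longrightarrow> w z = w' z"
  shows "div1 G w x = div1 G' w' x"
proof -
  have "cov1 G w x = cov1 G' w' x" by (rule cov1_cong[OF X]) (rule eq w, assumption)+
  then show ?thesis unfolding div1_def tr2_def ginv_def eq[OF X(2)] by simp
qed

lemma div2_cong:
  assumes X: "open X" "x \<in> X" and eq: "\<And>z. z \<in> X \<Longrightarrow> G z = G' z" and T: "\<And>z. z \<in> X \<Longrightarrow> T z = T' z"
  shows "div2 G T x = div2 G' T' x"
proof -
  have *: "pd a (\<lambda>z. T z $ b $ c) x = pd a (\<lambda>z. T' z $ b $ c) x" for a b c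
    by (rule pd_cong_open[OF X]) (simp add: T)
  have c: "christoffel G x k i j = christoffel G' x k i j" for k i j
    by (rule christoffel_cong[OF X]) (rule eq)
  from * show ?thesis unfolding div2_def cov2_def ginv_def c T[OF X(2)] eq[OF X(2)] by simp
qed

lemma apply2_cong: "G x = G' x \<Longrightarrow> T x = T' x \<Longrightarrow> w x = w' x \<Longrightarrow> apply2 G T w x = apply2 G' T' w' x"
  by (simp add: apply2_def ginv_def)

lemma ip1_cong: "G x = G' x \<Longrightarrow> v x = v' x \<Longrightarrow> w x = w' x \<Longrightarrow> ip1 G v w x = ip1 G' v' w' x"
  by (simp add: ip1_def ginv_def)

lemma ip2_cong: "G x = G' x \<Longrightarrow> S x = S' x \<Longrightarrow> T x = T' x \<Longrightarrow> ip2 G S T x = ip2 G' S' T' x"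
  by (simp add: ip2_def ginv_def)

lemma tr2_cong: "G x = G' x \<Longrightarrow> T x = T' x \<Longrightarrow> tr2 G T x = tr2 G' T' x"
  by (simp add: tr2_def ginv_def)

section \<open>Conformal change of a metric\<close>

definition cmetric :: "(real^'n::finite \<Rightarrow> real) \<Rightarrow> 'n tensor2_field \<Rightarrow> 'n tensor2_field" where
  "cmetric \<omega> G x = (\<omega> x)\<^sup>2 *\<^sub>R G x"

definition dlog :: "(real^'n::finite \<Rightarrow> real) \<Rightarrow> 'n covector_field" where
  "dlog \<omega> x = (\<chi> i. pd i \<omega> x / \<omega> x)"

locale conformal =
  fixes X :: "(real^'n::finite) set" and G :: "'n tensor2_field" and \<omega> :: "real^'n \<Rightarrow> real"
  assumes G: "metric_on X G" and \<omega>: "smooth_on X \<omega>" and pos: "\<And>x. x \<in> X \<Longrightarrow> \<omega> x > 0"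

begin

abbreviation "G\<omega> \<equiv> cmetric \<omega> G"

abbreviation "u \<equiv> dlog \<omega>"

lemma \<omega>_diff: "x \<in> X \<Longrightarrow> \<omega> differentiable (at x)"
  by (rule smooth_on_diff[OF \<omega>])

lemma \<omega>0: "x \<in> X \<Longrightarrow> \<omega> x \<noteq> 0" using pos[of x] by simp

lemma pd_\<omega>: "x \<in> X \<Longrightarrow> pd i \<omega> x = \<omega> x * u x $ i"
  using \<omega>0[of x] by (simp add: dlog_def)

lemma sm1_u: "sm1 X u"
  unfolding sm1_def dlog_def vec_lambda_beta using \<omega>0 by (intro allI smooth_on_divide smooth_on_pd \<omega>)

lemma metric_cmetric: "metric_on X G\<omega>"
  unfolding metric_on_def
proof (intro conjI allI ballI impI)
  show "open X" by (rule metric_open[OF G])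
  show "smooth_on X (\<lambda>x. G\<omega> x $ i $ j)" for i j
    unfolding cmetric_def vector_scaleR_component real_scaleR_def
    by (intro smooth_intros \<omega> metric_smooth[OF G])
  fix x assume x: "x \<in> X"
  have "transpose (G x) = G x" using G x by (simp add: metric_on_def)
  then show "transpose (G\<omega> x) = G\<omega> x"
    by (simp add: cmetric_def transpose_def vec_eq_iff)
  fix v :: "real^'n" assume "v \<noteq> 0"
  then have "v \<bullet> (G x *v v) > 0" by (rule metric_pos[OF G x])
  moreover have "v \<bullet> (G\<omega> x *v v) = (\<omega> x)\<^sup>2 * (v \<bullet> (G x *v v))"
    by (simp add: cmetric_def scaleR_matrix_vector_assoc[symmetric])
  ultimately show "v \<bullet> (G\<omega> x *v v) > 0" using \<omega>0[OF x] by simp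
qed

lemma ginv_cmetric:
  assumes x: "x \<in> X"
  shows "ginv G\<omega> x $ i $ j = inverse ((\<omega> x)\<^sup>2) * ginv G x $ i $ j"
proof -
  have "ginv G\<omega> x = inverse ((\<omega> x)\<^sup>2) *\<^sub>R ginv G x"
    unfolding ginv_def[of G\<omega>]
    by (rule matrix_inv_unique)
       (use \<omega>0[OF x] in \<open>simp_all add: cmetric_def ginv_matrix[OF G x]
          matrix_scalar_ac scalar_matrix_assoc[symmetric]\<close>)
  then show ?thesis by simp
qed

lemma christ1_cmetric:
  assumes x: "x \<in> X"
  shows "christ1 G\<omega> x l i j = (\<omega> x)\<^sup>2 * (christ1 G x l i j + u x $ i * G x $ l $ j + u x $ j * G x $ l $ i - u x $ l * G x $ i $ j)"
proof -
  have "pd k (\<lambda>z. G\<omega> z $ i $ j) x = (\<omega> x)\<^sup>2 * (pd k (\<lambda>z. G z $ i $ j) x + 2 * u x $ k * G x $ i $ j)" for k i j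
    by (simp add: cmetric_def power2_eq_square \<omega>_diff[OF x] metric_diff[OF G x] pd_\<omega>[OF x] algebra_simps)
  then show ?thesis unfolding christ1_def by (simp add: algebra_simps)
qed

text \<open>The square of \<open>\<omega>\<close> in \<open>christ1_cmetric\<close> cancels against
  that of the inverse metric. What is added to the connection is the tensor \<open>u\<^sub>i
  \<delta>\<^sup>k\<^sub>j + u\<^sub>j \<delta>\<^sup>k\<^sub>i - g\<^sub>i\<^sub>j
  u\<^sup>k\<close>.\<close>

lemma christoffel_cmetric:
  assumes x: "x \<in> X"
  shows "christoffel G\<omega> x k i j = christoffel G x k i j + kd k j * u x $ i + kd k i * u x $ j
    - G x $ i $ j * (\<Sum>l\<in>UNIV. ginv G x $ k $ l * u x $ l)"
proof -
  have "christoffel G\<omega> x k i j = (\<Sum>l\<in>UNIV. ginv G x $ k $ l *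
      (christ1 G x l i j + u x $ i * G x $ l $ j + u x $ j * G x $ l $ i - u x $ l * G x $ i $ j))"
    unfolding christoffel_christ1 christ1_cmetric[OF x] ginv_cmetric[OF x]
    using \<omega>0[OF x] by (intro sum.cong refl) (simp add: field_simps)
  also have "\<dots> = christoffel G x k i j + (\<Sum>l\<in>UNIV. ginv G x $ k $ l * G x $ l $ j) * u x $ i
     + (\<Sum>l\<in>UNIV. ginv G x $ k $ l * G x $ l $ i) * u x $ j - G x $ i $ j * (\<Sum>l\<in>UNIV. ginv G x $ k $ l * u x $ l)"
    unfolding christoffel_christ1 sum_distrib_right sum_distrib_left
    by (simp only: sum.distrib[symmetric] sum_subtractf[symmetric]) (simp add: algebra_simps)
  finally show ?thesis by (simp only: ginv_left[OF G x])
qed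

end

section \<open>Two-dimensional identities\<close>

definition tf :: "2 tensor2_field \<Rightarrow> 2 tensor2_field \<Rightarrow> 2 tensor2_field" where
  "tf h T x = T x - (1/2 * tr2 h T x) *\<^sub>R h x"

definition sym2 :: "(real^'n::finite) set \<Rightarrow> 'n tensor2_field \<Rightarrow> bool" where
  "sym2 X T \<longleftrightarrow> (\<forall>x\<in>X. \<forall>i j. T x $ i $ j = T x $ j $ i)"

lemma sym2D: "sym2 X T \<Longrightarrow> x \<in> X \<Longrightarrow> T x $ i $ j = T x $ j $ i"
  by (simp add: sym2_def)

text \<open>The pointwise relations between a metric and its inverse in dimension two. With these as
  hypotheses, componentwise tensor identities become polynomial consequences that
  \<open>algebra\<close> can find.\<close>

lemma ginv2:
  fixes h :: "2 tensor2_field"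
  assumes h: "metric_on X h" and x: "x \<in> X"
  shows "ginv h x $ 2 $ 1 = ginv h x $ 1 $ 2" "h x $ 2 $ 1 = h x $ 1 $ 2"
    "ginv h x $ 1 $ 1 * h x $ 1 $ 1 + ginv h x $ 1 $ 2 * h x $ 1 $ 2 = 1"
    "ginv h x $ 1 $ 1 * h x $ 1 $ 2 + ginv h x $ 1 $ 2 * h x $ 2 $ 2 = 0"
    "ginv h x $ 1 $ 2 * h x $ 1 $ 1 + ginv h x $ 2 $ 2 * h x $ 1 $ 2 = 0"
    "ginv h x $ 1 $ 2 * h x $ 1 $ 2 + ginv h x $ 2 $ 2 * h x $ 2 $ 2 = 1"
proof -
  show *: "ginv h x $ 2 $ 1 = ginv h x $ 1 $ 2" "h x $ 2 $ 1 = h x $ 1 $ 2"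
    by (rule ginv_sym[OF h x], rule metric_sym[OF h x])
  show "ginv h x $ 1 $ 1 * h x $ 1 $ 1 + ginv h x $ 1 $ 2 * h x $ 1 $ 2 = 1"
    "ginv h x $ 1 $ 1 * h x $ 1 $ 2 + ginv h x $ 1 $ 2 * h x $ 2 $ 2 = 0"
    "ginv h x $ 1 $ 2 * h x $ 1 $ 1 + ginv h x $ 2 $ 2 * h x $ 1 $ 2 = 0"
    "ginv h x $ 1 $ 2 * h x $ 1 $ 2 + ginv h x $ 2 $ 2 * h x $ 2 $ 2 = 1"
    using ginv_left[OF h x, of 1 1] ginv_left[OF h x, of 1 2] ginv_left[OF h x, of 2 1] ginv_left[OF h x, of 2 2] *
    by (simp_all add: sum_2)
qed

lemma tr2_metric:
  fixes h :: "2 tensor2_field"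
  assumes h: "metric_on X h" and x: "x \<in> X"
  shows "tr2 h h x = 2"
  unfolding tr2_def sum_2 ginv2(1,2)[OF h x] using ginv2(3-6)[OF h x] by algebra

lemma tr2_linear: "tr2 h (\<lambda>z. S z - c *\<^sub>R T z) x = tr2 h S x - c * tr2 h T x" for h :: "2 tensor2_field"
  unfolding tr2_def sum_2 vector_minus_component vector_scaleR_component real_scaleR_def by algebra

lemma ip2_linear: "ip2 h (\<lambda>z. S z - c *\<^sub>R T z) U x = ip2 h S U x - c * ip2 h T U x" for h :: "2 tensor2_field"
  unfolding ip2_def sum_2 vector_minus_component vector_scaleR_component real_scaleR_def by algebra

lemma tr2_tf:
  assumes h: "metric_on X h" and x: "x \<in> X"
  shows "tr2 h (tf h T) x = 0"
proof -
  have "tr2 h (tf h T) x = tr2 h (\<lambda>z. T z - (1/2 * tr2 h T x) *\<^sub>R h z) x"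
    by (rule tr2_cong) (simp_all add: tf_def)
  then show ?thesis by (simp add: tr2_linear tr2_metric[OF h x])
qed

context
  fixes X :: "(real^2) set" and h :: "2 tensor2_field"
  assumes h: "metric_on X h"

begin

lemma sm2_tf: "sm2 X T \<Longrightarrow> sm2 X (tf h T)"
  unfolding sm2_def[of X "tf h T"] tf_def vector_minus_component vector_scaleR_component real_scaleR_def
  by (intro allI sm_intros[OF h] smooth_tr2[OF h] sm2D)

lemma sym2_tf: "sym2 X T \<Longrightarrow> sym2 X (tf h T)"
  unfolding sym2_def tf_def using metric_sym[OF h] by simp

lemma ip2_sym_2:
  assumes x: "x \<in> X"
  shows "ip2 h S T x = ip2 h T S x"
  unfolding ip2_def sum_2 ginv2(1)[OF h x] by algebra

lemma ip2_metric:
  assumes x: "x \<in> X"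
  shows "ip2 h h T x = tr2 h T x"
  unfolding ip2_def tr2_def sum_2 ginv2(1,2)[OF h x] using ginv2(3-6)[OF h x] by algebra

lemma ip2_tf_left:
  assumes x: "x \<in> X" and T: "tr2 h T x = 0"
  shows "ip2 h (tf h S) T x = ip2 h S T x"
proof -
  have "ip2 h (tf h S) T x = ip2 h (\<lambda>z. S z - (1/2 * tr2 h S x) *\<^sub>R h z) T x"
    by (rule ip2_cong) (simp_all add: tf_def)
  then show ?thesis using T by (simp add: ip2_linear ip2_metric[OF x])
qed

lemma div1_smult:
  assumes x: "x \<in> X" and a: "smooth_on X a" and w: "sm1 X w"
  shows "div1 h (\<lambda>x. a x *\<^sub>R w x) x = a x * div1 h w x + ip1 h (grad1 a) w x"
proof -
  have "pd i (\<lambda>z. (a z *\<^sub>R w z) $ j) x = pd i a x * w x $ j + a x * pd i (\<lambda>z. w z $ j) x" for i j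
    by (simp add: smooth_on_diff[OF a x] sm1_diff[OF w x])
  then show ?thesis
    unfolding div1_def tr2_def ip1_def cov1_def grad1_def sum_2 by (simp add: algebra_simps)
qed

text \<open>The product rule for \<open>T v\<close>. The inverse metric hidden in
  \<open>apply2\<close> contributes no term of its own because it is parallel.\<close>

lemma div1_apply2:
  assumes x: "x \<in> X" and T: "sm2 X T" and v: "sm1 X v" and s: "sym2 X T"
  shows "div1 h (apply2 h T v) x = ip1 h (div2 h T) v x + ip2 h T (cov1 h v) x"
proof -
  note d = ginv_diff[OF h x] sm1_diff[OF v x] sm2_diff[OF T x]
  have T21: "pd i (\<lambda>z. T z $ 2 $ 1) x = pd i (\<lambda>z. T z $ 1 $ 2) x" "T x $ 2 $ 1 = T x $ 1 $ 2" for i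
    using pd_cong_open[OF metric_open[OF h] x, of "\<lambda>z. T z $ 2 $ 1" "\<lambda>z. T z $ 1 $ 2"] sym2D[OF s] x by auto
  have pdA: "pd i (\<lambda>z. apply2 h T v z $ a) x = (\<Sum>b\<in>UNIV. \<Sum>c\<in>UNIV.
     pd i (\<lambda>z. T z $ a $ b) x * ginv h x $ b $ c * v x $ c
     + T x $ a $ b * pd i (\<lambda>z. ginv h z $ b $ c) x * v x $ c
     + T x $ a $ b * ginv h x $ b $ c * pd i (\<lambda>z. v z $ c) x)" for i a
    by (simp add: apply2_def d algebra_simps)
  show ?thesis
    unfolding div1_def tr2_def ip1_def ip2_def cov1_def div2_def cov2_def vec_lambda_beta pdA pd_ginv_christoffel[OF h x]
    unfolding apply2_def vec_lambda_beta sum_2 T21 ginv2(1)[OF h x] christoffel_sym[OF h x, of _ 2 1]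
    by algebra
qed

text \<open>Cayley-Hamilton: an endomorphism of a plane with trace zero squares to half the trace of
  its square times the identity.\<close>

lemma apply2_apply2:
  assumes x: "x \<in> X" and L: "sym2 X L" and t: "tr2 h L x = 0"
  shows "apply2 h L (apply2 h L w) x = (1/2 * ip2 h L L x) *\<^sub>R w x"
proof -
  have "T = ginv h x $ 1 $ 1 * L x $ 1 $ 1 + 2 * ginv h x $ 1 $ 2 * L x $ 1 $ 2 + ginv h x $ 2 $ 2 * L x $ 2 $ 2 \<Longrightarrow> T = tr2 h L x" for T
    unfolding tr2_def sum_2 using sym2D[OF L x, of 2 1] ginv2(1)[OF h x] by simp
  then have t': "ginv h x $ 1 $ 1 * L x $ 1 $ 1 + 2 * ginv h x $ 1 $ 2 * L x $ 1 $ 2 + ginv h x $ 2 $ 2 * L x $ 2 $ 2 = 0"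
    using t by simp
  have "apply2 h L (apply2 h L w) x $ a = 1/2 * ip2 h L L x * w x $ a" for a
  proof -
    have "2 * (apply2 h L (apply2 h L w) x $ a) = ip2 h L L x * w x $ a"
      using exhaust_2[of a]
    proof
      assume a: "a = 1"
      show ?thesis unfolding a apply2_def ip2_def vec_lambda_beta sum_2 sym2D[OF L x, of 2 1] ginv2(1)[OF h x]
        using t' by algebra
    next
      assume a: "a = 2"
      show ?thesis unfolding a apply2_def ip2_def vec_lambda_beta sum_2 sym2D[OF L x, of 2 1] ginv2(1)[OF h x]
        using t' by algebra
    qed
    then show ?thesis by simp
  qed
  then show ?thesis by (simp add: vec_eq_iff)
qed

end

lemma one_neq_two: "(1::2) \<noteq> 2" "(2::2) \<noteq> 1"
  by simp_all

lemmas kd2 = one_neq_two refl if_True if_False simp_thms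

locale conformal2 = conformal X h \<omega> for X :: "(real^2) set" and h :: "2 tensor2_field" and \<omega>

begin

abbreviation "h\<omega> \<equiv> cmetric \<omega> h"

text \<open>All eight symbols are written out without Kronecker symbols, so that only polynomials
  reach \<open>algebra\<close>. \<open>U\<close> is \<open>u\<close> with its index raised.\<close>

lemma christ2:
  assumes x: "x \<in> X"
  defines "U k \<equiv> ginv h x $ k $ 1 * u x $ 1 + ginv h x $ k $ 2 * u x $ 2"
  shows "christoffel h\<omega> x 1 1 1 = christoffel h x 1 1 1 + 2 * u x $ 1 - h x $ 1 $ 1 * U 1"
    "christoffel h\<omega> x 2 1 1 = christoffel h x 2 1 1 - h x $ 1 $ 1 * U 2"
    "christoffel h\<omega> x 1 1 2 = christoffel h x 1 1 2 + u x $ 2 - h x $ 1 $ 2 * U 1"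
    "christoffel h\<omega> x 2 1 2 = christoffel h x 2 1 2 + u x $ 1 - h x $ 1 $ 2 * U 2"
    "christoffel h\<omega> x 1 2 1 = christoffel h x 1 1 2 + u x $ 2 - h x $ 1 $ 2 * U 1"
    "christoffel h\<omega> x 2 2 1 = christoffel h x 2 1 2 + u x $ 1 - h x $ 1 $ 2 * U 2"
    "christoffel h\<omega> x 1 2 2 = christoffel h x 1 2 2 - h x $ 2 $ 2 * U 1"
    "christoffel h\<omega> x 2 2 2 = christoffel h x 2 2 2 + 2 * u x $ 2 - h x $ 2 $ 2 * U 2"
  unfolding christoffel_cmetric[OF x] U_def sum_2 christoffel_sym[OF G x, of _ 2 1] ginv2(2)[OF G x]
  by (simp_all add: kd2)

text \<open>\<open>algebra\<close> treats \<open>inverse (\<omega> x)\<close> as an indeterminate,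
  hence a product in place of a power of \<open>\<omega>\<close>. Where its relation to
  \<open>\<omega> x\<close> matters, \<open>inv\<omega>\<close> supplies it.\<close>

lemma ginv_cmetric': "x \<in> X \<Longrightarrow> ginv h\<omega> x $ i $ j = inverse (\<omega> x) * inverse (\<omega> x) * ginv h x $ i $ j"
  using ginv_cmetric[of x i j] by (simp add: power2_eq_square)

lemma inv\<omega>: "x \<in> X \<Longrightarrow> inverse (\<omega> x) * \<omega> x = 1"
  using \<omega>0 by simp

text \<open>The trace over the lower indices of the tensor added to the connection is
  \<open>(2 - n) u\<close>, which vanishes in dimension \<open>n = 2\<close>.\<close>

lemma div1_cmetric:
  assumes x: "x \<in> X"
  shows "div1 h\<omega> w x = inverse (\<omega> x) * inverse (\<omega> x) * div1 h w x"
  unfolding div1_def tr2_def cov1_def vec_lambda_beta ginv_cmetric'[OF x] sum_2 christ2[OF x]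
    christoffel_sym[OF G x, of _ 2 1] ginv2(1)[OF G x]
  using ginv2(3-6)[OF G x] by algebra

text \<open>In dimension \<open>n\<close> the connection change adds
  \<open>(n - 2) T u - (tr T) u\<close> to the divergence, which is zero for trace-free
  \<open>T\<close> and \<open>n = 2\<close>. The term \<open>T u\<close> comes from differentiating
  the factor \<open>\<omega>\<close>.\<close>

lemma div2_cmetric:
  assumes x: "x \<in> X" and T: "sm2 X T" and s: "sym2 X T" and t: "tr2 h T x = 0"
  shows "div2 h\<omega> (\<lambda>x. \<omega> x *\<^sub>R T x) x = inverse (\<omega> x) *\<^sub>R (div2 h T x + apply2 h T u x)"
proof -
  have pdT: "pd i (\<lambda>z. (\<omega> z *\<^sub>R T z) $ a $ b) x = \<omega> x * (u x $ i * T x $ a $ b + pd i (\<lambda>z. T z $ a $ b) x)" for i a b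
    by (simp add: \<omega>_diff[OF x] sm2_diff[OF T x] pd_\<omega>[OF x] algebra_simps)
  have T21: "pd i (\<lambda>z. T z $ 2 $ 1) x = pd i (\<lambda>z. T z $ 1 $ 2) x" "T x $ 2 $ 1 = T x $ 1 $ 2" for i
    using pd_cong_open[OF metric_open[OF G] x, of "\<lambda>z. T z $ 2 $ 1" "\<lambda>z. T z $ 1 $ 2"] sym2D[OF s] x by auto
  have t': "ginv h x $ 1 $ 1 * T x $ 1 $ 1 + 2 * ginv h x $ 1 $ 2 * T x $ 1 $ 2 + ginv h x $ 2 $ 2 * T x $ 2 $ 2 = 0"
    using t unfolding tr2_def sum_2 T21 ginv2(1)[OF G x] by algebra
  \<comment> \<open>The product \<open>inverse (\<omega> x) * \<omega> x\<close> is kept: as a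
    polynomial identity in both indeterminates the equation holds with it, and it is cancelled
    afterwards.\<close>
  have *: "div2 h\<omega> (\<lambda>x. \<omega> x *\<^sub>R T x) x $ b = inverse (\<omega> x) * (inverse (\<omega> x) * \<omega> x) * (div2 h T x $ b + apply2 h T u x $ b)" for b
    using exhaust_2[of b]
  proof
    assume b: "b = 1"
    show ?thesis unfolding b div2_def apply2_def cov2_def vec_lambda_beta pdT
      unfolding vector_scaleR_component real_scaleR_def ginv_cmetric'[OF x] sum_2 christ2[OF x]
        christoffel_sym[OF G x, of _ 2 1] ginv2(1)[OF G x] T21
      using ginv2(3-6)[OF G x] t' by algebra
  next
    assume b: "b = 2"
    show ?thesis unfolding b div2_def apply2_def cov2_def vec_lambda_beta pdT
      unfolding vector_scaleR_component real_scaleR_def ginv_cmetric'[OF x] sum_2 christ2[OF x]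
        christoffel_sym[OF G x, of _ 2 1] ginv2(1)[OF G x] T21
      using ginv2(3-6)[OF G x] t' by algebra
  qed
  show ?thesis unfolding vec_eq_iff * inv\<omega>[OF x] by simp
qed

text \<open>The Hessian is needed only modulo multiples of the metric, since \<open>opA\<close>
  takes its trace-free part.\<close>

lemma hessian_cmetric:
  assumes x: "x \<in> X" and f: "smooth_on X f"
  shows "\<exists>c. \<forall>a b. cov1 h\<omega> (grad1 (\<lambda>x. \<omega> x * f x)) x $ a $ b =
     \<omega> x * (cov1 h (grad1 f) x $ a $ b + f x * (cov1 h u x $ a $ b - u x $ a * u x $ b)) + c * h x $ a $ b"
proof -
  let ?U = "\<lambda>k. ginv h x $ k $ 1 * u x $ 1 + ginv h x $ k $ 2 * u x $ 2"
  \<comment> \<open>The inner product of \<open>u\<close> with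
    \<open>d (\<omega> f) = \<omega> (df + f u)\<close>, coming from the metric term in the change
    of the connection.\<close>
  let ?c = "\<omega> x * (?U 1 * (pd 1 f x + u x $ 1 * f x) + ?U 2 * (pd 2 f x + u x $ 2 * f x))"
  note X = metric_open[OF G]
  have fd: "z \<in> X \<Longrightarrow> f differentiable (at z)" for z by (rule smooth_on_diff[OF f])
  have p1: "pd b (\<lambda>x. \<omega> x * f x) z = \<omega> z * (u z $ b * f z + pd b f z)" if "z \<in> X" for b z
    using that by (simp add: \<omega>_diff fd pd_\<omega> algebra_simps)
  have "pd a (\<lambda>z. pd b (\<lambda>x. \<omega> x * f x) z) x = pd a (\<lambda>z. \<omega> z * (u z $ b * f z + pd b f z)) x" for a b
    by (rule pd_cong_open[OF X x p1])
  then have p2: "pd a (\<lambda>z. pd b (\<lambda>x. \<omega> x * f x) z) x = \<omega> x * (u x $ a * (u x $ b * f x + pd b f x)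
     + pd a (\<lambda>z. u z $ b) x * f x + u x $ b * pd a f x + pd a (\<lambda>z. pd b f z) x)" for a b
    by (simp add: \<omega>_diff[OF x] fd[OF x] pd_\<omega>[OF x] sm1_diff[OF sm1_u x] smooth_on_diff[OF smooth_on_pd[OF f] x] algebra_simps)
  show ?thesis
    by (rule exI[of _ ?c])
       (simp only: forall_2 cov1_def grad1_def vec_lambda_beta p1[OF x] p2 sum_2 christ2[OF x] christoffel_sym[OF G x, of _ 2 1] ginv2(2)[OF G x],
        intro conjI; algebra)
qed

end

section \<open>Linearity and product rules\<close>

lemma sm1_add: "sm1 X v \<Longrightarrow> sm1 X w \<Longrightarrow> sm1 X (\<lambda>x. v x + w x)"
  unfolding sm1_def vector_add_component by (intro allI smooth_on_add) simp_all

lemma sm1_diff': "sm1 X v \<Longrightarrow> sm1 X w \<Longrightarrow> sm1 X (\<lambda>x. v x - w x)"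
  unfolding sm1_def vector_minus_component by (intro allI smooth_on_sub) simp_all

lemma sm1_smult: "smooth_on X a \<Longrightarrow> sm1 X w \<Longrightarrow> sm1 X (\<lambda>x. a x *\<^sub>R w x)"
  unfolding sm1_def vector_scaleR_component real_scaleR_def by (intro allI smooth_on_mult) simp_all

lemma sm2_add: "sm2 X S \<Longrightarrow> sm2 X T \<Longrightarrow> sm2 X (\<lambda>x. S x + T x)"
  unfolding sm2_def vector_add_component by (intro allI smooth_on_add) simp_all

lemma sm2_smult: "smooth_on X a \<Longrightarrow> sm2 X T \<Longrightarrow> sm2 X (\<lambda>x. a x *\<^sub>R T x)"
  unfolding sm2_def vector_scaleR_component real_scaleR_def by (intro allI smooth_on_mult) simp_all

lemma sm2_cong: "sm2 X S \<Longrightarrow> (\<And>x. x \<in> X \<Longrightarrow> S x = T x) \<Longrightarrow> sm2 X T"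
  unfolding sm2_def using smooth_on_cong[of X "\<lambda>x. S x $ i $ j" "\<lambda>x. T x $ i $ j" for i j] by auto

lemma sym2_add: "sym2 X S \<Longrightarrow> sym2 X T \<Longrightarrow> sym2 X (\<lambda>x. S x + T x)"
  and sym2_smult: "sym2 X T \<Longrightarrow> sym2 X (\<lambda>x. a x *\<^sub>R T x)"
  by (simp_all add: sym2_def)

lemma ip2_add_right: "ip2 G S (\<lambda>x. T x + c *\<^sub>R U x) x = ip2 G S T x + c * ip2 G S U x" for G :: "2 tensor2_field"
  unfolding ip2_def sum_2 vector_add_component vector_scaleR_component real_scaleR_def by algebra

lemma ip2_add_left: "ip2 G (\<lambda>x. T x + c *\<^sub>R U x) S x = ip2 G T S x + c * ip2 G U S x" for G :: "2 tensor2_field"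
  unfolding ip2_def sum_2 vector_add_component vector_scaleR_component real_scaleR_def by algebra

lemma ip1_lin_right: "ip1 G v (\<lambda>x. a *\<^sub>R w x + b *\<^sub>R z x) x = a * ip1 G v w x + b * ip1 G v z x" for G :: "2 tensor2_field"
  unfolding ip1_def sum_2 vector_add_component vector_scaleR_component real_scaleR_def by algebra

lemma ip1_lin_left: "ip1 G (\<lambda>x. a *\<^sub>R w x + b *\<^sub>R z x) v x = a * ip1 G w v x + b * ip1 G z v x" for G :: "2 tensor2_field"
  unfolding ip1_def sum_2 vector_add_component vector_scaleR_component real_scaleR_def by algebra

lemma apply2_lin_right: "apply2 G T (\<lambda>x. a *\<^sub>R w x + b *\<^sub>R z x) x = a *\<^sub>R apply2 G T w x + b *\<^sub>R apply2 G T z x" for G :: "2 tensor2_field"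
  unfolding apply2_def sum_2 vec_eq_iff vector_add_component vector_scaleR_component real_scaleR_def vec_lambda_beta
  by (intro allI, algebra)

lemma apply2_lin_left: "apply2 G (\<lambda>x. a *\<^sub>R S x + b *\<^sub>R T x) w x = a *\<^sub>R apply2 G S w x + b *\<^sub>R apply2 G T w x" for G :: "2 tensor2_field"
  unfolding apply2_def sum_2 vec_eq_iff vector_add_component vector_scaleR_component real_scaleR_def vec_lambda_beta
  by (intro allI, algebra)

context
  fixes X :: "(real^2) set" and h :: "2 tensor2_field"
  assumes h: "metric_on X h"

begin

lemma apply2_metric: "x \<in> X \<Longrightarrow> apply2 h h w x = w x"
  unfolding vec_eq_iff forall_2 apply2_def sum_2 vec_lambda_beta
  using ginv2(3-6)[OF h, of x] by (simp only: ginv2(1,2)[OF h], intro conjI; algebra)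

lemma ip1_sym: "x \<in> X \<Longrightarrow> ip1 h v w x = ip1 h w v x"
  unfolding ip1_def sum_2 by (simp only: ginv2(1)[OF h]) algebra

lemma ip1_apply2:
  assumes x: "x \<in> X" and T: "sym2 X T"
  shows "ip1 h v (apply2 h T w) x = ip1 h (apply2 h T v) w x"
  unfolding ip1_def apply2_def sum_2 vec_lambda_beta sym2D[OF T x, of 2 1] ginv2(1)[OF h x] by algebra

lemma ip2_outer:
  assumes x: "x \<in> X" and T: "sym2 X T"
  shows "ip2 h (\<lambda>z. \<chi> a b. v z $ a * w z $ b) T x = ip1 h (apply2 h T v) w x"
  unfolding ip2_def ip1_def apply2_def sum_2 vec_lambda_beta sym2D[OF T x, of 2 1] ginv2(1)[OF h x] by algebra

lemma div1_add:
  assumes x: "x \<in> X" and v: "sm1 X v" and w: "sm1 X w"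
  shows "div1 h (\<lambda>x. v x + w x) x = div1 h v x + div1 h w x"
  unfolding div1_def tr2_def cov1_def vec_lambda_beta vector_add_component sum_2
    pd_add[OF sm1_diff[OF v x] sm1_diff[OF w x]] by algebra

lemma div1_sub:
  assumes x: "x \<in> X" and v: "sm1 X v" and w: "sm1 X w"
  shows "div1 h (\<lambda>x. v x - w x) x = div1 h v x - div1 h w x"
  unfolding div1_def tr2_def cov1_def vec_lambda_beta vector_minus_component sum_2
    pd_diff[OF sm1_diff[OF v x] sm1_diff[OF w x]] by algebra

lemma div1_const:
  assumes x: "x \<in> X" and w: "sm1 X w"
  shows "div1 h (\<lambda>x. c *\<^sub>R w x) x = c * div1 h w x"
proof -
  have "ip1 h (grad1 (\<lambda>x. c)) w x = 0" by (simp add: ip1_def grad1_def)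
  then show ?thesis using div1_smult[OF h x smooth_on_const[OF metric_open[OF h]] w, of c] by simp
qed

lemma div2_add:
  assumes x: "x \<in> X" and S: "sm2 X S" and T: "sm2 X T"
  shows "div2 h (\<lambda>x. S x + T x) x = div2 h S x + div2 h T x"
  unfolding vec_eq_iff div2_def cov2_def vec_lambda_beta vector_add_component sum_2
    pd_add[OF sm2_diff[OF S x] sm2_diff[OF T x]] by (intro allI, algebra)

lemma div2_smult:
  assumes x: "x \<in> X" and a: "smooth_on X a" and T: "sm2 X T" and s: "sym2 X T"
  shows "div2 h (\<lambda>x. a x *\<^sub>R T x) x = a x *\<^sub>R div2 h T x + apply2 h T (grad1 a) x"
  unfolding vec_eq_iff forall_2 div2_def cov2_def apply2_def grad1_def vec_lambda_beta vector_add_component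
    vector_scaleR_component real_scaleR_def sum_2 pd_mult[OF smooth_on_diff[OF a x] sm2_diff[OF T x]]
    sym2D[OF s x, of 2 1] ginv2(1)[OF h x]
  by (intro conjI; algebra)

lemma div2_metric: "x \<in> X \<Longrightarrow> div2 h h x = 0"
proof -
  assume x: "x \<in> X"
  have "cov2 h h x c a b = 0" for c a b
    unfolding cov2_def metric_compat[OF h x] using metric_sym[OF h x] by (simp add: mult.commute)
  then show ?thesis by (simp add: div2_def vec_eq_iff)
qed

section \<open>Curvature in dimension two and the Bochner formula\<close>

text \<open>\<open>A\<close>, \<open>B\<close>, \<open>C\<close>, \<open>D\<close> stand for
  \<open>riem h x k l 1 2\<close> with \<open>(k, l)\<close> running through (1,1), (1,2), (2,1),
  (2,2). The hypotheses \<open>R\<close> make this antisymmetric once \<open>l\<close> is raised, so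
  a single number is left. Summands such as \<open>0 + - C\<close> reproduce the Ricci components
  literally, as \<open>riem\<close> terms with vanishing ones included.\<close>

lemma ricci2_algebra:
  fixes p q r a b c A B C D :: real
  assumes h: "p * a + q * b = 1" "p * b + q * c = 0" "q * a + r * b = 0" "q * b + r * c = 1"
    and R: "p * A + q * B + (p * A + q * B) = 0" "p * C + q * D + (q * A + r * B) = 0" "q * C + r * D + (q * C + r * D) = 0"
  shows "2 * (0 + - C) = (p * (0 + - C) + q * (A + 0) + (q * (0 + - D) + r * (B + 0))) * a"
    "2 * (A + 0) = (p * (0 + - C) + q * (A + 0) + (q * (0 + - D) + r * (B + 0))) * b"
    "2 * (0 + - D) = (p * (0 + - C) + q * (A + 0) + (q * (0 + - D) + r * (B + 0))) * b"
    "2 * (B + 0) = (p * (0 + - C) + q * (A + 0) + (q * (0 + - D) + r * (B + 0))) * c"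
proof -
  \<comment> \<open>The Gauss curvature: the Ricci components turn out to be \<open>\<rho>\<close>
    times those of the metric.\<close>
  define \<rho> where "\<rho> = q * A + r * B"
  have "A = (p * A + q * B) * a + (q * A + r * B) * b" "B = (p * A + q * B) * b + (q * A + r * B) * c"
    "C = (p * C + q * D) * a + (q * C + r * D) * b" "D = (p * C + q * D) * b + (q * C + r * D) * c"
    using h by algebra+
  moreover have "p * A + q * B = 0" "q * C + r * D = 0" "p * C + q * D = - \<rho>" "q * A + r * B = \<rho>"
    using R unfolding \<rho>_def by linarith+
  ultimately have e: "A = \<rho> * b" "B = \<rho> * c" "C = - \<rho> * a" "D = - \<rho> * b" by simp_all
  have t: "p * (0 + - C) + q * (A + 0) + (q * (0 + - D) + r * (B + 0)) = 2 * \<rho>"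
    unfolding e using h by algebra
  show "2 * (0 + - C) = (p * (0 + - C) + q * (A + 0) + (q * (0 + - D) + r * (B + 0))) * a"
    "2 * (A + 0) = (p * (0 + - C) + q * (A + 0) + (q * (0 + - D) + r * (B + 0))) * b"
    "2 * (0 + - D) = (p * (0 + - C) + q * (A + 0) + (q * (0 + - D) + r * (B + 0))) * b"
    "2 * (B + 0) = (p * (0 + - C) + q * (A + 0) + (q * (0 + - D) + r * (B + 0))) * c"
    unfolding t by (simp_all add: e)
qed

text \<open>In the same notation, with \<open>v\<close> and \<open>w\<close> the components of a
  one-form: the curvature contraction arising from commuting derivatives is the Ricci tensor applied
  to the form. Again the shape is that of the unsimplified sums.\<close>

lemma bochner_algebra:
  fixes p q r A B C D v w :: real
  assumes "p * A + q * B + (p * A + q * B) = 0" "p * C + q * D + (q * A + r * B) = 0" "q * C + r * D + (q * C + r * D) = 0" "A + D = 0"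
  shows "- (p * 0 * v + p * 0 * w + (q * 0 * v + q * 0 * w) + (q * - A * v + q * - C * w + (r * - B * v + r * - D * w)))
      = (0 + - C) * p * v + (0 + - C) * q * w + ((A + 0) * q * v + (A + 0) * r * w)"
    "- (p * A * v + p * C * w + (q * B * v + q * D * w) + (q * 0 * v + q * 0 * w + (r * 0 * v + r * 0 * w)))
      = (0 + - D) * p * v + (0 + - D) * q * w + ((B + 0) * q * v + (B + 0) * r * w)"
proof -
  have D: "D = - A" using assms(4) by linarith
  have 1: "q * B = - (p * A)" "q * C = r * A" "p * C = - (r * B)"
    using assms(1-3) unfolding D mult_minus_right by linarith+
  have "q * B * v = - (p * A * v)" "q * C * w = r * A * w" "p * C * w = - (r * B * w)" "p * C * v = - (r * B * v)"
    unfolding 1 by simp_all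
  then show "- (p * 0 * v + p * 0 * w + (q * 0 * v + q * 0 * w) + (q * - A * v + q * - C * w + (r * - B * v + r * - D * w)))
      = (0 + - C) * p * v + (0 + - C) * q * w + ((A + 0) * q * v + (A + 0) * r * w)"
    "- (p * A * v + p * C * w + (q * B * v + q * D * w) + (q * 0 * v + q * 0 * w + (r * 0 * v + r * 0 * w)))
      = (0 + - D) * p * v + (0 + - D) * q * w + ((B + 0) * q * v + (B + 0) * r * w)"
    unfolding D by (simp_all add: algebra_simps)
qed

text \<open>The mixed second derivatives of the inverse metric commute. Expressing each first
  derivative by \<open>pd_ginv_christoffel\<close>, the difference of the two orders is the
  symmetrised curvature with an index raised.\<close>

lemma riem_antisym:
  assumes x: "x \<in> X"
  shows "(\<Sum>l\<in>UNIV. ginv h x $ l $ a * riem h x k l 1 2) + (\<Sum>l\<in>UNIV. ginv h x $ l $ k * riem h x a l 1 2) = 0"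
proof -
  note d = ginv_diff[OF h x] christoffel_diff[OF h x]
  have p: "pd c (\<lambda>z. pd b (\<lambda>z. ginv h z $ k $ a) z) x = pd c (\<lambda>z. - (\<Sum>l\<in>UNIV. christoffel h z k b l * ginv h z $ l $ a)
     - (\<Sum>l\<in>UNIV. christoffel h z a b l * ginv h z $ l $ k)) x" for b c
    by (rule pd_cong_open[OF metric_open[OF h] x]) (rule pd_ginv_christoffel[OF h])
  have p': "pd c (\<lambda>z. - (\<Sum>l\<in>UNIV. christoffel h z k b l * ginv h z $ l $ a)
     - (\<Sum>l\<in>UNIV. christoffel h z a b l * ginv h z $ l $ k)) x =
     - (\<Sum>l\<in>UNIV. pd c (\<lambda>z. christoffel h z k b l) x * ginv h x $ l $ a + christoffel h x k b l * pd c (\<lambda>z. ginv h z $ l $ a) x)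
     - (\<Sum>l\<in>UNIV. pd c (\<lambda>z. christoffel h z a b l) x * ginv h x $ l $ k + christoffel h x a b l * pd c (\<lambda>z. ginv h z $ l $ k) x)" for b c
    by (simp add: d)
  have cs: "pd c (\<lambda>z. christoffel h z k i j) x = pd c (\<lambda>z. christoffel h z k j i) x" for c k i j
    by (rule pd_cong_open[OF metric_open[OF h] x]) (rule christoffel_sym[OF h])
  have "pd 1 (\<lambda>z. pd 2 (\<lambda>z. ginv h z $ k $ a) z) x - pd 2 (\<lambda>z. pd 1 (\<lambda>z. ginv h z $ k $ a) z) x = 0"
    using pd_commute[OF ginv_smooth[OF h] x, of 1 2 k a] by simp
  then show ?thesis
    unfolding p p'
    unfolding riem_def pd_ginv_christoffel[OF h x] sum_2
      ginv2(1)[OF h x] christoffel_sym[OF h x, of _ 2 1] cs[of _ _ 2 1]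
    by algebra
qed

text \<open>In dimension two the curvature has one independent component, which forces the Ricci
  tensor to be pure trace.\<close>

lemma ricci2:
  assumes x: "x \<in> X"
  shows "ricci h x = (1/2 * tr2 h (ricci h) x) *\<^sub>R h x"
proof -
  have r0: "riem h x k i c c = 0" for k i c by (simp add: riem_def)
  have r1: "riem h x k i 2 1 = - riem h x k i 1 2" for k i by (simp add: riem_def)
  note a = riem_antisym[OF x, of 1 1] riem_antisym[OF x, of 1 2] riem_antisym[OF x, of 2 2]
  have "2 * (ricci h x $ i $ j) = tr2 h (ricci h) x * h x $ i $ j" for i j
    using ricci2_algebra[OF ginv2(3-6)[OF h x] a[unfolded sum_2 ginv2(1)[OF h x]]] exhaust_2[of i] exhaust_2[of j]
    unfolding tr2_def ricci_riem sum_2 ginv2(1)[OF h x]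
    by (elim disjE; simp only: r0 r1 ginv2(2)[OF h x])
  then have "ricci h x $ i $ j = 1/2 * tr2 h (ricci h) x * h x $ i $ j" for i j by (simp add: field_simps)
  then show ?thesis by (simp add: vec_eq_iff)
qed

text \<open>For the closed form \<open>df\<close> the divergence of the Hessian and the gradient of
  the Laplacian differ by commuting covariant derivatives. This costs one Ricci term, which by
  \<open>ricci2\<close> is the Gauss curvature times \<open>df\<close>.\<close>

lemma bochner:
  assumes x: "x \<in> X" and f: "smooth_on X f"
  shows "div2 h (cov1 h (grad1 f)) x = grad1 (lap h f) x + (1/2 * tr2 h (ricci h) x) *\<^sub>R grad1 f x"
proof -
  define w where "w = grad1 f"
  have w: "sm1 X w" unfolding w_def by (rule sm1_grad1[OF f])
  note d = ginv_diff[OF h x] christoffel_diff[OF h x] sm1_diff[OF w x] smooth_on_diff[OF smooth_on_pd[OF sm1D[OF w]] x]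
  have cs: "pd c (\<lambda>z. christoffel h z k i j) x = pd c (\<lambda>z. christoffel h z k j i) x" for c k i j
    by (rule pd_cong_open[OF metric_open[OF h] x]) (rule christoffel_sym[OF h])
  have w21: "pd 2 (\<lambda>z. w z $ 1) y = pd 1 (\<lambda>z. w z $ 2) y" if "y \<in> X" for y
    unfolding w_def grad1_def vec_lambda_beta by (rule pd_commute[OF f that])
  have w21': "pd c (\<lambda>z. pd 2 (\<lambda>z. w z $ 1) z) x = pd c (\<lambda>z. pd 1 (\<lambda>z. w z $ 2) z) x" for c
    by (rule pd_cong_open[OF metric_open[OF h] x w21])
  have pc: "pd 2 (\<lambda>z. pd 1 (\<lambda>z. w z $ b) z) x = pd 1 (\<lambda>z. pd 2 (\<lambda>z. w z $ b) z) x" for b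
    by (rule pd_commute[OF sm1D[OF w] x])
  have pcov: "pd c (\<lambda>z. cov1 h w z $ a $ b) x = pd c (\<lambda>z. pd a (\<lambda>z. w z $ b) z) x
     - (\<Sum>k\<in>UNIV. pd c (\<lambda>z. christoffel h z k a b) x * w x $ k + christoffel h x k a b * pd c (\<lambda>z. w z $ k) x)" for a b c
    by (simp add: cov1_def d)
  have plap: "pd b (\<lambda>z. lap h f z) x = (\<Sum>c\<in>UNIV. \<Sum>a\<in>UNIV. pd b (\<lambda>z. ginv h z $ c $ a) x * cov1 h w x $ c $ a
     + ginv h x $ c $ a * pd b (\<lambda>z. cov1 h w z $ c $ a) x)" for b
    unfolding lap_def div1_def tr2_def w_def[symmetric]
    by (simp add: d sm2_diff[OF sm2_cov1[OF h w] x])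
  have r0: "riem h x k i c c = 0" for k i c by (simp add: riem_def)
  have r1: "riem h x k i 2 1 = - riem h x k i 1 2" for k i by (simp add: riem_def)
  have A: "div2 h (cov1 h w) x $ b - pd b (\<lambda>z. lap h f z) x =
     - (\<Sum>c\<in>UNIV. \<Sum>a\<in>UNIV. \<Sum>k\<in>UNIV. ginv h x $ c $ a * riem h x k a c b * w x $ k)" for b
    using exhaust_2[of b]
    unfolding plap div2_def cov2_def riem_def vec_lambda_beta pcov pd_ginv_christoffel[OF h x] sum_2
    unfolding cov1_def vec_lambda_beta sum_2
    by (elim disjE; hypsubst; simp only: pc w21' w21[OF x] cs[of _ _ 2 1] christoffel_sym[OF h x, of _ 2 1] ginv2(1)[OF h x]; simp add: algebra_simps)
  note a = riem_antisym[OF x, of 1 1] riem_antisym[OF x, of 1 2] riem_antisym[OF x, of 2 2]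
  \<comment> \<open>The off-diagonal Ricci components agree, because both are the same multiple of
    \<open>h x $ 1 $ 2\<close>; in terms of the curvature this says that its trace over the first
    two indices is zero.\<close>
  have AD: "riem h x 1 1 1 2 + riem h x 2 2 1 2 = 0"
    using trans[OF ricci2_algebra(2) ricci2_algebra(3)[symmetric], OF ginv2(3-6)[OF h x] a[unfolded sum_2 ginv2(1)[OF h x]] ginv2(3-6)[OF h x] a[unfolded sum_2 ginv2(1)[OF h x]]]
    by simp
  have B: "- (\<Sum>c\<in>UNIV. \<Sum>a\<in>UNIV. \<Sum>k\<in>UNIV. ginv h x $ c $ a * riem h x k a c b * w x $ k)
     = apply2 h (ricci h) w x $ b" for b
    using bochner_algebra[OF a[unfolded sum_2 ginv2(1)[OF h x]] AD, of "w x $ 1" "w x $ 2"] exhaust_2[of b]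
    unfolding apply2_def ricci_riem vec_lambda_beta sum_2 ginv2(1)[OF h x]
    by (elim disjE; hypsubst; simp only: r0 r1)
  have "apply2 h (ricci h) w x = apply2 h (\<lambda>z. (1/2 * tr2 h (ricci h) x) *\<^sub>R h z + 0 *\<^sub>R h z) w x"
    by (rule apply2_cong) (use ricci2[OF x] in simp_all)
  also have "\<dots> = (1/2 * tr2 h (ricci h) x) *\<^sub>R w x"
    by (simp only: apply2_lin_left apply2_metric[OF x]) simp
  finally have C: "apply2 h (ricci h) w x = (1/2 * tr2 h (ricci h) x) *\<^sub>R w x" .
  have "div2 h (cov1 h w) x $ b = pd b (\<lambda>z. lap h f z) x + ((1/2 * tr2 h (ricci h) x) *\<^sub>R w x) $ b" for b
    using A[of b] unfolding B C by linarith
  then show ?thesis unfolding w_def[symmetric] by (simp add: vec_eq_iff) (simp add: grad1_def)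
qed

end

section \<open>The operator in factorised form\<close>

definition opA :: "2 tensor2_field \<Rightarrow> 2 tensor2_field \<Rightarrow> (real^2 \<Rightarrow> real) \<Rightarrow> 2 tensor2_field" where
  "opA h Q f x = tf h (cov1 h (grad1 f)) x + f x *\<^sub>R Q x"

definition opv :: "2 tensor2_field \<Rightarrow> 2 tensor2_field \<Rightarrow> (real^2 \<Rightarrow> real) \<Rightarrow> 2 covector_field" where
  "opv h L f x = f x *\<^sub>R div2 h L x - apply2 h L (grad1 f) x"

text \<open>\<open>L\<close> and \<open>Q\<close> are parameters, so that conformal covariance and
  naturality use only how these two tensors transform.\<close>

definition op4 :: "2 tensor2_field \<Rightarrow> 2 tensor2_field \<Rightarrow> 2 tensor2_field \<Rightarrow> (real^2 \<Rightarrow> real) \<Rightarrow> real^2 \<Rightarrow> real" where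
  "op4 h L Q f x = 2 * div1 h (div2 h (opA h Q f)) x + 2 * ip2 h Q (opA h Q f) x
     + 2 * (div1 h (apply2 h L (opv h L f)) x + ip1 h (div2 h L) (opv h L f) x)
     + 1/4 * (ip2 h L L x)\<^sup>2 * f x"

definition tfree :: "(real^2) set \<Rightarrow> 2 tensor2_field \<Rightarrow> 2 tensor2_field \<Rightarrow> bool" where
  "tfree X h T \<longleftrightarrow> sm2 X T \<and> sym2 X T \<and> (\<forall>x\<in>X. tr2 h T x = 0)"

lemma tfreeD: "tfree X h T \<Longrightarrow> sm2 X T" "tfree X h T \<Longrightarrow> sym2 X T" "tfree X h T \<Longrightarrow> x \<in> X \<Longrightarrow> tr2 h T x = 0"
  by (auto simp: tfree_def)

lemma grad1_cmult: "F differentiable (at x) \<Longrightarrow> grad1 (\<lambda>z. c * F z) x = c *\<^sub>R grad1 F x"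
  by (simp add: grad1_def vec_eq_iff)

context
  fixes X :: "(real^2) set" and h :: "2 tensor2_field"
  assumes h: "metric_on X h"

begin

lemma sym2_hessian: "smooth_on X f \<Longrightarrow> sym2 X (cov1 h (grad1 f))"
  unfolding sym2_def cov1_def grad1_def vec_lambda_beta
  by (intro ballI allI) (simp only: christoffel_sym[OF h] pd_commute[of X f])

lemma sm2_hessian: "smooth_on X f \<Longrightarrow> sm2 X (cov1 h (grad1 f))"
  by (rule sm2_cov1[OF h sm1_grad1])

lemma tr2_add: "tr2 h (\<lambda>x. S x + c *\<^sub>R T x) x = tr2 h S x + c * tr2 h T x"
  unfolding tr2_def sum_2 vector_add_component vector_scaleR_component real_scaleR_def by algebra

lemma tfree_opA:
  assumes Q: "tfree X h Q" and f: "smooth_on X f"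
  shows "tfree X h (opA h Q f)"
  unfolding tfree_def
proof (intro conjI ballI)
  show "sm2 X (opA h Q f)" unfolding opA_def[abs_def]
    by (intro sm2_add sm2_smult f tfreeD(1)[OF Q] sm2_tf[OF h] sm2_hessian)
  show "sym2 X (opA h Q f)" unfolding opA_def[abs_def]
    by (intro sym2_add sym2_smult tfreeD(2)[OF Q] sym2_tf[OF h] sym2_hessian f)
  fix x assume x: "x \<in> X"
  have "tr2 h (opA h Q f) x = tr2 h (\<lambda>z. tf h (cov1 h (grad1 f)) z + f x *\<^sub>R Q z) x"
    by (rule tr2_cong) (simp_all add: opA_def)
  then show "tr2 h (opA h Q f) x = 0"
    by (simp add: tr2_add tr2_tf[OF h x] tfreeD(3)[OF Q x])
qed

lemma sm1_opv: "sm2 X L \<Longrightarrow> smooth_on X f \<Longrightarrow> sm1 X (opv h L f)"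
  unfolding opv_def[abs_def] by (intro sm1_diff' sm1_smult sm1_div2[OF h] sm1_apply2[OF h] sm1_grad1)

text \<open>The Bochner formula gives the full gradient of \<open>lap h f\<close>, and removing the
  trace of the Hessian subtracts half of it.\<close>

lemma div2_opA:
  assumes Q: "tfree X h Q" and f: "smooth_on X f" and x: "x \<in> X"
  shows "div2 h (opA h Q f) x = (1/2) *\<^sub>R grad1 (lap h f) x + (1/2 * tr2 h (ricci h) x) *\<^sub>R grad1 f x
     + (f x *\<^sub>R div2 h Q x + apply2 h Q (grad1 f) x)"
proof -
  let ?H = "cov1 h (grad1 f)" and ?a = "\<lambda>z. (-1/2) * lap h f z"
  have H: "sm2 X ?H" by (rule sm2_hessian[OF f])
  have a: "smooth_on X ?a" by (intro smooth_intros metric_open[OF h] smooth_lap[OF h f])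
  have ah: "sm2 X (\<lambda>z. ?a z *\<^sub>R h z)" by (rule sm2_smult[OF a sm2_metric[OF h]])
  have fQ: "sm2 X (\<lambda>z. f z *\<^sub>R Q z)" by (rule sm2_smult[OF f tfreeD(1)[OF Q]])
  have hs: "sym2 X h" using metric_sym[OF h] by (simp add: sym2_def)
  have "opA h Q f = (\<lambda>z. (?H z + ?a z *\<^sub>R h z) + f z *\<^sub>R Q z)"
    by (rule ext) (simp add: opA_def tf_def lap_def div1_def)
  then have "div2 h (opA h Q f) x = (div2 h ?H x + div2 h (\<lambda>z. ?a z *\<^sub>R h z) x) + div2 h (\<lambda>z. f z *\<^sub>R Q z) x"
    by (simp only: div2_add[OF h x sm2_add[OF H ah] fQ] div2_add[OF h x H ah])
  also have "div2 h (\<lambda>z. ?a z *\<^sub>R h z) x = grad1 ?a x"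
    by (simp only: div2_smult[OF h x a sm2_metric[OF h] hs] div2_metric[OF h x] apply2_metric[OF h x], simp?)
  also have "grad1 ?a x = (-1/2) *\<^sub>R grad1 (lap h f) x"
    by (rule grad1_cmult[OF smooth_on_diff[OF smooth_lap[OF h f] x]])
  also have "div2 h (\<lambda>z. f z *\<^sub>R Q z) x = f x *\<^sub>R div2 h Q x + apply2 h Q (grad1 f) x"
    by (rule div2_smult[OF h x f tfreeD(1)[OF Q] tfreeD(2)[OF Q]])
  also have "div2 h ?H x = grad1 (lap h f) x + (1/2 * tr2 h (ricci h) x) *\<^sub>R grad1 f x"
    by (rule bochner[OF h x f])
  finally show ?thesis
    by (simp add: vec_eq_iff)
qed

text \<open>This accounts for the coefficients of the operator. The trace part of \<open>P\<close>
  drops out of \<open>2 div div P - lap J\<close> and of \<open>2 |P|^2 - J^2\<close>. In the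
  gradient term it yields \<open>2 div (\<kappa> grad f)\<close>, which comes from the Bochner
  formula, and \<open>- div (K grad f)\<close>, which comes from
  \<open>L (L (grad f))\<close>.\<close>

lemma op4_expand:
  assumes L: "tfree X h L" and Q: "tfree X h Q" and f: "smooth_on X f" and x: "x \<in> X"
    and P: "\<And>z. z \<in> X \<Longrightarrow> P z = Q z + (1/2 * J z) *\<^sub>R h z"
    and J: "\<And>z. z \<in> X \<Longrightarrow> J z = 1/2 * tr2 h (ricci h) z - 1/2 * ip2 h L L z"
  shows "lap h (lap h f) x + 4 * div1 h (apply2 h P (grad1 f)) x
    + (2 * div1 h (div2 h P) x - lap h J x + 2 * norm2_sq h P x - (J x)\<^sup>2
      + 2 * div1 h (apply2 h L (div2 h L)) x + 2 * norm1_sq h (div2 h L) x + 1/4 * (ip2 h L L x)\<^sup>2) * f x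
    = op4 h L Q f x"
proof -
  note X = metric_open[OF h]
  define \<kappa> where "\<kappa> z = 1/2 * tr2 h (ricci h) z" for z
  define K where "K z = ip2 h L L z" for z
  let ?g = "grad1 f" and ?H = "cov1 h (grad1 f)" and ?q = "div2 h L"
  note L' = tfreeD[OF L] and Q' = tfreeD[OF Q]
  have g: "sm1 X ?g" by (rule sm1_grad1[OF f])
  have lf: "smooth_on X (lap h f)" using smooth_lap[OF h f] .
  have \<kappa>: "smooth_on X \<kappa>" unfolding \<kappa>_def[abs_def]
    by (intro smooth_intros X smooth_tr2[OF h] sm2_ricci[OF h])
  have K: "smooth_on X K" unfolding K_def[abs_def] by (intro smooth_ip2[OF h] L')
  have Js: "smooth_on X J"
    by (rule smooth_on_cong[of X "\<lambda>z. \<kappa> z - 1/2 * K z"]) (intro smooth_intros X \<kappa> K, simp add: J \<kappa>_def K_def)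
  have hs: "sym2 X h" using metric_sym[OF h] by (simp add: sym2_def)
  have Qg: "sm1 X (apply2 h Q ?g)" by (rule sm1_apply2[OF h Q'(1) g])
  have Lg: "sm1 X (apply2 h L ?g)" by (rule sm1_apply2[OF h L'(1) g])
  have dQ: "sm1 X (div2 h Q)" by (rule sm1_div2[OF h Q'(1)])
  have q: "sm1 X ?q" by (rule sm1_div2[OF h L'(1)])
  have Lq: "sm1 X (apply2 h L ?q)" by (rule sm1_apply2[OF h L'(1) q])
  have glf: "sm1 X (grad1 (lap h f))" by (rule sm1_grad1[OF lf])
  have gJ: "sm1 X (grad1 J)" by (rule sm1_grad1[OF Js])
  have J2: "smooth_on X (\<lambda>z. 1/2 * J z)" by (intro smooth_intros X Js)
  have T1: "sm1 X (\<lambda>z. \<kappa> z *\<^sub>R ?g z)" by (rule sm1_smult[OF \<kappa> g])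
  have T3: "sm1 X (\<lambda>z. K z *\<^sub>R ?g z)" by (rule sm1_smult[OF K g])
  have fdQ: "sm1 X (\<lambda>z. f z *\<^sub>R div2 h Q z)" by (rule sm1_smult[OF f dQ])
  have hlf: "sm1 X (\<lambda>z. (1/2) *\<^sub>R grad1 (lap h f) z)" by (rule sm1_smult[OF smooth_on_const[OF X] glf])
  have A: "div1 h (div2 h (opA h Q f)) x = 1/2 * lap h (lap h f) x + div1 h (\<lambda>z. \<kappa> z *\<^sub>R ?g z) x
     + (f x * div1 h (div2 h Q) x + ip1 h ?g (div2 h Q) x + div1 h (apply2 h Q ?g) x)"
  proof -
    have "div1 h (div2 h (opA h Q f)) x = div1 h (\<lambda>z. ((1/2) *\<^sub>R grad1 (lap h f) z + \<kappa> z *\<^sub>R ?g z) + (f z *\<^sub>R div2 h Q z + apply2 h Q ?g z)) x"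
      by (rule div1_cong[OF X x]) (simp_all only: div2_opA[OF Q f] \<kappa>_def)
    also have "\<dots> = 1/2 * lap h (lap h f) x + div1 h (\<lambda>z. \<kappa> z *\<^sub>R ?g z) x
     + (f x * div1 h (div2 h Q) x + ip1 h ?g (div2 h Q) x + div1 h (apply2 h Q ?g) x)"
      by (simp only: div1_add[OF h x sm1_add[OF hlf T1] sm1_add[OF fdQ Qg]] div1_add[OF h x hlf T1] div1_add[OF h x fdQ Qg]
         div1_const[OF h x glf] div1_smult[OF h x f dQ] lap_def[of h "lap h f"])
    finally show ?thesis .
  qed
  have B: "div1 h (apply2 h Q ?g) x = ip1 h ?g (div2 h Q) x + ip2 h Q ?H x"
    using div1_apply2[OF h x Q'(1) g Q'(2)] ip1_sym[OF h x, of ?g "div2 h Q"] by simp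
  \<comment> \<open>A metric on a surface has square norm 2 and is orthogonal to \<open>Q\<close>,
    so the trace part contributes exactly \<open>J^2 / 2\<close> to the square norm of
    \<open>P\<close>.\<close>
  have Qh: "ip2 h Q h x = 0" "ip2 h h Q x = 0" "ip2 h h h x = 2"
    using ip2_sym_2[OF h x, of Q h] ip2_metric[OF h x, of Q] ip2_metric[OF h x, of h] Q'(3)[OF x] tr2_metric[OF h x] by auto
  have C: "ip2 h Q (opA h Q f) x = ip2 h Q ?H x + f x * ip2 h Q Q x"
  proof -
    have "ip2 h Q (opA h Q f) x = ip2 h Q (\<lambda>z. (?H z + (-1/2 * lap h f x) *\<^sub>R h z) + f x *\<^sub>R Q z) x"
      by (rule ip2_cong) (simp_all add: opA_def tf_def lap_def div1_def)
    then show ?thesis by (simp only: ip2_add_right Qh, simp?)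
  qed
  have D: "div1 h (apply2 h P ?g) x = div1 h (apply2 h Q ?g) x + (1/2 * div1 h (\<lambda>z. \<kappa> z *\<^sub>R ?g z) x - 1/4 * div1 h (\<lambda>z. K z *\<^sub>R ?g z) x)"
  proof -
    have h1: "sm1 X (\<lambda>z. (1/2) *\<^sub>R (\<kappa> z *\<^sub>R ?g z))" by (rule sm1_smult[OF smooth_on_const[OF X] T1])
    have h2: "sm1 X (\<lambda>z. (1/4) *\<^sub>R (K z *\<^sub>R ?g z))" by (rule sm1_smult[OF smooth_on_const[OF X] T3])
    have "apply2 h P ?g z = apply2 h Q ?g z + ((1/2) *\<^sub>R (\<kappa> z *\<^sub>R ?g z) - (1/4) *\<^sub>R (K z *\<^sub>R ?g z))" if z: "z \<in> X" for z
    proof -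
      have "apply2 h P ?g z = apply2 h (\<lambda>y. 1 *\<^sub>R Q y + (1/2 * J z) *\<^sub>R h y) ?g z"
        by (rule apply2_cong) (simp_all add: P[OF z])
      also have "\<dots> = apply2 h Q ?g z + (1/2 * J z) *\<^sub>R ?g z"
        by (simp only: apply2_lin_left apply2_metric[OF h z], simp?)
      finally show ?thesis by (simp add: J[OF z] \<kappa>_def K_def algebra_simps)
    qed
    then have "div1 h (apply2 h P ?g) x = div1 h (\<lambda>z. apply2 h Q ?g z + ((1/2) *\<^sub>R (\<kappa> z *\<^sub>R ?g z) - (1/4) *\<^sub>R (K z *\<^sub>R ?g z))) x"
      by (intro div1_cong[OF X x]) simp_all
    then show ?thesis
      by (simp only: div1_add[OF h x Qg sm1_diff'[OF h1 h2]] div1_sub[OF h x h1 h2] div1_const[OF h x T1] div1_const[OF h x T3])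
  qed
  have E: "div1 h (div2 h P) x = div1 h (div2 h Q) x + 1/2 * lap h J x"
  proof -
    have h1: "sm1 X (\<lambda>z. (1/2) *\<^sub>R grad1 J z)" by (rule sm1_smult[OF smooth_on_const[OF X] gJ])
    have "div2 h P z = div2 h Q z + (1/2) *\<^sub>R grad1 J z" if z: "z \<in> X" for z
    proof -
      have "div2 h P z = div2 h (\<lambda>y. Q y + (1/2 * J y) *\<^sub>R h y) z"
        by (rule div2_cong[OF X z]) (simp_all add: P)
      also have "\<dots> = div2 h Q z + div2 h (\<lambda>y. (1/2 * J y) *\<^sub>R h y) z"
        by (rule div2_add[OF h z Q'(1) sm2_smult[OF J2 sm2_metric[OF h]]])
      also have "div2 h (\<lambda>y. (1/2 * J y) *\<^sub>R h y) z = grad1 (\<lambda>y. 1/2 * J y) z"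
        by (simp only: div2_smult[OF h z J2 sm2_metric[OF h] hs] div2_metric[OF h z] apply2_metric[OF h z], simp?)
      also have "\<dots> = (1/2) *\<^sub>R grad1 J z"
        by (rule grad1_cmult[OF smooth_on_diff[OF Js z]])
      finally show ?thesis .
    qed
    then have "div1 h (div2 h P) x = div1 h (\<lambda>z. div2 h Q z + (1/2) *\<^sub>R grad1 J z) x"
      by (intro div1_cong[OF X x]) simp_all
    then show ?thesis by (simp only: div1_add[OF h x dQ h1] div1_const[OF h x gJ] lap_def)
  qed
  have F: "norm2_sq h P x = ip2 h Q Q x + 1/2 * (J x)\<^sup>2"
  proof -
    have "norm2_sq h P x = ip2 h (\<lambda>z. Q z + (1/2 * J x) *\<^sub>R h z) (\<lambda>z. Q z + (1/2 * J x) *\<^sub>R h z) x"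
      unfolding norm2_sq_ip2 by (rule ip2_cong) (simp_all add: P[OF x])
    then show ?thesis by (simp only: ip2_add_left ip2_add_right Qh, (simp add: power2_eq_square)?)
  qed
  have LL: "apply2 h L (opv h L f) z = f z *\<^sub>R apply2 h L ?q z - (1/2) *\<^sub>R (K z *\<^sub>R ?g z)" if z: "z \<in> X" for z
  proof -
    have "apply2 h L (opv h L f) z = apply2 h L (\<lambda>y. f z *\<^sub>R ?q y + (-1) *\<^sub>R apply2 h L ?g y) z"
      by (rule apply2_cong) (simp_all add: opv_def)
    then show ?thesis
      by (simp only: apply2_lin_right apply2_apply2[OF h z L'(2) L'(3)[OF z]], (simp add: K_def)?)
  qed
  have Gq: "div1 h (apply2 h L (opv h L f)) x = f x * div1 h (apply2 h L ?q) x + ip1 h ?g (apply2 h L ?q) x - 1/2 * div1 h (\<lambda>z. K z *\<^sub>R ?g z) x"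
  proof -
    have h1: "sm1 X (\<lambda>z. (1/2) *\<^sub>R (K z *\<^sub>R ?g z))" by (rule sm1_smult[OF smooth_on_const[OF X] T3])
    have h2: "sm1 X (\<lambda>z. f z *\<^sub>R apply2 h L ?q z)" by (rule sm1_smult[OF f Lq])
    have "div1 h (apply2 h L (opv h L f)) x = div1 h (\<lambda>z. f z *\<^sub>R apply2 h L ?q z - (1/2) *\<^sub>R (K z *\<^sub>R ?g z)) x"
      by (rule div1_cong[OF X x]) (simp_all only: LL)
    then show ?thesis
      by (simp only: div1_sub[OF h x h2 h1] div1_const[OF h x T3] div1_smult[OF h x f Lq])
  qed
  have Hq: "ip1 h ?q (opv h L f) x = f x * ip1 h ?q ?q x - ip1 h ?g (apply2 h L ?q) x"
  proof -
    have "ip1 h ?q (opv h L f) x = ip1 h ?q (\<lambda>y. f x *\<^sub>R ?q y + (-1) *\<^sub>R apply2 h L ?g y) x"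
      by (rule ip1_cong) (simp_all add: opv_def)
    moreover have "ip1 h ?q (apply2 h L ?g) x = ip1 h ?g (apply2 h L ?q) x"
      using ip1_apply2[OF h x L'(2), of ?q ?g] ip1_sym[OF h x] by metis
    ultimately show ?thesis by (simp only: ip1_lin_right, simp?)
  qed
  show ?thesis
    unfolding op4_def A B C D E F Gq Hq norm1_sq_ip1
    by (simp add: algebra_simps)
qed

text \<open>\<open>L\<close> occurs an even number of times in every term. This disposes of the sign
  ambiguity of the conormal.\<close>

lemma op4_sign:
  assumes L: "tfree X h L" and f: "smooth_on X f" and x: "x \<in> X" and s: "s * s = (1::real)"
  shows "op4 h (\<lambda>z. s *\<^sub>R L z) Q f x = op4 h L Q f x"
proof -
  note X = metric_open[OF h]
  have gc: "grad1 (\<lambda>z. s) z = 0" for z by (simp add: grad1_def vec_eq_iff)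
  have d: "div2 h (\<lambda>z. s *\<^sub>R L z) z = s *\<^sub>R div2 h L z" if z: "z \<in> X" for z
  proof -
    have "apply2 h L (grad1 (\<lambda>z. s)) z = 0" by (simp add: apply2_def gc vec_eq_iff)
    then show ?thesis
      using div2_smult[OF h z smooth_on_const[OF X] tfreeD(1)[OF L] tfreeD(2)[OF L], of s] by simp
  qed
  have a: "apply2 h (\<lambda>z. s *\<^sub>R L z) w z = s *\<^sub>R apply2 h L w z" for w z
    using apply2_lin_left[of h s L 0 L w z] by simp
  have v: "opv h (\<lambda>z. s *\<^sub>R L z) f z = s *\<^sub>R opv h L f z" if "z \<in> X" for z
    unfolding opv_def d[OF that] a by (simp add: algebra_simps)
  have av: "apply2 h (\<lambda>z. s *\<^sub>R L z) (opv h (\<lambda>z. s *\<^sub>R L z) f) z = apply2 h L (opv h L f) z" if z: "z \<in> X" for z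
  proof -
    have "apply2 h L (opv h (\<lambda>z. s *\<^sub>R L z) f) z = apply2 h L (\<lambda>y. s *\<^sub>R opv h L f y + 0 *\<^sub>R opv h L f y) z"
      by (rule apply2_cong) (simp_all add: v[OF z])
    then show ?thesis unfolding a by (simp only: apply2_lin_right, (simp add: s)?)
  qed
  have 1: "div1 h (apply2 h (\<lambda>z. s *\<^sub>R L z) (opv h (\<lambda>z. s *\<^sub>R L z) f)) x = div1 h (apply2 h L (opv h L f)) x"
    by (rule div1_cong[OF X x]) (simp_all only: av)
  have "ip1 h (div2 h (\<lambda>z. s *\<^sub>R L z)) (opv h (\<lambda>z. s *\<^sub>R L z) f) x =
     ip1 h (\<lambda>y. s *\<^sub>R div2 h L y + 0 *\<^sub>R div2 h L y) (\<lambda>y. s *\<^sub>R opv h L f y + 0 *\<^sub>R opv h L f y) x"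
    by (rule ip1_cong) (simp_all add: d[OF x] v[OF x])
  also have "\<dots> = s * s * ip1 h (div2 h L) (opv h L f) x"
    by (simp only: ip1_lin_left ip1_lin_right, (simp add: algebra_simps)?)
  finally have 2: "ip1 h (div2 h (\<lambda>z. s *\<^sub>R L z)) (opv h (\<lambda>z. s *\<^sub>R L z) f) x = ip1 h (div2 h L) (opv h L f) x"
    by (simp add: s)
  have "ip2 h (\<lambda>z. s *\<^sub>R L z) (\<lambda>z. s *\<^sub>R L z) x = s * s * ip2 h L L x"
    unfolding ip2_def sum_2 vector_scaleR_component real_scaleR_def by algebra
  then have 3: "ip2 h (\<lambda>z. s *\<^sub>R L z) (\<lambda>z. s *\<^sub>R L z) x = ip2 h L L x" by (simp add: s)
  show ?thesis unfolding op4_def 1 2 3 ..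
qed

end

section \<open>Conformal covariance of the factorised operator\<close>

context conformal2

begin

lemma ip1_cmetric: "x \<in> X \<Longrightarrow> ip1 h\<omega> v w x = inverse (\<omega> x) * inverse (\<omega> x) * ip1 h v w x"
  unfolding ip1_def sum_2 by (simp only: ginv_cmetric') algebra

lemma ip2_cmetric: "x \<in> X \<Longrightarrow> ip2 h\<omega> S T x = inverse (\<omega> x) * inverse (\<omega> x) * (inverse (\<omega> x) * inverse (\<omega> x)) * ip2 h S T x"
  unfolding ip2_def sum_2 by (simp only: ginv_cmetric') algebra

lemma apply2_cmetric: "x \<in> X \<Longrightarrow> apply2 h\<omega> T w x = (inverse (\<omega> x) * inverse (\<omega> x)) *\<^sub>R apply2 h T w x"
  unfolding apply2_def sum_2 vec_eq_iff vec_lambda_beta vector_scaleR_component real_scaleR_def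
  by (simp only: ginv_cmetric') (intro allI, algebra)

lemma tr2_cmetric: "x \<in> X \<Longrightarrow> tr2 h\<omega> T x = inverse (\<omega> x) * inverse (\<omega> x) * tr2 h T x"
  unfolding tr2_def sum_2 by (simp only: ginv_cmetric') algebra

lemma tf_cmetric: "x \<in> X \<Longrightarrow> tf h\<omega> T x = tf h T x"
  using \<omega>0[of x] by (simp add: tf_def tr2_cmetric cmetric_def field_simps power2_eq_square)

text \<open>The cross terms cancel in pairs. In the first summand the double divergence produces
  \<open>A\<cdot>\<nabla>u - u\<cdot>(A u)\<close>, and the change of \<open>Q\<close> the negative
  of it. In the second, the divergence produces \<open>- u\<cdot>(L v)\<close>, and the change of
  \<open>q\<close> the opposite term.\<close>

lemma op4_cmetric:
  assumes L: "tfree X h L" and Q: "tfree X h Q" and f: "smooth_on X f" and x: "x \<in> X"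
    and L': "\<And>z. z \<in> X \<Longrightarrow> L' z = \<omega> z *\<^sub>R L z"
    and Q': "\<And>z. z \<in> X \<Longrightarrow> Q' z = Q z - tf h (cov1 h u) z + tf h (\<lambda>z. \<chi> a b. u z $ a * u z $ b) z"
  shows "op4 h\<omega> L' Q' (\<lambda>z. \<omega> z * f z) x = inverse (\<omega> x) ^ 3 * op4 h L Q f x"
proof -
  note X = metric_open[OF G]
  note Lt = tfreeD[OF L] and Qt = tfreeD[OF Q]
  note G' = metric_cmetric
  define f' where "f' z = \<omega> z * f z" for z
  define A where "A = opA h Q f"
  have A: "tfree X h A" unfolding A_def by (rule tfree_opA[OF G Q f])
  note At = tfreeD[OF A]
  have inv: "smooth_on X (\<lambda>z. inverse (\<omega> z))" by (rule smooth_on_inverse[OF \<omega> \<omega>0])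
  have f's: "smooth_on X f'" unfolding f'_def[abs_def] by (rule smooth_on_mult[OF \<omega> f])
  have ginv1: "grad1 (\<lambda>z. inverse (\<omega> z)) z = (- inverse (\<omega> z)) *\<^sub>R u z" if z: "z \<in> X" for z
    unfolding vec_eq_iff grad1_def vec_lambda_beta vector_scaleR_component real_scaleR_def
      pd_inverse[OF \<omega>_diff[OF z] \<omega>0[OF z]] pd_\<omega>[OF z] using \<omega>0[OF z] by simp
  \<comment> \<open>Both outer divergences act on one-forms carrying a factor
    \<open>inverse \<omega>\<close>. Differentiating that factor is the source of the terms in
    \<open>ip1 h u\<close>.\<close>
  have divW: "div1 h\<omega> (\<lambda>z. inverse (\<omega> z) *\<^sub>R w z) x = inverse (\<omega> x) ^ 3 * (div1 h w x - ip1 h u w x)" if w: "sm1 X w" for w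
  proof -
    have "ip1 h (grad1 (\<lambda>z. inverse (\<omega> z))) w x = ip1 h (\<lambda>z. (- inverse (\<omega> x)) *\<^sub>R u z + 0 *\<^sub>R u z) w x"
      by (rule ip1_cong) (simp_all add: ginv1[OF x])
    then have "ip1 h (grad1 (\<lambda>z. inverse (\<omega> z))) w x = - inverse (\<omega> x) * ip1 h u w x"
      by (simp only: ip1_lin_left, simp?)
    then show ?thesis
      unfolding div1_cmetric[OF x] div1_smult[OF G x inv w] by (simp add: power3_eq_cube algebra_simps)
  qed
  have pf: "grad1 f' z = \<omega> z *\<^sub>R (grad1 f z + f z *\<^sub>R u z)" if z: "z \<in> X" for z
    unfolding f'_def[abs_def] vec_eq_iff grad1_def
    by (simp add: \<omega>_diff[OF z] smooth_on_diff[OF f z] pd_\<omega>[OF z] algebra_simps)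
  have q': "div2 h\<omega> L' z = inverse (\<omega> z) *\<^sub>R (div2 h L z + apply2 h L u z)" if z: "z \<in> X" for z
  proof -
    have "div2 h\<omega> L' z = div2 h\<omega> (\<lambda>z. \<omega> z *\<^sub>R L z) z"
      by (rule div2_cong[OF X z]) (simp_all only: L')
    then show ?thesis using div2_cmetric[OF z Lt(1,2) Lt(3)[OF z]] by simp
  qed
  have v': "opv h\<omega> L' f' z = opv h L f z" if z: "z \<in> X" for z
  proof -
    have "apply2 h L' (grad1 f') z = apply2 h (\<lambda>y. \<omega> z *\<^sub>R L y + 0 *\<^sub>R L y) (\<lambda>y. \<omega> z *\<^sub>R grad1 f y + (\<omega> z * f z) *\<^sub>R u y) z"
      by (rule apply2_cong) (simp_all add: L'[OF z] pf[OF z] algebra_simps)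
    also have "\<dots> = (\<omega> z * \<omega> z) *\<^sub>R apply2 h L (grad1 f) z + (\<omega> z * \<omega> z * f z) *\<^sub>R apply2 h L u z"
      by (simp only: apply2_lin_left apply2_lin_right) (simp add: algebra_simps)
    finally have 1: "apply2 h L' (grad1 f') z = \<dots>" .
    have i: "\<omega> z * (t * inverse (\<omega> z)) = t" "\<omega> z * (\<omega> z * (t * (inverse (\<omega> z) * inverse (\<omega> z)))) = t"
      "\<omega> z * (\<omega> z * (inverse (\<omega> z) * inverse (\<omega> z))) = 1" for t
      using \<omega>0[OF z] by (simp_all add: field_simps)
    show ?thesis
      unfolding opv_def q'[OF z] apply2_cmetric[OF z] 1 unfolding f'_def
      by (simp add: algebra_simps i right_inverse[OF \<omega>0[OF z]])
  qed
  have LL: "apply2 h\<omega> L' (opv h\<omega> L' f') z = inverse (\<omega> z) *\<^sub>R apply2 h L (opv h L f) z" if z: "z \<in> X" for z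
  proof -
    have "apply2 h L' (opv h\<omega> L' f') z = apply2 h (\<lambda>y. \<omega> z *\<^sub>R L y + 0 *\<^sub>R L y) (opv h L f) z"
      by (rule apply2_cong) (simp_all add: L'[OF z] v'[OF z])
    then show ?thesis unfolding apply2_cmetric[OF z] apply2_lin_left using \<omega>0[OF z] by simp
  qed
  have v: "sm1 X (opv h L f)" by (rule sm1_opv[OF G Lt(1) f])
  have B1: "div1 h\<omega> (apply2 h\<omega> L' (opv h\<omega> L' f')) x =
     inverse (\<omega> x) ^ 3 * (div1 h (apply2 h L (opv h L f)) x - ip1 h u (apply2 h L (opv h L f)) x)"
  proof -
    have "div1 h\<omega> (apply2 h\<omega> L' (opv h\<omega> L' f')) x = div1 h\<omega> (\<lambda>z. inverse (\<omega> z) *\<^sub>R apply2 h L (opv h L f) z) x"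
      by (rule div1_cong[OF X x]) (simp_all only: LL)
    then show ?thesis by (simp only: divW[OF sm1_apply2[OF G Lt(1) v]])
  qed
  have B2: "ip1 h\<omega> (div2 h\<omega> L') (opv h\<omega> L' f') x = inverse (\<omega> x) ^ 3 * (ip1 h (div2 h L) (opv h L f) x + ip1 h u (apply2 h L (opv h L f)) x)"
  proof -
    have "ip1 h (div2 h\<omega> L') (opv h\<omega> L' f') x = ip1 h (\<lambda>y. inverse (\<omega> x) *\<^sub>R div2 h L y + inverse (\<omega> x) *\<^sub>R apply2 h L u y) (opv h L f) x"
      by (rule ip1_cong) (simp_all add: q'[OF x] v'[OF x] algebra_simps)
    moreover have "ip1 h (apply2 h L u) (opv h L f) x = ip1 h u (apply2 h L (opv h L f)) x"
      using ip1_apply2[OF G x Lt(2)] by simp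
    ultimately show ?thesis
      unfolding ip1_cmetric[OF x] by (simp only: ip1_lin_left) (simp add: power3_eq_cube algebra_simps)
  qed
  have K: "ip2 h\<omega> L' L' x = inverse (\<omega> x) * inverse (\<omega> x) * ip2 h L L x"
  proof -
    have "ip2 h L' L' x = ip2 h (\<lambda>z. \<omega> x *\<^sub>R L z) (\<lambda>z. \<omega> x *\<^sub>R L z) x"
      by (rule ip2_cong) (simp_all add: L'[OF x])
    also have "\<dots> = \<omega> x * \<omega> x * ip2 h L L x"
      unfolding ip2_def sum_2 vector_scaleR_component real_scaleR_def by algebra
    finally show ?thesis unfolding ip2_cmetric[OF x] using \<omega>0[OF x] by (simp add: field_simps)
  qed
  have A': "opA h\<omega> Q' f' z = \<omega> z *\<^sub>R A z" if z: "z \<in> X" for z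
  proof -
    let ?uu = "\<lambda>z. \<chi> a b. u z $ a * u z $ b"
    \<comment> \<open>The multiple \<open>c\<close> of the metric contributes \<open>2 * c\<close>
      to the trace and is removed again by \<open>tf\<close>.\<close>
    obtain c where c: "\<And>a b. cov1 h\<omega> (grad1 f') z $ a $ b =
       \<omega> z * (cov1 h (grad1 f) z $ a $ b + f z * (cov1 h u z $ a $ b - u z $ a * u z $ b)) + c * h z $ a $ b"
      using hessian_cmetric[OF z f] unfolding f'_def[abs_def] by blast
    let ?S = "\<lambda>y. \<omega> z *\<^sub>R (cov1 h (grad1 f) y + f z *\<^sub>R (cov1 h u y - ?uu y)) + c *\<^sub>R h y"
    have tr: "tr2 h ?S z = \<omega> z * (tr2 h (cov1 h (grad1 f)) z + f z * (tr2 h (cov1 h u) z - tr2 h ?uu z)) + c * 2"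
    proof -
      have "tr2 h ?S z = \<omega> z * (tr2 h (cov1 h (grad1 f)) z + f z * (tr2 h (cov1 h u) z - tr2 h ?uu z)) + c * tr2 h h z"
        unfolding tr2_def sum_2 vector_add_component vector_minus_component vector_scaleR_component real_scaleR_def vec_lambda_beta by algebra
      then show ?thesis by (simp only: tr2_metric[OF G z])
    qed
    have "tf h\<omega> (cov1 h\<omega> (grad1 f')) z = tf h ?S z"
    proof -
      have e: "cov1 h\<omega> (grad1 f') z = ?S z" by (simp add: vec_eq_iff c)
      have "tr2 h (cov1 h\<omega> (grad1 f')) z = tr2 h ?S z" by (rule tr2_cong) (simp_all add: e)
      then show ?thesis unfolding tf_cmetric[OF z] unfolding tf_def by (simp add: e)
    qed
    also have "\<dots> = \<omega> z *\<^sub>R (tf h (cov1 h (grad1 f)) z + f z *\<^sub>R (tf h (cov1 h u) z - tf h ?uu z))"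
      unfolding tf_def tr by (simp add: vec_eq_iff field_simps)
    finally show ?thesis
      unfolding opA_def A_def Q'[OF z] f'_def by (simp add: algebra_simps)
  qed
  have W: "div2 h\<omega> (opA h\<omega> Q' f') z = inverse (\<omega> z) *\<^sub>R (div2 h A z + apply2 h A u z)" if z: "z \<in> X" for z
  proof -
    have "div2 h\<omega> (opA h\<omega> Q' f') z = div2 h\<omega> (\<lambda>z. \<omega> z *\<^sub>R A z) z"
      by (rule div2_cong[OF X z]) (simp_all only: A')
    then show ?thesis using div2_cmetric[OF z At(1,2) At(3)[OF z]] by simp
  qed
  have dA: "sm1 X (div2 h A)" and Au: "sm1 X (apply2 h A u)"
    by (rule sm1_div2[OF G At(1)], rule sm1_apply2[OF G At(1) sm1_u])
  have C1: "div1 h\<omega> (div2 h\<omega> (opA h\<omega> Q' f')) x =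
    inverse (\<omega> x) ^ 3 * (div1 h (div2 h A) x + ip2 h A (cov1 h u) x - ip1 h u (apply2 h A u) x)"
  proof -
    have "div1 h\<omega> (div2 h\<omega> (opA h\<omega> Q' f')) x = div1 h\<omega> (\<lambda>z. inverse (\<omega> z) *\<^sub>R (div2 h A z + apply2 h A u z)) x"
      by (rule div1_cong[OF X x]) (simp_all only: W)
    also have "\<dots> = inverse (\<omega> x) ^ 3 * (div1 h (\<lambda>z. div2 h A z + apply2 h A u z) x - ip1 h u (\<lambda>z. div2 h A z + apply2 h A u z) x)"
      by (rule divW[OF sm1_add[OF dA Au]])
    also have "ip1 h u (\<lambda>z. div2 h A z + apply2 h A u z) x = ip1 h u (div2 h A) x + ip1 h u (apply2 h A u) x"
      using ip1_lin_right[of h u 1 "div2 h A" 1 "apply2 h A u" x] by simp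
    also have "div1 h (\<lambda>z. div2 h A z + apply2 h A u z) x = div1 h (div2 h A) x + (ip1 h (div2 h A) u x + ip2 h A (cov1 h u) x)"
      by (simp only: div1_add[OF G x dA Au] div1_apply2[OF G x At(1) sm1_u At(2)])
    finally show ?thesis using ip1_sym[OF G x, of u "div2 h A"] by simp
  qed
  have C2: "ip2 h\<omega> Q' (opA h\<omega> Q' f') x = inverse (\<omega> x) ^ 3 * (ip2 h Q A x - ip2 h A (cov1 h u) x + ip1 h u (apply2 h A u) x)"
  proof -
    let ?uu = "\<lambda>z. \<chi> a b. u z $ a * u z $ b"
    have "ip2 h Q' (opA h\<omega> Q' f') x = ip2 h (\<lambda>y. (Q y + (-1) *\<^sub>R tf h (cov1 h u) y) + 1 *\<^sub>R tf h ?uu y) (\<lambda>y. \<omega> x *\<^sub>R A y) x"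
      by (rule ip2_cong) (simp_all add: Q'[OF x] A'[OF x])
    also have "\<dots> = \<omega> x * ip2 h (\<lambda>y. (Q y + (-1) *\<^sub>R tf h (cov1 h u) y) + 1 *\<^sub>R tf h ?uu y) A x"
      unfolding ip2_def sum_2 vector_scaleR_component real_scaleR_def by algebra
    also have "ip2 h (\<lambda>y. (Q y + (-1) *\<^sub>R tf h (cov1 h u) y) + 1 *\<^sub>R tf h ?uu y) A x = ip2 h Q A x - ip2 h (cov1 h u) A x + ip2 h ?uu A x"
      by (simp only: ip2_add_left ip2_tf_left[OF G x At(3)[OF x]], simp?)
    also have "ip2 h ?uu A x = ip1 h u (apply2 h A u) x"
      using ip2_outer[OF G x At(2), of u u] ip1_apply2[OF G x At(2), of u u] by simp
    also have "ip2 h (cov1 h u) A x = ip2 h A (cov1 h u) x" by (rule ip2_sym_2[OF G x])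
    finally show ?thesis unfolding ip2_cmetric[OF x] using \<omega>0[OF x] by (simp add: power3_eq_cube)
  qed
  show ?thesis
    unfolding f'_def[symmetric] op4_def B1 B2 K C1 C2 A_def[symmetric]
    unfolding f'_def using \<omega>0[OF x] by (simp add: field_simps power2_eq_square power3_eq_cube)
qed

end

section \<open>Naturality of the factorised operator\<close>

lemma (in pullback) pb2_smult_diff:
  assumes S: "pb2 S S'" and T: "pb2 T T'" and a: "\<And>x. x \<in> X \<Longrightarrow> a x = a' (\<phi> x)"
  shows "pb2 (\<lambda>x. S x + a x *\<^sub>R T x) (\<lambda>x. S' x + a' x *\<^sub>R T' x)"
  using S T unfolding pb2_def
  by (simp add: a sum.distrib sum_distrib_left distrib_left mult_ac)

lemma (in pullback) pb1_smult_diff: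
  assumes S: "pb1 v v'" and T: "pb1 w w'" and a: "\<And>x. x \<in> X \<Longrightarrow> a x = a' (\<phi> x)"
  shows "pb1 (\<lambda>x. a x *\<^sub>R v x - w x) (\<lambda>x. a' x *\<^sub>R v' x - w' x)"
  using S T unfolding pb1_def
  by (simp add: a sum_subtractf sum_distrib_left right_diff_distrib mult_ac)

locale pullback2 = pullback X Y \<phi> h h' for X Y :: "(real^2) set" and \<phi> h h'

begin

lemma pb2_opA:
  assumes Q: "pb2 Q Q'" and f: "\<And>x. x \<in> X \<Longrightarrow> f x = f' (\<phi> x)" and f': "smooth_on Y f'"
  shows "pb2 (opA h Q f) (opA h' Q' f')"
proof -
  have g: "pb1 (grad1 f) (grad1 f')" by (rule pb1_grad1[OF f f'])
  have H: "pb2 (cov1 h (grad1 f)) (cov1 h' (grad1 f'))"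
    by (rule pb2_cov1[OF g sm1D[OF sm1_grad1[OF f']]])
  have tr: "- (1/2) * tr2 h (cov1 h (grad1 f)) x = - (1/2) * tr2 h' (cov1 h' (grad1 f')) (\<phi> x)" if "x \<in> X" for x
    using pb_tr2[OF H that] by simp
  have "pb2 (\<lambda>x. (cov1 h (grad1 f) x + (- (1/2) * tr2 h (cov1 h (grad1 f)) x) *\<^sub>R h x) + f x *\<^sub>R Q x)
     (\<lambda>x. (cov1 h' (grad1 f') x + (- (1/2) * tr2 h' (cov1 h' (grad1 f')) x) *\<^sub>R h' x) + f' x *\<^sub>R Q' x)"
    by (intro pb2_smult_diff H Q pb2_metric tr f)
  then show ?thesis unfolding pb2_def by (simp add: opA_def tf_def)
qed

lemma op4_pull:
  assumes L: "pb2 L L'" and Q: "pb2 Q Q'" and f: "\<And>x. x \<in> X \<Longrightarrow> f x = f' (\<phi> x)"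
    and L': "tfree Y h' L'" and Q': "tfree Y h' Q'" and f': "smooth_on Y f'" and x: "x \<in> X"
  shows "op4 h L Q f x = op4 h' L' Q' f' (\<phi> x)"
proof -
  have A: "pb2 (opA h Q f) (opA h' Q' f')" by (rule pb2_opA[OF Q f f'])
  note Ls = sm2D[OF tfreeD(1)[OF L']]
  have As: "sm2 Y (opA h' Q' f')" by (rule tfreeD(1)[OF tfree_opA[OF G' Q' f']])
  have W: "pb1 (div2 h (opA h Q f)) (div2 h' (opA h' Q' f'))"
    by (rule pb1_div2[OF A sm2D[OF As]])
  have q: "pb1 (div2 h L) (div2 h' L')" by (rule pb1_div2[OF L Ls])
  have g: "pb1 (grad1 f) (grad1 f')" by (rule pb1_grad1[OF f f'])
  have v: "pb1 (opv h L f) (opv h' L' f')"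
    unfolding opv_def[abs_def] by (intro pb1_smult_diff q pb1_apply2 L g f)
  have vs: "sm1 Y (opv h' L' f')" by (rule sm1_opv[OF G' tfreeD(1)[OF L'] f'])
  have 1: "div1 h (div2 h (opA h Q f)) x = div1 h' (div2 h' (opA h' Q' f')) (\<phi> x)"
    by (rule pb_div1[OF W sm1D[OF sm1_div2[OF G' As]] x])
  have 2: "div1 h (apply2 h L (opv h L f)) x = div1 h' (apply2 h' L' (opv h' L' f')) (\<phi> x)"
    by (rule pb_div1[OF pb1_apply2[OF L v] sm1D[OF sm1_apply2[OF G' tfreeD(1)[OF L'] vs]] x])
  show ?thesis
    unfolding op4_def 1 2 pb_ip2[OF Q A x] pb_ip1[OF q v x] pb_ip2[OF L L x] f[OF x] ..
qed

end

text \<open>The part of the Ricci tensor without manifest symmetry is the derivative of the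
  contracted Christoffel symbol. That symbol is half the gradient of \<open>ln (det G)\<close>, so
  its derivative is a Hessian.\<close>

lemma sym2_ricci:
  fixes G :: "'n::finite tensor2_field"
  assumes G: "metric_on X G"
  shows "sym2 X (ricci G)"
  unfolding sym2_def
proof (intro ballI allI)
  fix x i j assume x: "x \<in> X"
  \<comment> \<open>\<open>q i\<close> is the \<open>i\<close>-th derivative of
    \<open>ln (det G)\<close>, written as a trace to stay with the components of the metric.\<close>
  define q where "q i z = (\<Sum>k\<in>UNIV. \<Sum>l\<in>UNIV. ginv G z $ k $ l * pd i (\<lambda>z. G z $ k $ l) z)" for i z
  have tr: "(\<Sum>k\<in>UNIV. christoffel G z k i k) = 1/2 * q i z" if z: "z \<in> X" for i z
  proof -
    have "(\<Sum>k\<in>UNIV. \<Sum>l\<in>UNIV. ginv G z $ k $ l * pd k (\<lambda>z. G z $ l $ i) z) = (\<Sum>l\<in>UNIV. \<Sum>k\<in>UNIV. ginv G z $ k $ l * pd k (\<lambda>z. G z $ l $ i) z)"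
      by (rule sum.swap)
    also have "\<dots> = (\<Sum>k\<in>UNIV. \<Sum>l\<in>UNIV. ginv G z $ k $ l * pd l (\<lambda>z. G z $ i $ k) z)"
      by (simp only: ginv_sym[OF G z, of _ k for k] pd_metric_sym[OF G z, of _ i k for k])
    finally have 1: "(\<Sum>k\<in>UNIV. \<Sum>l\<in>UNIV. ginv G z $ k $ l * pd k (\<lambda>z. G z $ l $ i) z) = (\<Sum>k\<in>UNIV. \<Sum>l\<in>UNIV. ginv G z $ k $ l * pd l (\<lambda>z. G z $ i $ k) z)" .
    have "q i z = (\<Sum>k\<in>UNIV. \<Sum>l\<in>UNIV. ginv G z $ k $ l * pd i (\<lambda>z. G z $ l $ k) z)"
      unfolding q_def by (intro sum.cong refl) (use pd_metric_sym[OF G z] in metis)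
    then show ?thesis using 1
      unfolding christoffel_christ1 christ1_def
      by (simp add: distrib_left right_diff_distrib sum.distrib sum_subtractf sum_divide_distrib[symmetric])
  qed
  have pq: "pd j (\<lambda>z. q i z) x = - (\<Sum>k\<in>UNIV. \<Sum>l\<in>UNIV. \<Sum>a\<in>UNIV. \<Sum>b\<in>UNIV. ginv G x $ k $ a * pd j (\<lambda>z. G z $ a $ b) x * ginv G x $ b $ l * pd i (\<lambda>z. G z $ k $ l) x)
     + (\<Sum>k\<in>UNIV. \<Sum>l\<in>UNIV. ginv G x $ k $ l * pd j (\<lambda>z. pd i (\<lambda>z. G z $ k $ l) z) x)" for i j
    unfolding q_def
    by (simp add: ginv_diff[OF G x] smooth_on_diff[OF smooth_on_pd[OF metric_smooth[OF G]] x] pd_ginv[OF G x] sum.distrib sum_subtractf sum_distrib_right)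
  have "(\<Sum>k\<in>UNIV. \<Sum>l\<in>UNIV. \<Sum>a\<in>UNIV. \<Sum>b\<in>UNIV. ginv G x $ k $ a * pd j (\<lambda>z. G z $ a $ b) x * ginv G x $ b $ l * pd i (\<lambda>z. G z $ k $ l) x)
     = (\<Sum>k\<in>UNIV. \<Sum>l\<in>UNIV. \<Sum>a\<in>UNIV. \<Sum>b\<in>UNIV. ginv G x $ k $ a * pd i (\<lambda>z. G z $ a $ b) x * ginv G x $ b $ l * pd j (\<lambda>z. G z $ k $ l) x)"
    by (subst sum_swap_pairs) (intro sum.cong refl, use ginv_sym[OF G x] in \<open>simp add: mult_ac\<close>)
  moreover have "pd j (\<lambda>z. pd i (\<lambda>z. G z $ k $ l) z) x = pd i (\<lambda>z. pd j (\<lambda>z. G z $ k $ l) z) x" for k l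
    by (rule pd_commute[OF metric_smooth[OF G] x])
  ultimately have qs: "pd j (\<lambda>z. q i z) x = pd i (\<lambda>z. q j z) x" unfolding pq by simp
  have ptr: "(\<Sum>k\<in>UNIV. pd j (\<lambda>z. christoffel G z k i k) x) = 1/2 * pd j (\<lambda>z. q i z) x" for i j
  proof -
    have sq: "smooth_on X (\<lambda>z. q i z)" unfolding q_def
      by (intro smooth_intros metric_open[OF G] ginv_smooth[OF G] metric_smooth[OF G])
    have "(\<Sum>k\<in>UNIV. pd j (\<lambda>z. christoffel G z k i k) x) = pd j (\<lambda>z. \<Sum>k\<in>UNIV. christoffel G z k i k) x"
      by (simp add: christoffel_diff[OF G x])
    also have "\<dots> = pd j (\<lambda>z. 1/2 * q i z) x" by (rule pd_cong_open[OF metric_open[OF G] x tr])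
    finally show ?thesis using smooth_on_diff[OF sq x] pd_mult[of "\<lambda>z. 1/2" x "\<lambda>z. q i z"] by simp
  qed
  have 1: "(\<Sum>k\<in>UNIV. \<Sum>l\<in>UNIV. christoffel G x k j l * christoffel G x l i k) = (\<Sum>k\<in>UNIV. \<Sum>l\<in>UNIV. christoffel G x k i l * christoffel G x l j k)"
    by (subst sum.swap) (simp only: mult.commute)
  have 2: "pd k (\<lambda>z. christoffel G z k i j) x = pd k (\<lambda>z. christoffel G z k j i) x" for k
    by (rule pd_cong_open[OF metric_open[OF G] x]) (rule christoffel_sym[OF G])
  show "ricci G x $ i $ j = ricci G x $ j $ i"
    unfolding ricci_def vec_lambda_beta ptr qs 1 2 christoffel_sym[OF G x, of _ i j] ..
qed

section \<open>Hypersurface geometry in slice coordinates\<close>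

lemma slice_emb_nth [simp]: "slice_emb y $ 1 = y $ 1" "slice_emb y $ 2 = y $ 2" "slice_emb y $ 3 = 0"
  by (simp_all add: slice_emb_def)

lemma tan_ix_simps [simp]: "tan_ix 1 = 1" "tan_ix 2 = 2"
  by (simp_all add: tan_ix_def)

lemma slice_emb_tan_ix [simp]: "slice_emb y $ tan_ix a = y $ a"
  using exhaust_2[of a] by auto

lemma tan_part_nth: "tan_part T y $ a $ b = T (slice_emb y) $ tan_ix a $ tan_ix b"
  by (simp add: tan_part_def)

definition slice_of :: "(real^3) set \<Rightarrow> (real^2) set" where
  "slice_of X = {y. slice_emb y \<in> X}"

lemma slice_ofD: "y \<in> slice_of X \<Longrightarrow> slice_emb y \<in> X" by (simp add: slice_of_def)

lemma pd_slice_emb: "pd a (\<lambda>y. slice_emb y $ j) y = kd j (tan_ix a)"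
  using exhaust_2[of a] exhaust_3[of j] by (elim disjE) simp_all

lemma diff_slice_emb: "(\<lambda>y. slice_emb y $ j) differentiable (at y)"
  using exhaust_3[of j] by (elim disjE) simp_all

lemma pd_slice:
  fixes F :: "real^3 \<Rightarrow> real"
  assumes "F differentiable (at (slice_emb y))"
  shows "pd a (\<lambda>y. F (slice_emb y)) y = pd (tan_ix a) F (slice_emb y)"
    and "(\<lambda>y. F (slice_emb y)) differentiable (at y)"
  using pd_comp[of slice_emb y F, OF diff_slice_emb assms] by (simp_all only: pd_slice_emb sum_kd_right)

lemma smooth_slice_emb: "open V \<Longrightarrow> smooth_on V (\<lambda>y. slice_emb y $ j)"
  using exhaust_3[of j] by (elim disjE) (simp_all add: smooth_on_coord smooth_on_const)

lemma open_slice_of: "open X \<Longrightarrow> open (slice_of X)"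
proof -
  assume X: "open X"
  have "slice_emb differentiable (at y)" for y by (rule differentiable_vecI[OF diff_slice_emb])
  then have "continuous_on UNIV slice_emb"
    by (simp add: continuous_on_eq_continuous_at differentiable_imp_continuous_within)
  then have "open (slice_emb -` X)" using X by (simp add: continuous_on_open_vimage)
  then show ?thesis by (simp add: slice_of_def vimage_def)
qed

lemma smooth_slice: "smooth_on X F \<Longrightarrow> smooth_on (slice_of X) (\<lambda>y. F (slice_emb y))" for F :: "real^3 \<Rightarrow> real"
  by (rule smooth_on_comp[of X F]) (auto intro!: smooth_slice_emb open_slice_of dest: smooth_on_open slice_ofD)

lemma sm2_tan_part: "sm2 X T \<Longrightarrow> sm2 (slice_of X) (tan_part T)"
  unfolding sm2_def[of _ "tan_part T"] tan_part_nth by (intro allI smooth_slice sm2D)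

(* The trace-free part of calP, since Ric and the Schouten tensor differ by a multiple of G. *)
definition Qf :: "3 tensor2_field \<Rightarrow> 2 tensor2_field" where
  "Qf G y = tf (tan_part G) (tan_part (ricci G)) y + mean_curv G y *\<^sub>R second_ff0 G y"

context
  fixes X :: "(real^3) set" and G :: "3 tensor2_field"
  assumes G: "metric_on X G"

begin

lemma metric_tan_part: "metric_on (slice_of X) (tan_part G)"
  unfolding metric_on_def
proof (intro conjI allI ballI impI)
  show "open (slice_of X)" by (rule open_slice_of[OF metric_open[OF G]])
  show "smooth_on (slice_of X) (\<lambda>x. (tan_part G) x $ i $ j)" for i j
    by (rule sm2D[OF sm2_tan_part[OF sm2_metric[OF G]]])
  fix y assume y: "y \<in> slice_of X"
  then have x: "slice_emb y \<in> X" by (rule slice_ofD)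
  show "transpose ((tan_part G) y) = (tan_part G) y"
    using metric_sym[OF G x] by (simp add: transpose_def vec_eq_iff tan_part_nth)
  fix v :: "real^2" assume v: "v \<noteq> 0"
  have "slice_emb v \<noteq> 0"
  proof
    assume "slice_emb v = 0"
    then have "slice_emb v $ 1 = 0" "slice_emb v $ 2 = 0" by (simp_all only: zero_index)
    then show False using v by (simp add: vec_eq_iff forall_2)
  qed
  then have "slice_emb v \<bullet> (G (slice_emb y) *v slice_emb v) > 0" by (rule metric_pos[OF G x])
  then show "v \<bullet> ((tan_part G) y *v v) > 0"
    by (simp add: inner_vec_def sum_2 sum_3 matrix_vector_mult_def tan_part_nth)
qed

text \<open>The conormal is a multiple of \<open>dx^3\<close> near the slice. Its tangential
  components vanish identically, so only the Christoffel term of the covariant derivative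
  remains.\<close>

lemma second_ff_eq:
  assumes x: "slice_emb y \<in> X"
  shows "second_ff G y $ a $ b = - christoffel G (slice_emb y) 3 (tan_ix a) (tan_ix b) * inverse (sqrt (ginv G (slice_emb y) $ 3 $ 3))"
proof -
  have t: "tan_ix b \<noteq> 3" using exhaust_2[of b] by auto
  have "(\<lambda>z. conormal G z $ tan_ix b) = (\<lambda>z. 0)"
    using t by (simp add: conormal_def axis_def fun_eq_iff)
  then have "cov1 G (conormal G) (slice_emb y) $ tan_ix a $ tan_ix b =
    - (\<Sum>k\<in>UNIV. christoffel G (slice_emb y) k (tan_ix a) (tan_ix b) * conormal G (slice_emb y) $ k)"
    by (simp add: cov1_def)
  also have "\<dots> = - christoffel G (slice_emb y) 3 (tan_ix a) (tan_ix b) * inverse (sqrt (ginv G (slice_emb y) $ 3 $ 3))"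
    by (simp add: sum_3 conormal_def axis_def divide_inverse)
  finally show ?thesis by (simp add: second_ff_def tan_part_nth)
qed

lemma sm2_second_ff: "sm2 (slice_of X) (second_ff G)"
proof -
  have "sm2 (slice_of X) (\<lambda>y. \<chi> a b. - christoffel G (slice_emb y) 3 (tan_ix a) (tan_ix b) * inverse (sqrt (ginv G (slice_emb y) $ 3 $ 3)))"
    unfolding sm2_def vec_lambda_beta
    by (intro allI smooth_on_mult smooth_on_minus smooth_slice christoffel_smooth[OF G] smooth_on_inverse smooth_on_sqrt ginv_smooth[OF G])
       (use ginv_diag_pos[OF G, of _ 3] in \<open>force simp: slice_of_def\<close>)+
  then show ?thesis
    by (rule sm2_cong) (simp add: vec_eq_iff second_ff_eq slice_ofD)
qed

lemma sym2_second_ff: "sym2 (slice_of X) (second_ff G)"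
  unfolding sym2_def using second_ff_eq christoffel_sym[OF G] by (simp add: slice_ofD)

lemma second_ff0_tf: "second_ff0 G y = tf (tan_part G) (second_ff G) y"
  by (simp add: second_ff0_def tf_def mean_curv_def)

lemma tfree_second_ff0: "tfree (slice_of X) (tan_part G) (second_ff0 G)"
  unfolding tfree_def second_ff0_tf[abs_def]
  using sm2_tf[OF metric_tan_part sm2_second_ff] sym2_tf[OF metric_tan_part sym2_second_ff] tr2_tf[OF metric_tan_part] by simp

lemma smooth_mean_curv: "smooth_on (slice_of X) (mean_curv G)"
  unfolding mean_curv_def[abs_def]
  by (intro smooth_intros open_slice_of metric_open[OF G] smooth_tr2[OF metric_tan_part] sm2_second_ff)

lemma K_inv_ip2: "K_inv G y = ip2 (tan_part G) (second_ff0 G) (second_ff0 G) y"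
  unfolding K_inv_def norm2_sq_ip2 ..

lemma tr2_metric3: "x \<in> X \<Longrightarrow> tr2 G G x = 3"
proof -
  assume x: "x \<in> X"
  have "tr2 G G x = (\<Sum>a\<in>UNIV. \<Sum>b\<in>UNIV. ginv G x $ a $ b * G x $ b $ a)"
    unfolding tr2_def using metric_sym[OF G x] by simp
  then show ?thesis by (simp add: ginv_left[OF G x] sum_3)
qed

text \<open>In dimension three the trace of the defining equation is \<open>tr Ric = 4 tr P\<close>,
  whence the factor 1/4.\<close>

lemma schouten_eq:
  assumes x: "x \<in> X"
  shows "schouten G x = ricci G x - (1/4 * tr2 G (ricci G) x) *\<^sub>R G x"
proof -
  define tr where "tr P = (\<Sum>a\<in>UNIV. \<Sum>b\<in>UNIV. ginv G x $ a $ b * P $ a $ b)" for P :: "real^3^3"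
  have lin: "tr (P + c *\<^sub>R G x) = tr P + c * 3" for P c
  proof -
    have "tr (P + c *\<^sub>R G x) = tr P + c * tr (G x)"
      by (simp only: tr_def vector_add_component vector_scaleR_component real_scaleR_def distrib_left sum.distrib
         mult.left_commute[of _ c] sum_distrib_left)
    then show ?thesis using tr2_metric3[OF x] by (simp add: tr_def tr2_def)
  qed
  have R: "tr (ricci G x) = tr2 G (ricci G) x" by (simp add: tr_def tr2_def)
  show ?thesis unfolding schouten_def tr_def[symmetric]
  proof (rule the_equality)
    let ?P = "ricci G x - (1/4 * tr2 G (ricci G) x) *\<^sub>R G x"
    have "tr ?P = 1/4 * tr2 G (ricci G) x" using lin[of "ricci G x" "- (1/4 * tr2 G (ricci G) x)"] R by simp
    then show "ricci G x = (real CARD(3) - 2) *\<^sub>R ?P + tr ?P *\<^sub>R G x" by simp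
  next
    fix P assume P: "ricci G x = (real CARD(3) - 2) *\<^sub>R P + tr P *\<^sub>R G x"
    then have P': "ricci G x = P + tr P *\<^sub>R G x" by simp
    then have "tr (ricci G x) = tr P + tr P * 3" by (simp only: lin)
    then have "tr P = 1/4 * tr2 G (ricci G) x" unfolding R by simp
    then show "P = ricci G x - (1/4 * tr2 G (ricci G) x) *\<^sub>R G x"
      using P' by (simp add: algebra_simps)
  qed
qed

lemma tfree_Qf: "tfree (slice_of X) (tan_part G) (Qf G)"
  unfolding tfree_def
proof (intro conjI ballI)
  note L = tfreeD[OF tfree_second_ff0]
  have R: "sm2 (slice_of X) (tan_part (ricci G))" by (rule sm2_tan_part[OF sm2_ricci[OF G]])
  have Rs: "sym2 (slice_of X) (tan_part (ricci G))"
    using sym2_ricci[OF G] unfolding sym2_def tan_part_nth by (auto dest: slice_ofD)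
  show "sm2 (slice_of X) (Qf G)" unfolding Qf_def[abs_def]
    by (intro sm2_add sm2_smult sm2_tf[OF metric_tan_part R] smooth_mean_curv L)
  show "sym2 (slice_of X) (Qf G)" unfolding Qf_def[abs_def]
    by (intro sym2_add sym2_smult sym2_tf[OF metric_tan_part Rs] L)
  fix y assume y: "y \<in> slice_of X"
  have "tr2 (tan_part G) (Qf G) y = tr2 (tan_part G) (\<lambda>z. tf (tan_part G) (tan_part (ricci G)) z + mean_curv G y *\<^sub>R second_ff0 G z) y"
    by (rule tr2_cong) (simp_all add: Qf_def)
  then show "tr2 (tan_part G) (Qf G) y = 0"
    by (simp add: tr2_add[OF metric_tan_part] tr2_tf[OF metric_tan_part y] L(3)[OF y])
qed

lemma calJ_eq:
  assumes y: "y \<in> slice_of X"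
  shows "calJ G y = tr2 (tan_part G) (tan_part (ricci G)) y - 1/2 * tr2 G (ricci G) (slice_emb y) + (mean_curv G y)\<^sup>2 - K_inv G y"
proof -
  let ?c = "1/2 * (mean_curv G y)\<^sup>2 - 1/2 * K_inv G y - 1/4 * tr2 G (ricci G) (slice_emb y)"
  have "calJ G y = tr2 (tan_part G) (\<lambda>z. (tan_part (ricci G) z + mean_curv G y *\<^sub>R second_ff0 G z) + ?c *\<^sub>R (tan_part G) z) y"
    unfolding calJ_def
    by (rule tr2_cong) (simp_all add: calP_def vec_eq_iff tan_part_nth schouten_eq[OF slice_ofD[OF y]] algebra_simps)
  then show ?thesis
    by (simp add: tr2_add[OF metric_tan_part] tfreeD(3)[OF tfree_second_ff0 y] tr2_metric[OF metric_tan_part y])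
qed

lemma calP_eq:
  assumes y: "y \<in> slice_of X"
  shows "calP G y = Qf G y + (1/2 * calJ G y) *\<^sub>R (tan_part G) y"
  unfolding calJ_eq[OF y] Qf_def tf_def
  by (simp add: calP_def vec_eq_iff tan_part_nth schouten_eq[OF slice_ofD[OF y]] algebra_simps)

end

section \<open>Changes of slice coordinates\<close>

definition slice_map :: "(real^3 \<Rightarrow> real^3) \<Rightarrow> real^2 \<Rightarrow> real^2" where
  "slice_map \<phi> y = (\<chi> a. \<phi> (slice_emb y) $ tan_ix a)"

text \<open>The slice goes into the slice, so \<open>\<phi>\<close> restricts to a map of surfaces
  that is itself a pullback, for the induced metrics.\<close>

locale slice_pullback = pullback X Y \<phi> G G' for X Y :: "(real^3) set" and \<phi> G G' +
  assumes slice: "\<And>y. y \<in> slice_of X \<Longrightarrow> \<phi> (slice_emb y) $ 3 = 0"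

begin

abbreviation "V \<equiv> slice_of X"

abbreviation "W \<equiv> slice_of Y"

abbreviation "\<psi> \<equiv> slice_map \<phi>"

lemma V_open: "open V" by (rule open_slice_of[OF X])

lemma emb_\<psi>: "y \<in> V \<Longrightarrow> slice_emb (\<psi> y) = \<phi> (slice_emb y)"
  using slice[of y] by (simp add: vec_eq_iff forall_3 slice_map_def)

lemma \<psi>_W: "y \<in> V \<Longrightarrow> \<psi> y \<in> W"
  using sub[of "slice_emb y"] by (simp add: slice_of_def emb_\<psi>)

lemma pd_\<psi>: "y \<in> V \<Longrightarrow> pd a (\<lambda>y. \<psi> y $ i) y = D (slice_emb y) (tan_ix i) (tan_ix a)"
  using pd_slice(1)[OF smooth_on_diff[OF \<phi> slice_ofD]] by (simp add: slice_map_def D_def)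

text \<open>Along the slice the Jacobian is block triangular. This is why restriction to tangential
  indices commutes with the pullback.\<close>

lemma D3_tan: assumes y: "y \<in> V" shows "D (slice_emb y) 3 (tan_ix a) = 0"
proof -
  have "D (slice_emb y) 3 (tan_ix a) = pd a (\<lambda>y. \<phi> (slice_emb y) $ 3) y"
    using pd_slice(1)[OF smooth_on_diff[OF \<phi> slice_ofD[OF y]]] by (simp add: D_def)
  also have "\<dots> = pd a (\<lambda>y. 0) y" by (rule pd_cong_open[OF V_open y slice])
  finally show ?thesis by simp
qed

lemma D31: "y \<in> V \<Longrightarrow> D (slice_emb y) 3 1 = 0" and D32: "y \<in> V \<Longrightarrow> D (slice_emb y) 3 2 = 0"
  using D3_tan[of y 1] D3_tan[of y 2] by simp_all

lemma E3_tan: assumes y: "y \<in> V" shows "E (slice_emb y) 3 (tan_ix a) (tan_ix b) = 0"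
proof -
  have "E (slice_emb y) 3 (tan_ix a) (tan_ix b) = pd b (\<lambda>y. D (slice_emb y) 3 (tan_ix a)) y"
    using pd_slice(1)[OF D_diff[OF slice_ofD[OF y]]] by (simp add: E_def)
  also have "\<dots> = pd b (\<lambda>y. 0) y" by (rule pd_cong_open[OF V_open y D3_tan])
  finally show ?thesis by simp
qed

lemma det_D: assumes y: "y \<in> V"
  shows "D (slice_emb y) 3 3 \<noteq> 0"
    "D (slice_emb y) 1 1 * D (slice_emb y) 2 2 - D (slice_emb y) 1 2 * D (slice_emb y) 2 1 \<noteq> 0"
  using jac[OF slice_ofD[OF y]] D31[OF y] D32[OF y]
  unfolding D_def[symmetric] det_3 by auto

sublocale S: pullback2 V W \<psi> "tan_part G" "tan_part G'"
proof (unfold_locales)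
  show "open V" by (rule V_open)
  show "smooth_on V (\<lambda>x. \<psi> x $ i)" for i
    unfolding slice_map_def vec_lambda_beta by (rule smooth_slice[OF \<phi>])
  show "y \<in> V \<Longrightarrow> \<psi> y \<in> W" for y by (rule \<psi>_W)
  show "det (\<chi> i a. pd a (\<lambda>z. \<psi> z $ i) y) \<noteq> 0" if "y \<in> V" for y
    using det_D(2)[OF that] by (simp add: det_2 pd_\<psi>[OF that])
  show "metric_on W (tan_part G')" by (rule metric_tan_part[OF G'])
  fix y a b assume y: "y \<in> V"
  show "tan_part G y $ a $ b = (\<Sum>i\<in>UNIV. \<Sum>j\<in>UNIV. pd a (\<lambda>z. \<psi> z $ i) y * pd b (\<lambda>z. \<psi> z $ j) y * tan_part G' (\<psi> y) $ i $ j)"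
    by (simp add: tan_part_nth pull'[OF slice_ofD[OF y]] pd_\<psi>[OF y] sum_3 sum_2 D3_tan[OF y] emb_\<psi>[OF y])
qed

lemma SD: "y \<in> V \<Longrightarrow> S.D y i a = D (slice_emb y) (tan_ix i) (tan_ix a)"
  by (simp add: S.D_def pd_\<psi>)

lemma pb2_tan_part:
  assumes T: "pb2 T T'"
  shows "S.pb2 (tan_part T) (tan_part T')"
  unfolding S.pb2_def
proof (intro ballI allI)
  fix y a b assume y: "y \<in> V"
  have "T (slice_emb y) $ tan_ix a $ tan_ix b = (\<Sum>i\<in>UNIV. \<Sum>j\<in>UNIV. D (slice_emb y) i (tan_ix a) * D (slice_emb y) j (tan_ix b) * T' (\<phi> (slice_emb y)) $ i $ j)"
    using T slice_ofD[OF y] by (simp add: pb2_def)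
  then show "tan_part T y $ a $ b = (\<Sum>i\<in>UNIV. \<Sum>j\<in>UNIV. S.D y i a * S.D y j b * tan_part T' (\<psi> y) $ i $ j)"
    by (simp add: tan_part_nth SD[OF y] sum_3 sum_2 D3_tan[OF y] emb_\<psi>[OF y])
qed

text \<open>Whether \<open>\<phi>\<close> preserves or reverses the side of the surface to which the
  conormal points.\<close>

definition sg :: "real^2 \<Rightarrow> real" where "sg y = sgn (D (slice_emb y) 3 3)"

lemma sg_sq: "y \<in> V \<Longrightarrow> sg y * sg y = 1"
  using det_D(1)[of y] by (simp add: sg_def sgn_mult[symmetric])

text \<open>The Christoffel law brings in \<open>D 3 3\<close> and the normalisation of the conormal
  its absolute value; their quotient is the sign.\<close>

lemma second_ff_pull:
  assumes y: "y \<in> V"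
  shows "second_ff G y $ a $ b = sg y * (\<Sum>i\<in>UNIV. \<Sum>j\<in>UNIV. S.D y i a * S.D y j b * second_ff G' (\<psi> y) $ i $ j)"
proof -
  let ?x = "slice_emb y"
  have x: "?x \<in> X" by (rule slice_ofD[OF y])
  let ?d = "D ?x 3 3" and ?r = "sqrt (ginv G ?x $ 3 $ 3)" and ?r' = "sqrt (ginv G' (\<phi> ?x) $ 3 $ 3)"
  let ?s = "\<Sum>i\<in>UNIV. \<Sum>j\<in>UNIV. christoffel G' (\<phi> ?x) 3 (tan_ix i) (tan_ix j) * D ?x (tan_ix i) (tan_ix a) * D ?x (tan_ix j) (tan_ix b)"
  have r: "?r > 0" "?r' > 0" using ginv_diag_pos[OF metric x, of 3] ginv_diag_pos[OF G' sub[OF x], of 3] by simp_all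
  have "ginv G' (\<phi> ?x) $ 3 $ 3 = ?d * ?d * ginv G ?x $ 3 $ 3"
    using ginv_pull[OF x, of 3 3] by (simp add: sum_3 D31[OF y] D32[OF y])
  then have r': "?r' = \<bar>?d\<bar> * ?r" by (simp add: real_sqrt_mult)
  have \<Gamma>: "?d * christoffel G ?x 3 (tan_ix a) (tan_ix b) = ?s"
    using christoffel_pull[OF x, of 3 "tan_ix a" "tan_ix b"]
    by (simp add: sum_3 sum_2 D31[OF y] D32[OF y] E3_tan[OF y] D3_tan[OF y])
  have "second_ff G y $ a $ b = - (?s * inverse ?d) * inverse ?r"
    unfolding second_ff_eq[OF metric x] \<Gamma>[symmetric] using det_D(1)[OF y] by simp
  also have "\<dots> = - sg y * (?s * inverse ?r')"
  proof -
    have "inverse ?d = sgn ?d * inverse \<bar>?d\<bar>" by (simp add: sgn_if)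
    then show ?thesis by (simp add: r' sg_def)
  qed
  also have "\<dots> = sg y * (\<Sum>i\<in>UNIV. \<Sum>j\<in>UNIV. S.D y i a * S.D y j b * second_ff G' (\<psi> y) $ i $ j)"
    using sub[OF x] by (simp add: second_ff_eq[OF G'] emb_\<psi>[OF y] SD[OF y] sum_2 algebra_simps)
  finally show ?thesis .
qed

lemma pb2_second_ff: "S.pb2 (\<lambda>y. sg y *\<^sub>R second_ff G y) (second_ff G')"
  unfolding S.pb2_def using second_ff_pull sg_sq by (simp add: mult.assoc[symmetric])

lemma mean_curv_pull: assumes y: "y \<in> V" shows "mean_curv G y = sg y * mean_curv G' (\<psi> y)"
proof -
  have "tr2 (tan_part G) (\<lambda>y. sg y *\<^sub>R second_ff G y) y = tr2 (tan_part G') (second_ff G') (\<psi> y)"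
    by (rule S.pb_tr2[OF pb2_second_ff y])
  moreover have "tr2 (tan_part G) (\<lambda>y. sg y *\<^sub>R second_ff G y) y = sg y * tr2 (tan_part G) (second_ff G) y"
    unfolding tr2_def sum_2 vector_scaleR_component real_scaleR_def by algebra
  ultimately have "sg y * (sg y * tr2 (tan_part G) (second_ff G) y) = sg y * tr2 (tan_part G') (second_ff G') (\<psi> y)" by simp
  then show ?thesis by (simp add: mean_curv_def sg_sq[OF y] mult.assoc[symmetric])
qed

lemma second_ff0_pull:
  assumes y: "y \<in> V"
  shows "second_ff0 G y $ a $ b = sg y * (\<Sum>i\<in>UNIV. \<Sum>j\<in>UNIV. S.D y i a * S.D y j b * second_ff0 G' (\<psi> y) $ i $ j)"
  unfolding second_ff0_def vector_minus_component vector_scaleR_component real_scaleR_def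
    second_ff_pull[OF y] mean_curv_pull[OF y] S.pull'[OF y] sum_2 by algebra

lemma pb2_second_ff0: "S.pb2 (\<lambda>y. sg y *\<^sub>R second_ff0 G y) (second_ff0 G')"
  unfolding S.pb2_def using second_ff0_pull sg_sq by (simp add: mult.assoc[symmetric])

lemma K_inv_pull: assumes y: "y \<in> V" shows "K_inv G y = K_inv G' (\<psi> y)"
proof -
  have "ip2 (tan_part G) (\<lambda>y. sg y *\<^sub>R second_ff0 G y) (\<lambda>y. sg y *\<^sub>R second_ff0 G y) y = K_inv G' (\<psi> y)"
    unfolding K_inv_ip2[OF G'] by (rule S.pb_ip2[OF pb2_second_ff0 pb2_second_ff0 y])
  moreover have "ip2 (tan_part G) (\<lambda>y. sg y *\<^sub>R second_ff0 G y) (\<lambda>y. sg y *\<^sub>R second_ff0 G y) y = sg y * sg y * K_inv G y"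
    unfolding K_inv_ip2[OF metric] ip2_def sum_2 vector_scaleR_component real_scaleR_def by algebra
  ultimately show ?thesis by (simp add: sg_sq[OF y])
qed

lemma pb2_Qf: "S.pb2 (Qf G) (Qf G')"
  unfolding S.pb2_def
proof (intro ballI allI)
  fix y a b assume y: "y \<in> V"
  let ?R = "tan_part (ricci G)" and ?R' = "tan_part (ricci G')"
  have R: "S.pb2 ?R ?R'" by (rule pb2_tan_part[OF pb2_ricci])
  have R1: "?R y $ a $ b = (\<Sum>i\<in>UNIV. \<Sum>j\<in>UNIV. S.D y i a * S.D y j b * ?R' (\<psi> y) $ i $ j)"
    using R y by (simp add: S.pb2_def)
  have "mean_curv G y * second_ff0 G y $ a $ b = (sg y * sg y) * (mean_curv G' (\<psi> y) * (\<Sum>i\<in>UNIV. \<Sum>j\<in>UNIV. S.D y i a * S.D y j b * second_ff0 G' (\<psi> y) $ i $ j))"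
    unfolding second_ff0_pull[OF y] mean_curv_pull[OF y] by simp
  then have HL: "mean_curv G y * second_ff0 G y $ a $ b = mean_curv G' (\<psi> y) * (\<Sum>i\<in>UNIV. \<Sum>j\<in>UNIV. S.D y i a * S.D y j b * second_ff0 G' (\<psi> y) $ i $ j)"
    by (simp only: sg_sq[OF y] mult_1)
  show "Qf G y $ a $ b = (\<Sum>i\<in>UNIV. \<Sum>j\<in>UNIV. S.D y i a * S.D y j b * Qf G' (\<psi> y) $ i $ j)"
    unfolding Qf_def tf_def vector_minus_component vector_add_component vector_scaleR_component real_scaleR_def
      HL R1 S.pb_tr2[OF R y] S.pull'[OF y] sum_2 by algebra
qed

lemma calJ_pull: assumes y: "y \<in> V" shows "calJ G y = calJ G' (\<psi> y)"
proof -
  have "mean_curv G y * mean_curv G y = (sg y * sg y) * (mean_curv G' (\<psi> y) * mean_curv G' (\<psi> y))"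
    unfolding mean_curv_pull[OF y] by simp
  then have "(mean_curv G y)\<^sup>2 = (mean_curv G' (\<psi> y))\<^sup>2" by (simp add: sg_sq[OF y] power2_eq_square)
  then show ?thesis
    unfolding calJ_eq[OF metric y] calJ_eq[OF G' \<psi>_W[OF y]] K_inv_pull[OF y]
      S.pb_tr2[OF pb2_tan_part[OF pb2_ricci] y] emb_\<psi>[OF y] pb_tr2[OF pb2_ricci slice_ofD[OF y]] by simp
qed

text \<open>The sign of the conormal is locally constant, so it drops out of the operator.\<close>

lemma op4_slice_pull:
  assumes y: "y \<in> V" and f: "\<And>y. y \<in> V \<Longrightarrow> f y = f' (\<psi> y)" and f': "smooth_on W f'"
  shows "op4 (tan_part G) (second_ff0 G) (Qf G) f y = op4 (tan_part G') (second_ff0 G') (Qf G') f' (\<psi> y)"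
proof -
  \<comment> \<open>The open set where \<open>D 3 3\<close> has the same sign as over
    \<open>y\<close>. After shrinking to it, \<open>sg\<close> is constant and the hypothesis of
    \<open>op4_sign\<close> is met.\<close>
  define X1 where "X1 = {x\<in>X. D x 3 3 * D (slice_emb y) 3 3 > 0}"
  have cont: "continuous_on X (\<lambda>x. D x 3 3 * D (slice_emb y) 3 3)"
    by (intro continuous_intros)
       (auto simp: continuous_on_eq_continuous_at[OF X] intro: differentiable_imp_continuous_within D_diff)
  have X1o: "open X1"
  proof -
    have "X1 = X \<inter> (\<lambda>x. D x 3 3 * D (slice_emb y) 3 3) -` {0<..}" by (auto simp: X1_def)
    then show ?thesis using continuous_open_preimage[OF cont X, of "{0<..}"] by simp
  qed
  have sub1: "x \<in> X1 \<Longrightarrow> x \<in> X" for x by (simp add: X1_def)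
  interpret R: slice_pullback X1 Y \<phi> G G'
  proof (unfold_locales)
    show "open X1" by (rule X1o)
    show "smooth_on X1 (\<lambda>x. \<phi> x $ i)" for i by (rule smooth_on_subset[OF \<phi> X1o]) (use sub1 in blast)
    show "\<And>x. x \<in> X1 \<Longrightarrow> \<phi> x \<in> Y" by (rule sub[OF sub1])
    show "\<And>x. x \<in> X1 \<Longrightarrow> det (\<chi> i a. pd a (\<lambda>z. \<phi> z $ i) x) \<noteq> 0" by (rule jac[OF sub1])
    show "metric_on Y G'" by (rule G')
    show "\<And>x a b. x \<in> X1 \<Longrightarrow>
      G x $ a $ b = (\<Sum>i\<in>UNIV. \<Sum>j\<in>UNIV. pd a (\<lambda>z. \<phi> z $ i) x * pd b (\<lambda>z. \<phi> z $ j) x * G' (\<phi> x) $ i $ j)"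
      by (rule pull[OF sub1])
    show "\<And>y. y \<in> slice_of X1 \<Longrightarrow> \<phi> (slice_emb y) $ 3 = 0" by (rule slice) (simp add: slice_of_def X1_def)
  qed
  have y1: "y \<in> R.V" using y det_D(1)[OF y] by (simp add: slice_of_def X1_def zero_less_mult_iff) linarith
  have V1: "z \<in> R.V \<Longrightarrow> z \<in> V" for z by (simp add: slice_of_def X1_def)
  have c: "R.sg z = sg y" if z: "z \<in> R.V" for z
  proof -
    have "D (slice_emb z) 3 3 * D (slice_emb y) 3 3 > 0" using z by (simp add: slice_of_def X1_def)
    then show ?thesis by (auto simp: R.sg_def sg_def zero_less_mult_iff)
  qed
  have L: "R.S.pb2 (\<lambda>z. sg y *\<^sub>R second_ff0 G z) (second_ff0 G')"
    unfolding R.S.pb2_def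
  proof (intro ballI allI)
    fix z a b assume z: "z \<in> R.V"
    have "(R.sg z *\<^sub>R second_ff0 G z) $ a $ b = (\<Sum>i\<in>UNIV. \<Sum>j\<in>UNIV. R.S.D z i a * R.S.D z j b * second_ff0 G' (\<psi> z) $ i $ j)"
      using R.pb2_second_ff0 z unfolding R.S.pb2_def by blast
    then show "(sg y *\<^sub>R second_ff0 G z) $ a $ b = (\<Sum>i\<in>UNIV. \<Sum>j\<in>UNIV. R.S.D z i a * R.S.D z j b * second_ff0 G' (\<psi> z) $ i $ j)"
      unfolding c[OF z] .
  qed
  have fs: "smooth_on R.V f"
  proof (rule smooth_on_cong)
    show "smooth_on R.V (\<lambda>z. f' (\<psi> z))" by (rule R.S.smooth_comp[OF f'])
  qed (simp add: f V1)
  have "op4 (tan_part G) (\<lambda>z. sg y *\<^sub>R second_ff0 G z) (Qf G) f y = op4 (tan_part G') (second_ff0 G') (Qf G') f' (\<psi> y)"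
    by (rule R.S.op4_pull[OF L R.pb2_Qf f[OF V1] tfree_second_ff0[OF G'] tfree_Qf[OF G'] f' y1])
  moreover have "op4 (tan_part G) (\<lambda>z. sg y *\<^sub>R second_ff0 G z) (Qf G) f y = op4 (tan_part G) (second_ff0 G) (Qf G) f y"
    by (rule op4_sign[OF R.S.metric tfree_second_ff0[OF R.metric] fs y1 sg_sq[OF y]])
  ultimately show ?thesis by simp
qed

end

section \<open>The Gauss equation and the conformal change of the Ricci tensor\<close>

text \<open>The Gauss equation and the transformation rule of \<open>Qf\<close> are tensor identities, so they may be checked at a point where the metric has the
  components of the identity matrix; there they are polynomial identities in the derivatives of
  the components.\<close>

lemma slice_normalize:
  assumes G': "metric_on Y G'" and y0: "y0 \<in> slice_of Y"
  obtains X \<phi> G where "slice_pullback X Y \<phi> G G'" "0 \<in> slice_of X" "slice_map \<phi> 0 = y0" "G (slice_emb 0) = mat 1"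
proof -
  define x0 where "x0 = slice_emb y0"
  have x0: "x0 \<in> Y" unfolding x0_def by (rule slice_ofD[OF y0])
  define g where "g = G' x0"
  have gs: "g $ 2 $ 1 = g $ 1 $ 2" "g $ 3 $ 1 = g $ 1 $ 3" "g $ 3 $ 2 = g $ 2 $ 3"
    unfolding g_def by (rule metric_sym[OF G' x0])+
  have g1: "g $ 1 $ 1 > 0"
    using metric_pos[OF G' x0, of "axis 1 1"] by (simp add: g_def[symmetric] inner_axis' matrix_vector_mult_basis column_def)
  \<comment> \<open>Gram-Schmidt on the first two coordinate vectors: \<open>m\<close> is the
    projection coefficient and \<open>e\<close> the squared length of the orthogonal
    remainder.\<close>
  define m where "m = g $ 1 $ 2 / g $ 1 $ 1"
  define e where "e = g $ 2 $ 2 - m * g $ 1 $ 2"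
  have m: "m * g $ 1 $ 1 = g $ 1 $ 2" using g1 by (simp add: m_def)
  have e: "e > 0"
  proof -
    define v where "v = (vector [- m, 1, 0] :: real^3)"
    have v: "v $ 1 = - m" "v $ 2 = 1" "v $ 3 = 0" by (simp_all add: v_def)
    have "v \<noteq> 0" using v(2) by auto
    then have "v \<bullet> (g *v v) > 0" unfolding g_def by (rule metric_pos[OF G' x0])
    moreover have "v \<bullet> (g *v v) = m * (m * g $ 1 $ 1) - 2 * m * g $ 1 $ 2 + g $ 2 $ 2"
      by (simp add: inner_vec_def matrix_vector_mult_def sum_3 v gs algebra_simps)
    ultimately show ?thesis by (simp add: m e_def algebra_simps)
  qed
  \<comment> \<open>\<open>p\<close> is the unit normal vector, that is, the unit conormal with its
    index raised.\<close>
  define r where "r = sqrt (ginv G' x0 $ 3 $ 3)"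
  have r: "r > 0" "r * r = ginv G' x0 $ 3 $ 3" using ginv_diag_pos[OF G' x0, of 3] by (simp_all add: r_def)
  define p where "p j = ginv G' x0 $ j $ 3 * inverse r" for j
  define \<alpha> where "\<alpha> = inverse (sqrt (g $ 1 $ 1))"
  define \<gamma> where "\<gamma> = inverse (sqrt e)"
  have \<alpha>: "\<alpha> * \<alpha> * g $ 1 $ 1 = 1" "\<alpha> > 0" using g1 by (simp_all add: \<alpha>_def field_simps)
  have \<gamma>: "\<gamma> * \<gamma> * e = 1" "\<gamma> > 0" using e by (simp_all add: \<gamma>_def field_simps)
  \<comment> \<open>The columns form an orthonormal frame whose first two vectors are tangent to the
    slice. The zeros in the third row keep the slice in place.\<close>
  define A where "A = (vector [vector [\<alpha>, - m * \<gamma>, p 1], vector [0, \<gamma>, p 2], vector [0, 0, p 3]] :: real^3^3)"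
  have A: "A $ 1 $ 1 = \<alpha>" "A $ 1 $ 2 = - m * \<gamma>" "A $ 1 $ 3 = p 1" "A $ 2 $ 1 = 0" "A $ 2 $ 2 = \<gamma>" "A $ 2 $ 3 = p 2"
    "A $ 3 $ 1 = 0" "A $ 3 $ 2 = 0" "A $ 3 $ 3 = p 3"
    by (simp_all add: A_def)
  have p3: "p 3 = r" using r by (simp add: p_def field_simps)
  \<comment> \<open>Lowering the index of the normal gives back the unit conormal, so the third
    column is orthogonal to the tangential ones.\<close>
  have gp: "g $ i $ 1 * p 1 + g $ i $ 2 * p 2 + g $ i $ 3 * p 3 = kd i 3 * inverse r" for i
  proof -
    have "(\<Sum>j\<in>UNIV. g $ i $ j * ginv G' x0 $ j $ 3) * inverse r = kd i 3 * inverse r"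
      unfolding g_def by (simp only: ginv_right[OF G' x0])
    then show ?thesis by (simp add: sum_3 p_def algebra_simps)
  qed
  define \<phi> where "\<phi> z = x0 + A *v z" for z
  have \<phi>n: "\<phi> z $ i = x0 $ i + (\<Sum>j\<in>UNIV. A $ i $ j * z $ j)" for z i
    by (simp add: \<phi>_def matrix_vector_mult_def)
  have pd\<phi>: "pd a (\<lambda>z. \<phi> z $ i) x = A $ i $ a" for a i x
  proof -
    have "pd a (\<lambda>z. x0 $ i + (\<Sum>j\<in>UNIV. A $ i $ j * z $ j)) x = (\<Sum>j\<in>UNIV. A $ i $ j * kd a j)"
      by simp
    then show ?thesis by (simp add: \<phi>n if_distrib[of "\<lambda>t. _ * t"] cong: if_cong)
  qed
  define X where "X = \<phi> -` Y"
  define G where "G z = (\<chi> a b. \<Sum>i\<in>UNIV. \<Sum>j\<in>UNIV. A $ i $ a * A $ j $ b * G' (\<phi> z) $ i $ j)" for z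
  have detA: "det A \<noteq> 0" using \<alpha>(2) \<gamma>(2) r(1) by (simp add: det_3 A p3)
  have "continuous_on UNIV \<phi>" unfolding \<phi>_def[abs_def]
    by (intro continuous_intros linear_continuous_on) (simp add: matrix_vector_mul_bounded_linear)
  then have Xo: "open X" unfolding X_def by (rule open_vimage[OF metric_open[OF G']])
  have \<phi>0: "\<phi> (slice_emb 0) = x0"
  proof -
    have "slice_emb 0 = 0" by (simp add: vec_eq_iff forall_3)
    then show ?thesis by (simp add: \<phi>_def)
  qed
  have "slice_pullback X Y \<phi> G G'"
  proof
    show "open X" by (rule Xo)
    show "smooth_on X (\<lambda>x. \<phi> x $ i)" for i unfolding \<phi>n by (intro smooth_intros Xo)
    show "x \<in> X \<Longrightarrow> \<phi> x \<in> Y" for x by (simp add: X_def)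
    show "det (\<chi> i a. pd a (\<lambda>z. \<phi> z $ i) x) \<noteq> 0" for x using detA by (simp add: pd\<phi>)
    show "metric_on Y G'" by (rule G')
    show "G x $ a $ b = (\<Sum>i\<in>UNIV. \<Sum>j\<in>UNIV. pd a (\<lambda>z. \<phi> z $ i) x * pd b (\<lambda>z. \<phi> z $ j) x * G' (\<phi> x) $ i $ j)" for x a b
      by (simp add: G_def pd\<phi>)
    show "\<phi> (slice_emb y) $ 3 = 0" for y by (simp add: \<phi>n sum_3 A x0_def)
  qed
  moreover have "0 \<in> slice_of X" by (simp add: slice_of_def X_def \<phi>0 x0)
  moreover have "slice_map \<phi> 0 = y0" by (simp add: slice_map_def \<phi>0 x0_def vec_eq_iff)
  moreover have "G (slice_emb 0) = mat 1"
  proof -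
    have Gab: "G (slice_emb 0) $ a $ b = (\<Sum>i\<in>UNIV. A $ i $ a * (\<Sum>j\<in>UNIV. g $ i $ j * A $ j $ b))" for a b
      by (simp add: G_def \<phi>0 g_def sum_distrib_left mult_ac)
    have gA1: "(\<Sum>j\<in>UNIV. g $ i $ j * A $ j $ 1) = g $ i $ 1 * \<alpha>" for i by (simp add: sum_3 A)
    have gA2: "(\<Sum>j\<in>UNIV. g $ i $ j * A $ j $ 2) = (g $ i $ 2 - m * g $ i $ 1) * \<gamma>" for i
      by (simp add: sum_3 A algebra_simps)
    have gA3: "(\<Sum>j\<in>UNIV. g $ i $ j * A $ j $ 3) = kd i 3 * inverse r" for i
      using gp[of i] by (simp add: sum_3 A)
    have n: "(1::3) \<noteq> 3" "(2::3) \<noteq> 3" "(1::3) \<noteq> 2" by simp_all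
    have m0: "g $ 1 $ 2 - m * g $ 1 $ 1 = 0" using m by simp
    have "G (slice_emb 0) $ 1 $ 1 = 1" using \<alpha>(1) by (simp add: Gab gA1 sum_3 A mult_ac)
    moreover have "G (slice_emb 0) $ 1 $ 2 = 0" by (simp add: Gab gA2 sum_3 A m0)
    moreover have "G (slice_emb 0) $ 2 $ 2 = 1"
      using \<gamma>(1) by (simp add: Gab gA2 sum_3 A m0 gs e_def mult_ac)
    moreover have "G (slice_emb 0) $ 1 $ 3 = 0" "G (slice_emb 0) $ 2 $ 3 = 0"
      by (simp_all add: Gab gA3 sum_3 A)
    moreover have "G (slice_emb 0) $ 3 $ 3 = 1" using r by (simp add: Gab gA3 sum_3 A p3)
    moreover have "G (slice_emb 0) $ a $ b = G (slice_emb 0) $ b $ a" for a b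
    proof -
      have "G (slice_emb 0) $ a $ b = (\<Sum>j\<in>UNIV. \<Sum>i\<in>UNIV. A $ i $ a * A $ j $ b * g $ i $ j)"
        unfolding G_def vec_lambda_beta \<phi>0 g_def[symmetric] by (rule sum.swap)
      also have "\<dots> = G (slice_emb 0) $ b $ a"
        unfolding G_def vec_lambda_beta \<phi>0 g_def[symmetric]
        by (intro sum.cong refl) (use metric_sym[OF G' x0] in \<open>simp add: g_def mult_ac\<close>)
      finally show ?thesis .
    qed
    from this[of 2 1] this[of 3 1] this[of 3 2] calculation
    show ?thesis by (simp add: vec_eq_iff forall_3 mat_def)
  qed
  ultimately show ?thesis by (rule that)
qed

text \<open>The Christoffel symbols, their derivatives and the Ricci tensor at a point where the metric is the
  identity matrix, in terms
  of the derivatives of the metric, \<open>d i j k\<close> being \<open>pd k\<close> of the component \<open>i j\<close>, and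
  \<open>dd i j k l\<close> being \<open>pd l\<close> of that.\<close>

definition gam1 :: "('n::finite \<Rightarrow> 'n \<Rightarrow> 'n \<Rightarrow> real) \<Rightarrow> 'n \<Rightarrow> 'n \<Rightarrow> 'n \<Rightarrow> real" where
  "gam1 d k i j = (1/2) * (d k j i + d k i j - d i j k)"

definition pgam1 :: "('n::finite \<Rightarrow> 'n \<Rightarrow> 'n \<Rightarrow> real) \<Rightarrow> ('n \<Rightarrow> 'n \<Rightarrow> 'n \<Rightarrow> 'n \<Rightarrow> real) \<Rightarrow> 'n \<Rightarrow> 'n \<Rightarrow> 'n \<Rightarrow> 'n \<Rightarrow> real" where
  "pgam1 d dd e k i j = (1/2) * (dd k j i e + dd k i j e - dd i j k e) - (\<Sum>l\<in>UNIV. d k l e * gam1 d l i j)"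

definition ric1 :: "('n::finite \<Rightarrow> 'n \<Rightarrow> 'n \<Rightarrow> real) \<Rightarrow> ('n \<Rightarrow> 'n \<Rightarrow> 'n \<Rightarrow> 'n \<Rightarrow> real) \<Rightarrow> 'n \<Rightarrow> 'n \<Rightarrow> real" where
  "ric1 d dd i j = (\<Sum>k\<in>UNIV. pgam1 d dd k k i j) - (\<Sum>k\<in>UNIV. pgam1 d dd j k i k)
     + (\<Sum>k\<in>UNIV. \<Sum>l\<in>UNIV. gam1 d k k l * gam1 d l i j) - (\<Sum>k\<in>UNIV. \<Sum>l\<in>UNIV. gam1 d k j l * gam1 d l i k)"

definition jet1 :: "'n::finite tensor2_field \<Rightarrow> real^'n \<Rightarrow> 'n \<Rightarrow> 'n \<Rightarrow> 'n \<Rightarrow> real" where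
  "jet1 G x a b c = pd c (\<lambda>z. G z $ a $ b) x"

definition jet2 :: "'n::finite tensor2_field \<Rightarrow> real^'n \<Rightarrow> 'n \<Rightarrow> 'n \<Rightarrow> 'n \<Rightarrow> 'n \<Rightarrow> real" where
  "jet2 G x a b c e = pd e (\<lambda>z. pd c (\<lambda>z. G z $ a $ b) z) x"

context
  fixes X :: "(real^'n::finite) set" and G :: "'n tensor2_field" and x
  assumes G: "metric_on X G" and x: "x \<in> X" and G1: "G x = mat 1"

begin

lemma christoffel_at_1: "christoffel G x k i j = gam1 (jet1 G x) k i j"
proof -
  have "christoffel G x k i j = (\<Sum>l\<in>UNIV. kd k l * christ1 G x l i j)"
    unfolding christoffel_christ1 pd_ginv_at_1(1)[OF G x G1] by (simp add: mat_def)
  then show ?thesis by (simp only: sum_kd_left christ1_def gam1_def jet1_def)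
qed

lemma pd_christoffel_at_1: "pd e (\<lambda>z. christoffel G z k i j) x = pgam1 (jet1 G x) (jet2 G x) e k i j"
proof -
  have s: "smooth_on X (\<lambda>z. christ1 G z l i j)" for l
    unfolding christ1_def by (intro smooth_intros metric_open[OF G] metric_smooth[OF G])
  have "pd e (\<lambda>z. christoffel G z k i j) x = (\<Sum>l\<in>UNIV. - jet1 G x k l e * christ1 G x l i j) + (\<Sum>l\<in>UNIV. kd k l * pd e (\<lambda>z. christ1 G z l i j) x)"
    unfolding christoffel_christ1
    by (simp add: ginv_diff[OF G x] smooth_on_diff[OF s x] pd_ginv_at_1[OF G x G1] jet1_def mat_def sum.distrib sum_subtractf sum_negf)
  also have "(\<Sum>l\<in>UNIV. kd k l * pd e (\<lambda>z. christ1 G z l i j) x) = pd e (\<lambda>z. christ1 G z k i j) x"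
    by (simp only: sum_kd_left)
  also have "\<dots> = (1/2) * (jet2 G x k j i e + jet2 G x k i j e - jet2 G x i j k e)"
    unfolding christ1_def jet2_def by (subst pd_mult) (simp_all add: smooth_on_diff[OF smooth_on_pd[OF metric_smooth[OF G]] x])
  finally show ?thesis by (simp add: pgam1_def christ1_def gam1_def jet1_def sum_negf)
qed

lemma ricci_at_1: "ricci G x $ i $ j = ric1 (jet1 G x) (jet2 G x) i j"
  unfolding ricci_def ric1_def vec_lambda_beta pd_christoffel_at_1 christoffel_at_1 ..

lemma jet_sym: "jet1 G x a b c = jet1 G x b a c" "jet2 G x a b c e = jet2 G x b a c e" "jet2 G x a b c e = jet2 G x a b e c"
proof -
  show "jet1 G x a b c = jet1 G x b a c" unfolding jet1_def by (rule pd_metric_sym[OF G x])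
  show "jet2 G x a b c e = jet2 G x b a c e" unfolding jet2_def
    by (rule pd_cong_open[OF metric_open[OF G] x]) (rule pd_metric_sym[OF G])
  show "jet2 G x a b c e = jet2 G x a b e c" unfolding jet2_def by (rule pd_commute[OF metric_smooth[OF G] x])
qed

end

section \<open>The Gauss equation\<close>

text \<open>In an orthonormal frame \<open>Ric11 + Ric22 - Ric33\<close> is twice the sectional
  curvature of the tangent plane, and \<open>- gam1 d 3 i j\<close> is the second fundamental form.
  The identity is thus the Gauss equation for the scalar curvature, as an identity in arbitrary jets
  with the symmetries of a metric.\<close>

lemma gauss_polynomial:
  fixes d :: "3 \<Rightarrow> 3 \<Rightarrow> 3 \<Rightarrow> real" and dd :: "3 \<Rightarrow> 3 \<Rightarrow> 3 \<Rightarrow> 3 \<Rightarrow> real"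
  assumes "\<And>a b c. d a b c = d b a c" "\<And>a b c e. dd a b c e = dd b a c e" "\<And>a b c e. dd a b c e = dd a b e c"
  shows "ric1 d dd 1 1 + ric1 d dd 2 2 - ric1 d dd 3 3 + 2 * (gam1 d 3 1 1 * gam1 d 3 2 2 - gam1 d 3 1 2 * gam1 d 3 1 2)
     = ric1 (\<lambda>a b c. d (tan_ix a) (tan_ix b) (tan_ix c)) (\<lambda>a b c e. dd (tan_ix a) (tan_ix b) (tan_ix c) (tan_ix e)) 1 1
     + ric1 (\<lambda>a b c. d (tan_ix a) (tan_ix b) (tan_ix c)) (\<lambda>a b c e. dd (tan_ix a) (tan_ix b) (tan_ix c) (tan_ix e)) 2 2"
proof -
  note s = assms(1)[of 2 1] assms(1)[of 3 1] assms(1)[of 3 2] assms(2)[of 2 1] assms(2)[of 3 1] assms(2)[of 3 2]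
    assms(3)[of _ _ 2 1] assms(3)[of _ _ 3 1] assms(3)[of _ _ 3 2]
  show ?thesis
    unfolding ric1_def pgam1_def gam1_def sum_3 sum_2 tan_ix_simps s by (simp add: algebra_simps)
qed

lemma ip2_tf_at_1:
  assumes "h y = mat 1" "T y $ 2 $ 1 = T y $ 1 $ 2"
  shows "ip2 h (tf h T) (tf h T) y = 1/2 * (T y $ 1 $ 1 - T y $ 2 $ 2)\<^sup>2 + 2 * (T y $ 1 $ 2)\<^sup>2"
proof -
  have g: "ginv h y = mat 1" unfolding ginv_def by (rule matrix_inv_unique) (simp_all add: assms(1))
  show ?thesis
    unfolding ip2_def tf_def tr2_def sum_2 g assms(1)
    by (simp add: mat_def assms(2) field_simps power2_eq_square)
qed

lemma tr2_at_1: "G y = mat 1 \<Longrightarrow> tr2 G T y = (\<Sum>i\<in>UNIV. T y $ i $ i)"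
proof -
  assume 1: "G y = mat 1"
  have g: "ginv G y = mat 1" unfolding ginv_def by (rule matrix_inv_unique) (simp_all add: 1)
  show ?thesis unfolding tr2_def g by (simp add: mat_def if_distrib[of "\<lambda>t. t * _"] cong: if_cong)
qed

text \<open>The Gauss equation contains the determinant of the second fundamental form, which equals
  \<open>H^2 - K/2\<close>. The mean curvature then cancels against the \<open>H^2\<close> in
  \<open>calJ_eq\<close>.\<close>

lemma gauss_at_1:
  fixes G :: "3 tensor2_field"
  assumes G: "metric_on X G" and y: "y \<in> slice_of X" and G1: "G (slice_emb y) = mat 1"
  shows "calJ G y = 1/2 * tr2 (tan_part G) (ricci (tan_part G)) y - 1/2 * K_inv G y"
proof -
  let ?x = "slice_emb y" and ?h = "tan_part G"
  note x = slice_ofD[OF y] and h = metric_tan_part[OF G]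
  have h1: "?h y = mat 1" by (simp add: vec_eq_iff forall_2 tan_part_nth G1 mat_def)
  have j1: "jet1 ?h z a b c = jet1 G (slice_emb z) (tan_ix a) (tan_ix b) (tan_ix c)" if "z \<in> slice_of X" for z a b c
    unfolding jet1_def tan_part_nth by (rule pd_slice(1)[OF metric_diff[OF G slice_ofD[OF that]]])
  have j2: "jet2 ?h y a b c e = jet2 G ?x (tan_ix a) (tan_ix b) (tan_ix c) (tan_ix e)" for a b c e
  proof -
    have "jet2 ?h y a b c e = pd e (\<lambda>z. pd (tan_ix c) (\<lambda>z. G z $ tan_ix a $ tan_ix b) (slice_emb z)) y"
      unfolding jet2_def by (rule pd_cong_open[OF metric_open[OF h] y]) (use j1 in \<open>simp add: jet1_def\<close>)
    then show ?thesis unfolding jet2_def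
      by (simp only: pd_slice(1)[OF smooth_on_diff[OF smooth_on_pd[OF metric_smooth[OF G]] x]])
  qed
  have R2: "tr2 ?h (ricci ?h) y = ric1 (\<lambda>a b c. jet1 G ?x (tan_ix a) (tan_ix b) (tan_ix c)) (\<lambda>a b c e. jet2 G ?x (tan_ix a) (tan_ix b) (tan_ix c) (tan_ix e)) 1 1
     + ric1 (\<lambda>a b c. jet1 G ?x (tan_ix a) (tan_ix b) (tan_ix c)) (\<lambda>a b c e. jet2 G ?x (tan_ix a) (tan_ix b) (tan_ix c) (tan_ix e)) 2 2"
  proof -
    have e: "jet1 ?h y = (\<lambda>a b c. jet1 G ?x (tan_ix a) (tan_ix b) (tan_ix c))"
      "jet2 ?h y = (\<lambda>a b c e. jet2 G ?x (tan_ix a) (tan_ix b) (tan_ix c) (tan_ix e))"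
      by (intro ext, simp only: j1[OF y] j2)+
    show ?thesis unfolding tr2_at_1[of ?h y, OF h1] ricci_at_1[OF h y h1] e sum_2 ..
  qed
  let ?b = "\<lambda>i j. gam1 (jet1 G ?x) 3 i j"
  have II: "second_ff G y $ a $ b = - ?b (tan_ix a) (tan_ix b)" for a b
    unfolding second_ff_eq[OF G x] christoffel_at_1[OF G x G1] pd_ginv_at_1(1)[OF G x G1] by (simp add: mat_def)
  have b21: "?b 2 1 = ?b 1 2" using christoffel_sym[OF G x, of 3 2 1] unfolding christoffel_at_1[OF G x G1] .
  have H: "mean_curv G y = - 1/2 * (?b 1 1 + ?b 2 2)"
    unfolding mean_curv_def tr2_at_1[of ?h y, OF h1] by (simp add: sum_2 II field_simps)
  have K: "K_inv G y = 1/2 * (?b 1 1 - ?b 2 2)\<^sup>2 + 2 * (?b 1 2)\<^sup>2"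
  proof -
    have "K_inv G y = ip2 ?h (tf ?h (second_ff G)) (tf ?h (second_ff G)) y"
      unfolding K_inv_ip2[OF G] by (rule ip2_cong) (simp_all add: second_ff0_tf[OF G])
    then show ?thesis
      by (simp only: ip2_tf_at_1[of ?h y, OF h1] II b21 tan_ix_simps) (simp add: II b21 power2_eq_square algebra_simps)
  qed
  have "ric1 (jet1 G ?x) (jet2 G ?x) 1 1 + ric1 (jet1 G ?x) (jet2 G ?x) 2 2 - ric1 (jet1 G ?x) (jet2 G ?x) 3 3
     + 2 * (?b 1 1 * ?b 2 2 - ?b 1 2 * ?b 1 2) = tr2 ?h (ricci ?h) y"
    unfolding R2 by (rule gauss_polynomial; rule jet_sym[OF G x G1])
  then show ?thesis
    unfolding calJ_eq[OF G y] tr2_at_1[of ?h y, OF h1] tr2_at_1[of G ?x, OF G1] H K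
    by (simp add: sum_2 sum_3 tan_part_nth ricci_at_1[OF G x G1] power2_eq_square field_simps)
qed

lemma gauss:
  fixes G :: "3 tensor2_field"
  assumes G: "metric_on X G" and y: "y \<in> slice_of X"
  shows "calJ G y = 1/2 * tr2 (tan_part G) (ricci (tan_part G)) y - 1/2 * K_inv G y"
proof -
  obtain X0 \<phi> G0 where P: "slice_pullback X0 X \<phi> G0 G" and 0: "0 \<in> slice_of X0" "slice_map \<phi> 0 = y" "G0 (slice_emb 0) = mat 1"
    by (rule slice_normalize[OF G y])
  interpret slice_pullback X0 X \<phi> G0 G by (rule P)
  have "calJ G y = calJ G0 0" using calJ_pull[OF 0(1)] 0(2) by simp
  also have "\<dots> = 1/2 * tr2 (tan_part G0) (ricci (tan_part G0)) 0 - 1/2 * K_inv G0 0"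
    by (rule gauss_at_1[OF metric 0(1,3)])
  also have "tr2 (tan_part G0) (ricci (tan_part G0)) 0 = tr2 (tan_part G) (ricci (tan_part G)) y"
    using S.pb_tr2[OF S.pb2_ricci 0(1)] 0(2) by simp
  also have "K_inv G0 0 = K_inv G y" using K_inv_pull[OF 0(1)] 0(2) by simp
  finally show ?thesis .
qed

lemma sqlap_coord_op4:
  assumes G: "metric_on X G" and y: "y \<in> slice_of X" and f: "smooth_on (slice_of X) f"
  shows "sqlap_coord G f y = op4 (tan_part G) (second_ff0 G) (Qf G) f y"
proof -
  have "sqlap_coord G f y = lap (tan_part G) (lap (tan_part G) f) y + 4 * div1 (tan_part G) (apply2 (tan_part G) (calP G) (grad1 f)) y
    + (2 * div1 (tan_part G) (div2 (tan_part G) (calP G)) y - lap (tan_part G) (calJ G) y + 2 * norm2_sq (tan_part G) (calP G) y - (calJ G y)\<^sup>2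
      + 2 * div1 (tan_part G) (apply2 (tan_part G) (second_ff0 G) (div2 (tan_part G) (second_ff0 G))) y
      + 2 * norm1_sq (tan_part G) (div2 (tan_part G) (second_ff0 G)) y + 1/4 * (ip2 (tan_part G) (second_ff0 G) (second_ff0 G) y)\<^sup>2) * f y"
    unfolding sqlap_coord_def Let_def K_inv_ip2[OF G] ..
  also have "\<dots> = op4 (tan_part G) (second_ff0 G) (Qf G) f y"
    by (rule op4_expand[OF metric_tan_part[OF G] tfree_second_ff0[OF G] tfree_Qf[OF G] f y])
       (simp_all add: calP_eq[OF G] gauss[OF G] K_inv_ip2[OF G])
  finally show ?thesis .
qed

section \<open>Conformal change of the Ricci tensor, the second fundamental form and
  \<open>Qf\<close>\<close>

text \<open>The classical rule \<open>Ric - (d - 2) (\<nabla>u - u \<otimes> u) - (\<nabla>\<cdot>u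
  + (d - 2) |u|^2) g\<close> for \<open>d = 3\<close>, in components at a point where the metric is
  the identity. \<open>g\<close> and \<open>p\<close> stand for the Christoffel symbols and their
  derivatives, \<open>v\<close> for the derivatives of \<open>u\<close>; \<open>gh\<close> and
  \<open>ph\<close> belong to the rescaled metric.\<close>

lemma conformal_ricci_polynomial:
  fixes g :: "3 \<Rightarrow> 3 \<Rightarrow> 3 \<Rightarrow> real" and p :: "3 \<Rightarrow> 3 \<Rightarrow> 3 \<Rightarrow> 3 \<Rightarrow> real" and u :: "3 \<Rightarrow> real" and v :: "3 \<Rightarrow> 3 \<Rightarrow> real"
  assumes g: "\<And>k i j. g k i j = g k j i" and v: "\<And>i j. v i j = v j i"
    and gh: "\<And>k i j. gh k i j = g k i j + kd k j * u i + kd k i * u j - kd i j * u k"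
    and ph: "\<And>e k i j. ph e k i j = p e k i j + kd k j * v e i + kd k i * v e j
      - ((g j e i + g i e j) * u k + kd i j * (v e k - (\<Sum>l\<in>UNIV. (g l e k + g k e l) * u l)))"
    and R: "\<And>g p i j. R g p i j = (\<Sum>k\<in>UNIV. p k k i j) - (\<Sum>k\<in>UNIV. p j k i k)
     + (\<Sum>k\<in>UNIV. \<Sum>l\<in>UNIV. g k k l * g l i j) - (\<Sum>k\<in>UNIV. \<Sum>l\<in>UNIV. g k j l * g l i k :: real)"
  shows "R gh ph (tan_ix a) (tan_ix b) = R g p (tan_ix a) (tan_ix b)
     - (v (tan_ix a) (tan_ix b) - (\<Sum>k\<in>UNIV. g k (tan_ix a) (tan_ix b) * u k)) + u (tan_ix a) * u (tan_ix b)
     - kd a b * ((\<Sum>k\<in>UNIV. v k k - (\<Sum>l\<in>UNIV. g l k k * u l)) + (\<Sum>k\<in>UNIV. u k * u k))"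
proof -
  note s = g[of _ 2 1] g[of _ 3 1] g[of _ 3 2] v[of 2 1] v[of 3 1] v[of 3 2]
  have n: "(1::3) \<noteq> 2" "(1::3) \<noteq> 3" "(2::3) \<noteq> 1" "(2::3) \<noteq> 3" "(3::3) \<noteq> 1" "(3::3) \<noteq> 2" "(1::2) \<noteq> 2" "(2::2) \<noteq> 1"
    by simp_all
  show ?thesis
    using exhaust_2[of a] exhaust_2[of b]
    by (elim disjE; hypsubst; simp only: R gh ph sum_3 tan_ix_simps n refl if_True if_False simp_thms s mult_zero_left mult_1 add_0_right diff_0_right;
        simp add: algebra_simps)
qed

text \<open>Invertibility of the Jacobian lets a tensor identity proved at the normalised point be
  carried to the original one.\<close>

lemma (in pullback) pb2_zero:
  assumes T: "pb2 T T'" and x: "x \<in> X" and 0: "T x = 0"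
  shows "T' (\<phi> x) = 0"
proof -
  have 1: "(\<Sum>i\<in>UNIV. D x i a * (\<Sum>j\<in>UNIV. D x j b * T' (\<phi> x) $ i $ j)) = 0" for a b
  proof -
    have "T x $ a $ b = (\<Sum>i\<in>UNIV. D x i a * (\<Sum>j\<in>UNIV. D x j b * T' (\<phi> x) $ i $ j))"
      using T x by (simp add: pb2_def sum_distrib_left mult.assoc)
    then show ?thesis by (simp add: 0)
  qed
  have inv: "u i = 0" if "\<And>a. (\<Sum>i\<in>UNIV. D x i a * u i) = 0" for u i
  proof -
    have "(\<Sum>a\<in>UNIV. B x $ a $ i * (\<Sum>j\<in>UNIV. D x j a * u j)) = (\<Sum>j\<in>UNIV. (\<Sum>a\<in>UNIV. D x j a * B x $ a $ i) * u j)"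
      unfolding sum_distrib_left sum_distrib_right by (subst sum.swap) (simp only: mult_ac)
    also have "\<dots> = (\<Sum>j\<in>UNIV. u j * kd j i)" by (simp only: DB[OF x] mult.commute)
    also have "\<dots> = u i" by (rule sum_kd_right)
    finally show ?thesis using that by simp
  qed
  have "(\<Sum>j\<in>UNIV. D x j b * T' (\<phi> x) $ i $ j) = 0" for i b
    by (rule inv) (rule 1)
  then have "T' (\<phi> x) $ i $ j = 0" for i j
    by (rule inv)
  then show ?thesis by (simp add: vec_eq_iff)
qed

lemma (in pullback) pb1_dlog:
  assumes \<omega>: "smooth_on Y \<omega>"
  shows "pb1 (dlog (\<lambda>x. \<omega> (\<phi> x))) (dlog \<omega>)"
proof -
  have "pb1 (grad1 (\<lambda>x. \<omega> (\<phi> x))) (grad1 \<omega>)" by (rule pb1_grad1[OF _ \<omega>]) simp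
  then show ?thesis unfolding pb1_def grad1_def dlog_def vec_lambda_beta
    by (simp add: sum_divide_distrib)
qed

lemma (in pullback) pb2_outer:
  assumes "pb1 v v'" "pb1 w w'"
  shows "pb2 (\<lambda>z. \<chi> a b. v z $ a * w z $ b) (\<lambda>z. \<chi> a b. v' z $ a * w' z $ b)"
  using assms unfolding pb1_def pb2_def by (simp add: sum_product mult_ac)

lemma (in pullback2) pb2_tf:
  assumes T: "pb2 T T'"
  shows "pb2 (tf h T) (tf h' T')"
proof -
  have tr: "- (1/2) * tr2 h T x = - (1/2) * tr2 h' T' (\<phi> x)" if "x \<in> X" for x
    using pb_tr2[OF T that] by simp
  have "pb2 (\<lambda>x. T x + (- (1/2) * tr2 h T x) *\<^sub>R h x) (\<lambda>x. T' x + (- (1/2) * tr2 h' T' x) *\<^sub>R h' x)"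
    by (intro pb2_smult_diff T pb2_metric tr)
  then show ?thesis unfolding pb2_def by (simp add: tf_def)
qed

locale conformal3 = conformal X G \<omega> for X :: "(real^3) set" and G :: "3 tensor2_field" and \<omega>

begin

abbreviation "V \<equiv> slice_of X"

abbreviation "h \<equiv> tan_part G"

abbreviation "w \<equiv> \<lambda>y. \<omega> (slice_emb y)"

text \<open>The component of \<open>u\<close> along the unit normal, that is, the normal derivative
  of \<open>ln \<omega>\<close>.\<close>

abbreviation "un \<equiv> \<lambda>y. (\<Sum>l\<in>UNIV. ginv G (slice_emb y) $ 3 $ l * u (slice_emb y) $ l) * inverse (sqrt (ginv G (slice_emb y) $ 3 $ 3))"

lemma tan_part_cmetric: "tan_part (cmetric \<omega> G) = cmetric w h"
  by (intro ext) (simp add: vec_eq_iff tan_part_nth cmetric_def)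

lemma ws: "smooth_on V w" by (rule smooth_slice[OF \<omega>])

sublocale C2: conformal2 V h w
  by (unfold_locales) (rule metric_tan_part[OF G], rule ws, rule pos, rule slice_ofD)

lemma dlog_w: "y \<in> V \<Longrightarrow> dlog w y $ a = u (slice_emb y) $ tan_ix a"
  using pd_slice(1)[OF \<omega>_diff[OF slice_ofD]] by (simp add: dlog_def)

text \<open>For tangential lower indices the symbol with upper index 3 changes only through the
  metric term of \<open>christoffel_cmetric\<close>. Hence the second fundamental form changes, up
  to scale, by a pure trace.\<close>

lemma second_ff_cmetric:
  assumes y: "y \<in> V"
  shows "second_ff (cmetric \<omega> G) y $ a $ b = w y * (second_ff G y $ a $ b + un y * h y $ a $ b)"
proof -
  note x = slice_ofD[OF y]
  have t: "tan_ix a \<noteq> 3" "tan_ix b \<noteq> 3" using exhaust_2[of a] exhaust_2[of b] by auto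
  have "sqrt (ginv (cmetric \<omega> G) (slice_emb y) $ 3 $ 3) = inverse (w y) * sqrt (ginv G (slice_emb y) $ 3 $ 3)"
    unfolding ginv_cmetric[OF x] using pos[OF x] by (simp add: real_sqrt_mult power_inverse[symmetric])
  then show ?thesis
    unfolding second_ff_eq[OF metric_cmetric x] second_ff_eq[OF G x] christoffel_cmetric[OF x]
    using t not_sym[OF t(1)] not_sym[OF t(2)] by (simp add: tan_part_nth algebra_simps)
qed

lemma second_ff0_cmetric:
  assumes y: "y \<in> V"
  shows "second_ff0 (cmetric \<omega> G) y = w y *\<^sub>R second_ff0 G y"
proof -
  have e: "second_ff (cmetric \<omega> G) y = (w y *\<^sub>R second_ff G y + (w y * un y) *\<^sub>R h y)"
    by (simp add: vec_eq_iff second_ff_cmetric[OF y] algebra_simps)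
  have "tr2 h (second_ff (cmetric \<omega> G)) y = tr2 h (\<lambda>z. w y *\<^sub>R second_ff G z + (w y * un y) *\<^sub>R h z) y"
    by (rule tr2_cong) (simp_all add: e)
  also have "\<dots> = w y * tr2 h (second_ff G) y + (w y * un y) * tr2 h h y"
    unfolding tr2_def sum_2 vector_add_component vector_scaleR_component real_scaleR_def by algebra
  finally have t: "tr2 h (second_ff (cmetric \<omega> G)) y = w y * tr2 h (second_ff G) y + 2 * (w y * un y)"
    by (simp add: tr2_metric[OF C2.G y])
  have "second_ff0 (cmetric \<omega> G) y = tf h (second_ff (cmetric \<omega> G)) y"
    unfolding second_ff0_tf[OF metric_cmetric] tan_part_cmetric by (rule C2.tf_cmetric[OF y])
  then show ?thesis
    unfolding second_ff0_tf[OF G] tf_def t unfolding e by (simp add: vec_eq_iff algebra_simps)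
qed

text \<open>Stated for the product with \<open>w\<close>, because in \<open>Qf\<close> the mean
  curvature stands next to \<open>second_ff0\<close>, which brings in this factor.\<close>

lemma mean_curv_cmetric:
  assumes y: "y \<in> V"
  shows "mean_curv (cmetric \<omega> G) y * w y = mean_curv G y + un y"
proof -
  have e: "second_ff (cmetric \<omega> G) y = (w y *\<^sub>R second_ff G y + (w y * un y) *\<^sub>R h y)"
    by (simp add: vec_eq_iff second_ff_cmetric[OF y] algebra_simps)
  have "tr2 h (second_ff (cmetric \<omega> G)) y = tr2 h (\<lambda>z. w y *\<^sub>R second_ff G z + (w y * un y) *\<^sub>R h z) y"
    by (rule tr2_cong) (simp_all add: e)
  also have "\<dots> = w y * tr2 h (second_ff G) y + (w y * un y) * tr2 h h y"
    unfolding tr2_def sum_2 vector_add_component vector_scaleR_component real_scaleR_def by algebra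
  finally have t: "tr2 h (second_ff (cmetric \<omega> G)) y = w y * tr2 h (second_ff G) y + 2 * (w y * un y)"
    by (simp add: tr2_metric[OF C2.G y])
  show ?thesis
    unfolding mean_curv_def tan_part_cmetric C2.tr2_cmetric[OF y] t using C2.\<omega>0[OF y] by (simp add: field_simps)
qed

text \<open>The ambient Hessian of \<open>ln \<omega>\<close>, restricted to the surface, is the
  surface Hessian plus \<open>un\<close> times the second fundamental form. The trace-free part of
  this excess cancels against the change of \<open>H L\<close>, so only intrinsic terms in
  \<open>dlog w\<close> remain.\<close>

lemma Qf_cmetric_at_1:
  assumes y: "y \<in> V" and G1: "G (slice_emb y) = mat 1"
  shows "Qf (cmetric \<omega> G) y = Qf G y - tf h (cov1 h (dlog w)) y + tf h (\<lambda>z. \<chi> a b. dlog w z $ a * dlog w z $ b) y"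
proof -
  let ?x = "slice_emb y"
  note x = slice_ofD[OF y]
  have h1: "h y = mat 1" by (simp add: vec_eq_iff forall_2 tan_part_nth G1 mat_def)
  define g where "g k i j = christoffel G ?x k i j" for k i j
  define p where "p e k i j = pd e (\<lambda>z. christoffel G z k i j) ?x" for e k i j
  define v where "v e i = pd e (\<lambda>z. u z $ i) ?x" for e i
  define gh where "gh k i j = christoffel (cmetric \<omega> G) ?x k i j" for k i j
  define ph where "ph e k i j = pd e (\<lambda>z. christoffel (cmetric \<omega> G) z k i j) ?x" for e k i j
  have g: "g k i j = g k j i" for k i j unfolding g_def by (rule christoffel_sym[OF G x])
  \<comment> \<open>\<open>u\<close> is the differential of \<open>ln \<omega>\<close>, so its
    derivative is symmetric.\<close>
  have v: "v i j = v j i" for i j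
  proof -
    have "v i j = (\<omega> ?x * pd i (\<lambda>z. pd j \<omega> z) ?x - pd i \<omega> ?x * pd j \<omega> ?x) * inverse (\<omega> ?x * \<omega> ?x)" for i j
    proof -
      have "v i j = pd i (\<lambda>z. pd j \<omega> z * inverse (\<omega> z)) ?x"
        by (simp add: v_def dlog_def divide_inverse)
      also have "\<dots> = pd i (\<lambda>z. pd j \<omega> z) ?x * inverse (\<omega> ?x) + pd j \<omega> ?x * (- (inverse (\<omega> ?x) * inverse (\<omega> ?x)) * pd i \<omega> ?x)"
        using \<omega>_diff[OF x] smooth_on_diff[OF smooth_on_pd[OF \<omega>] x] \<omega>0[OF x] by simp
      finally show ?thesis using \<omega>0[OF x] by (simp add: field_simps)
    qed
    then show ?thesis using pd_commute[OF \<omega> x, of i j] by (simp add: mult.commute)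
  qed
  have gi: "ginv G ?x $ i $ j = kd i j" for i j
    unfolding pd_ginv_at_1(1)[OF G x G1] by (simp add: mat_def)
  have Gx: "G ?x $ i $ j = kd i j" for i j by (simp add: G1 mat_def)
  have dG: "pd e (\<lambda>z. G z $ i $ j) ?x = g j e i + g i e j" for e i j
    unfolding metric_compat[OF G x] Gx g_def by (simp only: sum_kd_left)
  have gh: "gh k i j = g k i j + kd k j * u ?x $ i + kd k i * u ?x $ j - kd i j * u ?x $ k" for k i j
    unfolding gh_def g_def christoffel_cmetric[OF x] gi Gx by (simp only: sum_kd_left)
  \<comment> \<open>The derivative of \<open>christoffel_cmetric\<close>:
    \<open>g j e i + g i e j\<close> is the derivative of the metric, and the bracket behind
    \<open>kd i j\<close> that of \<open>u\<close> with its index raised.\<close>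
  have ph: "ph e k i j = p e k i j + kd k j * v e i + kd k i * v e j
      - ((g j e i + g i e j) * u ?x $ k + kd i j * (v e k - (\<Sum>l\<in>UNIV. (g l e k + g k e l) * u ?x $ l)))" for e k i j
  proof -
    have du: "(\<lambda>z. u z $ l) differentiable (at ?x)" for l by (rule sm1_diff[OF sm1_u x])
    have dS: "(\<lambda>z. \<Sum>l\<in>UNIV. ginv G z $ k $ l * u z $ l) differentiable (at ?x)"
      by (simp add: ginv_diff[OF G x] du)
    have pS: "pd e (\<lambda>z. \<Sum>l\<in>UNIV. ginv G z $ k $ l * u z $ l) ?x = v e k - (\<Sum>l\<in>UNIV. (g l e k + g k e l) * u ?x $ l)"
    proof -
      have "pd e (\<lambda>z. \<Sum>l\<in>UNIV. ginv G z $ k $ l * u z $ l) ?x = (\<Sum>l\<in>UNIV. - ((g l e k + g k e l) * u ?x $ l) + kd k l * v e l)"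
        by (simp add: ginv_diff[OF G x] du pd_ginv_at_1(2)[OF G x G1] dG gi v_def, intro sum.cong refl, simp add: algebra_simps)
      then show ?thesis by (simp only: sum.distrib sum_negf sum_kd_left, simp?)
    qed
    have "ph e k i j = pd e (\<lambda>z. christoffel G z k i j + kd k j * u z $ i + kd k i * u z $ j
       - G z $ i $ j * (\<Sum>l\<in>UNIV. ginv G z $ k $ l * u z $ l)) ?x"
      unfolding ph_def by (rule pd_cong_open[OF metric_open[OF G] x]) (rule christoffel_cmetric)
    also have "\<dots> = p e k i j + kd k j * v e i + kd k i * v e j - ((g j e i + g i e j) * (\<Sum>l\<in>UNIV. ginv G ?x $ k $ l * u ?x $ l)
       + kd i j * (v e k - (\<Sum>l\<in>UNIV. (g l e k + g k e l) * u ?x $ l)))"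
      by (simp add: christoffel_diff[OF G x] metric_diff[OF G x] du dS pS dG Gx p_def v_def)
    finally show ?thesis by (simp only: gi sum_kd_left)
  qed
  define R where "R g p i j = (\<Sum>k\<in>UNIV. p k k i j) - (\<Sum>k\<in>UNIV. p j k i k)
     + (\<Sum>k\<in>UNIV. \<Sum>l\<in>UNIV. g k k l * g l i j) - (\<Sum>k\<in>UNIV. \<Sum>l\<in>UNIV. g k j l * g l i k :: real)"
    for g :: "3 \<Rightarrow> 3 \<Rightarrow> 3 \<Rightarrow> real" and p :: "3 \<Rightarrow> 3 \<Rightarrow> 3 \<Rightarrow> 3 \<Rightarrow> real" and i j
  define c where "c = (\<Sum>k\<in>UNIV. v k k - (\<Sum>l\<in>UNIV. g l k k * u ?x $ l)) + (\<Sum>k\<in>UNIV. u ?x $ k * u ?x $ k)"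
  have ric: "ricci (cmetric \<omega> G) ?x $ i $ j = R gh ph i j" "ricci G ?x $ i $ j = R g p i j" for i j
    by (simp_all add: ricci_def R_def g_def p_def gh_def ph_def)
  have II: "second_ff G y $ a $ b = - g 3 (tan_ix a) (tan_ix b)" for a b
    unfolding second_ff_eq[OF G x] gi g_def by simp
  have un: "un y = u ?x $ 3" unfolding gi by (simp only: sum_kd_left, simp?)
  have gam: "christoffel h y k a b = g (tan_ix k) (tan_ix a) (tan_ix b)" for k a b
  proof -
    have "jet1 h y a b c = jet1 G ?x (tan_ix a) (tan_ix b) (tan_ix c)" for a b c
      unfolding jet1_def tan_part_nth by (rule pd_slice(1)[OF metric_diff[OF G x]])
    then show ?thesis
      unfolding christoffel_at_1[OF C2.G y h1] g_def christoffel_at_1[OF G x G1] gam1_def by simp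
  qed
  have cv: "cov1 h (dlog w) y $ a $ b = v (tan_ix a) (tan_ix b) - (\<Sum>k\<in>UNIV. g (tan_ix k) (tan_ix a) (tan_ix b) * u ?x $ tan_ix k)" for a b
  proof -
    have "pd a (\<lambda>z. dlog w z $ b) y = pd a (\<lambda>z. u (slice_emb z) $ tan_ix b) y"
      by (rule pd_cong_open[OF metric_open[OF C2.G] y]) (rule dlog_w)
    also have "\<dots> = v (tan_ix a) (tan_ix b)"
      unfolding v_def by (rule pd_slice(1)[OF sm1_diff[OF sm1_u x]])
    finally show ?thesis by (simp add: cov1_def gam dlog_w[OF y])
  qed
  let ?uu = "\<lambda>z. \<chi> a b. dlog w z $ a * dlog w z $ b"
  have T: "tan_part (ricci (cmetric \<omega> G)) y = tan_part (ricci G) y - cov1 h (dlog w) y + ?uu y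
     + (- un y) *\<^sub>R second_ff G y + (- c) *\<^sub>R h y"
  proof -
    have "tan_part (ricci (cmetric \<omega> G)) y $ a $ b = tan_part (ricci G) y $ a $ b - cov1 h (dlog w) y $ a $ b + ?uu y $ a $ b
       - un y * second_ff G y $ a $ b - c * h y $ a $ b" for a b
      unfolding tan_part_nth ric conformal_ricci_polynomial[where R=R and g=g and p=p and gh=gh and ph=ph and v=v and u="\<lambda>k. u ?x $ k", OF g v gh ph R_def] c_def[symmetric] cv II un vec_lambda_beta dlog_w[OF y] Gx
      using exhaust_2[of a] exhaust_2[of b] by (elim disjE) (simp_all add: sum_3 sum_2)
    then show ?thesis by (simp add: vec_eq_iff)
  qed
  have tr: "tr2 h (tan_part (ricci (cmetric \<omega> G))) y = tr2 h (tan_part (ricci G)) y - tr2 h (cov1 h (dlog w)) y + tr2 h ?uu y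
     - un y * tr2 h (second_ff G) y - c * 2"
    unfolding tr2_at_1[of h y, OF h1] T by (simp add: sum_2 h1 mat_def algebra_simps)
  have "Qf (cmetric \<omega> G) y = tf h (tan_part (ricci (cmetric \<omega> G))) y + (mean_curv G y + un y) *\<^sub>R second_ff0 G y"
    unfolding Qf_def tan_part_cmetric C2.tf_cmetric[OF y] second_ff0_cmetric[OF y] scaleR_scaleR mean_curv_cmetric[OF y] ..
  also have "tf h (tan_part (ricci (cmetric \<omega> G))) y = tf h (tan_part (ricci G)) y - tf h (cov1 h (dlog w)) y + tf h ?uu y - un y *\<^sub>R second_ff0 G y"
    unfolding second_ff0_tf[OF G] tf_def tr unfolding T by (simp add: vec_eq_iff algebra_simps)
  finally show ?thesis unfolding Qf_def by (simp add: algebra_simps)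
qed

lemma Qf_cmetric:
  assumes y: "y \<in> V"
  shows "Qf (cmetric \<omega> G) y = Qf G y - tf h (cov1 h (dlog w)) y + tf h (\<lambda>z. \<chi> a b. dlog w z $ a * dlog w z $ b) y"
proof -
  obtain X0 \<phi> G0 where P: "slice_pullback X0 X \<phi> G0 G" and 0: "0 \<in> slice_of X0" "slice_map \<phi> 0 = y" "G0 (slice_emb 0) = mat 1"
    by (rule slice_normalize[OF G y])
  interpret P: slice_pullback X0 X \<phi> G0 G by (rule P)
  define \<omega>0 where "\<omega>0 x = \<omega> (\<phi> x)" for x
  interpret C: conformal3 X0 G0 \<omega>0
  proof unfold_locales
    show "smooth_on X0 \<omega>0" unfolding \<omega>0_def[abs_def] by (rule P.smooth_comp[OF \<omega>])
  qed (simp_all add: \<omega>0_def P.metric pos[OF P.sub])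
  interpret P': slice_pullback X0 X \<phi> "cmetric \<omega>0 G0" "cmetric \<omega> G"
  proof
    show "cmetric \<omega>0 G0 x $ a $ b = (\<Sum>i\<in>UNIV. \<Sum>j\<in>UNIV. pd a (\<lambda>z. \<phi> z $ i) x * pd b (\<lambda>z. \<phi> z $ j) x * cmetric \<omega> G (\<phi> x) $ i $ j)" if "x \<in> X0" for x a b
      using P.pull[OF that] by (simp add: cmetric_def \<omega>0_def sum_distrib_left mult_ac)
  qed (use P.X P.\<phi> P.sub P.jac metric_cmetric P.slice in auto)
  let ?ww = "\<lambda>y. \<omega>0 (slice_emb y)" and ?hh = "tan_part G0"
  have w0: "?ww z = w (P.\<psi> z)" if "z \<in> P.V" for z using P.emb_\<psi>[OF that] by (simp add: \<omega>0_def)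
  have dl: "P.S.pb1 (dlog ?ww) (dlog w)"
  proof -
    have "dlog ?ww z = dlog (\<lambda>z. w (P.\<psi> z)) z" if z: "z \<in> P.V" for z
      unfolding dlog_def w0[OF z] using pd_cong_open[OF P.V_open z w0] by simp
    then show ?thesis using P.S.pb1_dlog[OF ws] unfolding P.S.pb1_def by simp
  qed
  let ?vv = "\<lambda>z. \<chi> a b. dlog ?ww z $ a * dlog ?ww z $ b" and ?uu = "\<lambda>z. \<chi> a b. dlog w z $ a * dlog w z $ b"
  have Q: "P.S.pb2 (Qf G0) (Qf G)" by (rule P.pb2_Qf)
  have Q': "P.S.pb2 (Qf (cmetric \<omega>0 G0)) (Qf (cmetric \<omega> G))" by (rule P'.pb2_Qf)
  have cv: "P.S.pb2 (tf ?hh (cov1 ?hh (dlog ?ww))) (tf h (cov1 h (dlog w)))"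
    by (intro P.S.pb2_tf P.S.pb2_cov1[OF dl] sm1D[OF C2.sm1_u])
  have uu: "P.S.pb2 (tf ?hh ?vv) (tf h ?uu)"
    by (rule P.S.pb2_tf[OF P.S.pb2_outer[OF dl dl]])
  \<comment> \<open>The difference of the two sides of the claim, as one combination of tensors that
    pull back. It vanishes at the normalised point.\<close>
  have "P.S.pb2 (\<lambda>z. ((Qf (cmetric \<omega>0 G0) z + (-1) *\<^sub>R Qf G0 z) + 1 *\<^sub>R tf ?hh (cov1 ?hh (dlog ?ww)) z) + (-1) *\<^sub>R tf ?hh ?vv z)
     (\<lambda>z. ((Qf (cmetric \<omega> G) z + (-1) *\<^sub>R Qf G z) + 1 *\<^sub>R tf h (cov1 h (dlog w)) z) + (-1) *\<^sub>R tf h ?uu z)"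
    by (intro P.S.pb2_smult_diff Q Q' cv uu refl)
  from P.S.pb2_zero[OF this 0(1)]
  have "((Qf (cmetric \<omega> G) y + (-1) *\<^sub>R Qf G y) + 1 *\<^sub>R tf h (cov1 h (dlog w)) y) + (-1) *\<^sub>R tf h ?uu y = 0"
    using C.Qf_cmetric_at_1[OF 0(1,3)] by (simp add: 0(2))
  then show ?thesis by (simp add: algebra_simps)
qed

lemma op4_conformal:
  assumes y: "y \<in> V" and f: "smooth_on V f"
  shows "op4 (tan_part (cmetric \<omega> G)) (second_ff0 (cmetric \<omega> G)) (Qf (cmetric \<omega> G)) (\<lambda>y. w y * f y) y
    = inverse (w y) ^ 3 * op4 h (second_ff0 G) (Qf G) f y"
  unfolding tan_part_cmetric
  by (rule C2.op4_cmetric[OF tfree_second_ff0[OF G] tfree_Qf[OF G] f y second_ff0_cmetric Qf_cmetric])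

lemma sqlap_coord_conformal:
  assumes y: "y \<in> V" and f: "smooth_on V f"
  shows "sqlap_coord (cmetric \<omega> G) (\<lambda>y. w y * f y) y = inverse (w y) ^ 3 * sqlap_coord G f y"
  unfolding sqlap_coord_op4[OF metric_cmetric y smooth_on_mult[OF ws f]] sqlap_coord_op4[OF G y f]
  by (rule op4_conformal[OF y f])

end

section \<open>Transfer to the manifold\<close>

lemma smooth_op4:
  assumes h: "metric_on V h" and L: "tfree V h L" and Q: "tfree V h Q" and f: "smooth_on V f"
  shows "smooth_on V (op4 h L Q f)"
proof -
  note X = metric_open[OF h] and L' = tfreeD(1)[OF L] and Q' = tfreeD(1)[OF Q]
  have A: "sm2 V (opA h Q f)" by (rule tfreeD(1)[OF tfree_opA[OF h Q f]])
  have v: "sm1 V (opv h L f)" by (rule sm1_opv[OF h L' f])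
  show ?thesis unfolding op4_def[abs_def]
    by (intro smooth_on_add smooth_on_mult smooth_on_power smooth_on_const X f smooth_div1[OF h] smooth_ip1[OF h] smooth_ip2[OF h]
        sm1_div2[OF h] sm1_apply2[OF h] A v L' Q')
qed

text \<open>Locality of the operator is naturality under the identity map, since a pullback relates
  fields only on its domain.\<close>

lemma sqlap_coord_cong:
  assumes G': "metric_on X G'" and G: "\<And>x. x \<in> X \<Longrightarrow> G x = G' x" and y: "y \<in> slice_of X"
    and f: "\<And>y. y \<in> slice_of X \<Longrightarrow> f y = f' y" and f': "smooth_on (slice_of X) f'"
  shows "sqlap_coord G f y = sqlap_coord G' f' y"
proof -
  note X = metric_open[OF G']
  interpret slice_pullback X X "\<lambda>x. x" G G'
  proof
    show "open X" by (rule X)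
    show "smooth_on X (\<lambda>x. x $ i)" for i by (rule smooth_on_coord[OF X])
    show "det (\<chi> i a. pd a (\<lambda>z. z $ i) x) \<noteq> 0" for x :: "real^3"
    proof -
      have "(\<chi> i a. pd a (\<lambda>z. z $ i) x) = mat 1" by (simp add: vec_eq_iff mat_def)
      then show ?thesis by simp
    qed
    show "G x $ a $ b = (\<Sum>i\<in>UNIV. \<Sum>j\<in>UNIV. pd a (\<lambda>z. z $ i) x * pd b (\<lambda>z. z $ j) x * G' x $ i $ j)" if "x \<in> X" for x a b
      using G[OF that] exhaust_3[of a] exhaust_3[of b] by (elim disjE) (simp_all add: sum_3)
  qed (use G' in auto)
  have e: "slice_map (\<lambda>x. x) y = y" for y by (simp add: slice_map_def vec_eq_iff)
  have fs: "smooth_on V f" by (rule smooth_on_cong[OF f']) (simp add: f)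
  show ?thesis
    unfolding sqlap_coord_op4[OF metric y fs] sqlap_coord_op4[OF G' y f']
    using op4_slice_pull[OF y _ f', of f] f by (simp add: e)
qed

text \<open>A componentwise form of \<open>riemannian_metric\<close>, stable under rescaling by
  \<open>metric_cmetric\<close>. It lets the operator be treated for
  \<open>rescale \<Omega> g\<close> on the same footing as for members of the class.\<close>

definition local_metric :: "'m::topological_space chart set \<Rightarrow> 'm metric \<Rightarrow> bool" where
  "local_metric A g \<longleftrightarrow> (\<forall>\<kappa>\<in>A. metric_on (snd \<kappa> ` fst \<kappa>) (metric_in g \<kappa>)) \<and>
     (\<forall>\<kappa>\<in>A. \<forall>\<kappa>'\<in>A. \<forall>p\<in>fst \<kappa> \<inter> fst \<kappa>'.
        let D = matrix (frechet_derivative (transition \<kappa> \<kappa>') (at (snd \<kappa> p)))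
        in g \<kappa> p = transpose D ** g \<kappa>' p ** D)"

section \<open>Slice charts and the operator on the manifold\<close>

context
  fixes A :: "('m::{t2_space, second_countable_topology}) chart set"
    and C :: "'m metric set" and S :: "'m set"
  assumes A: "smooth_structure A" and C: "conformal_class A C" and S: "embedded_surface A S"

begin

lemma chart: "\<kappa> \<in> A \<Longrightarrow> is_chart \<kappa>"
  using A by (simp add: smooth_structure_def)

lemma chart_open: "\<kappa> \<in> A \<Longrightarrow> open (snd \<kappa> ` fst \<kappa>)"
  using chart by (simp add: is_chart_def)

lemma chart_inv_left: "\<kappa> \<in> A \<Longrightarrow> p \<in> fst \<kappa> \<Longrightarrow> chart_inv \<kappa> (snd \<kappa> p) = p"
  using chart by (simp add: is_chart_def homeomorphism_def)

lemma chart_inv_right: "\<kappa> \<in> A \<Longrightarrow> x \<in> snd \<kappa> ` fst \<kappa> \<Longrightarrow> snd \<kappa> (chart_inv \<kappa> x) = x"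
  by (auto simp: chart_inv_left)

lemma chart_inv_in: "\<kappa> \<in> A \<Longrightarrow> x \<in> snd \<kappa> ` fst \<kappa> \<Longrightarrow> chart_inv \<kappa> x \<in> fst \<kappa>"
  by (auto simp: chart_inv_left)

lemma slice_chartD: "\<kappa> \<in> slice_charts A S \<Longrightarrow> \<kappa> \<in> A"
  by (simp add: slice_charts_def)

lemma slice_chart_iff:
  assumes \<kappa>: "\<kappa> \<in> slice_charts A S" and p: "p \<in> fst \<kappa>"
  shows "p \<in> S \<longleftrightarrow> snd \<kappa> p $ 3 = 0"
proof
  have im: "snd \<kappa> ` (fst \<kappa> \<inter> S) = snd \<kappa> ` fst \<kappa> \<inter> {x. x $ 3 = 0}" using \<kappa> by (simp add: slice_charts_def)
  { assume "p \<in> S" then show "snd \<kappa> p $ 3 = 0" using im p by blast }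
  { assume "snd \<kappa> p $ 3 = 0"
    then have "snd \<kappa> p \<in> snd \<kappa> ` (fst \<kappa> \<inter> S)" using im p by blast
    then obtain q where q: "q \<in> fst \<kappa>" "q \<in> S" "snd \<kappa> p = snd \<kappa> q" by blast
    then have "p = q" using chart_inv_left[OF slice_chartD[OF \<kappa>]] p by metis
    then show "p \<in> S" using q by simp }
qed

lemma slice_dom_eq: "slice_dom \<kappa> = slice_of (snd \<kappa> ` fst \<kappa>)"
  by (simp add: slice_dom_def slice_of_def)

lemma slice_coord_emb:
  assumes \<kappa>: "\<kappa> \<in> slice_charts A S" and p: "p \<in> fst \<kappa>" "p \<in> S"
  shows "slice_emb (slice_coord \<kappa> p) = snd \<kappa> p" "slice_coord \<kappa> p \<in> slice_dom \<kappa>" "slice_param \<kappa> (slice_coord \<kappa> p) = p"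
proof -
  show *: "slice_emb (slice_coord \<kappa> p) = snd \<kappa> p"
    using slice_chart_iff[OF \<kappa> p(1)] p(2) by (simp add: vec_eq_iff forall_3 slice_coord_def)
  show "slice_coord \<kappa> p \<in> slice_dom \<kappa>" using p by (simp add: slice_dom_def *)
  show "slice_param \<kappa> (slice_coord \<kappa> p) = p"
    using chart_inv_left[OF slice_chartD[OF \<kappa>] p(1)] by (simp add: slice_param_def *)
qed

lemma slice_param_in:
  assumes \<kappa>: "\<kappa> \<in> slice_charts A S" and y: "y \<in> slice_dom \<kappa>"
  shows "slice_param \<kappa> y \<in> fst \<kappa>" "slice_param \<kappa> y \<in> S" "slice_coord \<kappa> (slice_param \<kappa> y) = y"
proof -
  note \<kappa>A = slice_chartD[OF \<kappa>]
  have e: "slice_emb y \<in> snd \<kappa> ` fst \<kappa>" using y by (simp add: slice_dom_def)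
  show 1: "slice_param \<kappa> y \<in> fst \<kappa>" unfolding slice_param_def by (rule chart_inv_in[OF \<kappa>A e])
  have 2: "snd \<kappa> (slice_param \<kappa> y) = slice_emb y" unfolding slice_param_def by (rule chart_inv_right[OF \<kappa>A e])
  show "slice_param \<kappa> y \<in> S" using slice_chart_iff[OF \<kappa> 1] 2 by simp
  show "slice_coord \<kappa> (slice_param \<kappa> y) = y" by (simp add: slice_coord_def 2 vec_eq_iff)
qed

lemma slice_dom_open: "\<kappa> \<in> A \<Longrightarrow> open (slice_dom \<kappa>)"
  unfolding slice_dom_eq by (rule open_slice_of[OF chart_open])

lemma riemannian_local_metric:
  assumes g: "riemannian_metric A g"
  shows "local_metric A g"
  unfolding local_metric_def
proof (intro conjI ballI)
  fix \<kappa> assume \<kappa>: "\<kappa> \<in> A"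
  show "metric_on (snd \<kappa> ` fst \<kappa>) (metric_in g \<kappa>)"
    unfolding metric_on_def
  proof (intro conjI allI ballI impI)
    show "open (snd \<kappa> ` fst \<kappa>)" by (rule chart_open[OF \<kappa>])
    have "smooth_on (snd \<kappa> ` fst \<kappa>) (metric_in g \<kappa>)" using g \<kappa> by (simp add: riemannian_metric_def)
    then show "smooth_on (snd \<kappa> ` fst \<kappa>) (\<lambda>x. metric_in g \<kappa> x $ i $ j)" for i j
      by (intro smooth_on_nth)
    fix x assume "x \<in> snd \<kappa> ` fst \<kappa>"
    then have p: "chart_inv \<kappa> x \<in> fst \<kappa>" by (rule chart_inv_in[OF \<kappa>])
    then show "transpose (metric_in g \<kappa> x) = metric_in g \<kappa> x"
      using g \<kappa> by (simp add: riemannian_metric_def metric_in_def)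
    show "v \<bullet> (metric_in g \<kappa> x *v v) > 0" if "v \<noteq> 0" for v
      using g \<kappa> p that by (simp add: riemannian_metric_def metric_in_def)
  qed
next
  fix \<kappa> \<kappa>' p assume "\<kappa> \<in> A" "\<kappa>' \<in> A" "p \<in> fst \<kappa> \<inter> fst \<kappa>'"
  then show "let D = matrix (frechet_derivative (transition \<kappa> \<kappa>') (at (snd \<kappa> p))) in g \<kappa> p = transpose D ** g \<kappa>' p ** D"
    using g unfolding riemannian_metric_def by blast
qed

lemma metric_in_rescale: "metric_in (rescale \<Omega> g) \<kappa> = cmetric (\<Omega> \<circ> chart_inv \<kappa>) (metric_in g \<kappa>)"
  by (intro ext) (simp add: metric_in_def rescale_def cmetric_def)

lemma conformal_chart:
  assumes g: "local_metric A g" and \<Omega>: "positive_fun A \<Omega>" and \<kappa>: "\<kappa> \<in> A"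
  shows "conformal3 (snd \<kappa> ` fst \<kappa>) (metric_in g \<kappa>) (\<Omega> \<circ> chart_inv \<kappa>)"
proof unfold_locales
  show "metric_on (snd \<kappa> ` fst \<kappa>) (metric_in g \<kappa>)" using g \<kappa> by (simp add: local_metric_def)
  show "smooth_on (snd \<kappa> ` fst \<kappa>) (\<Omega> \<circ> chart_inv \<kappa>)" using \<Omega> \<kappa> by (simp add: positive_fun_def smooth_fun_def)
  show "(\<Omega> \<circ> chart_inv \<kappa>) x > 0" for x using \<Omega> by (simp add: positive_fun_def)
qed

lemma local_metric_rescale:
  assumes g: "local_metric A g" and \<Omega>: "positive_fun A \<Omega>"
  shows "local_metric A (rescale \<Omega> g)"
  unfolding local_metric_def
proof (intro conjI ballI)
  fix \<kappa> assume \<kappa>: "\<kappa> \<in> A"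
  interpret conformal3 "snd \<kappa> ` fst \<kappa>" "metric_in g \<kappa>" "\<Omega> \<circ> chart_inv \<kappa>" by (rule conformal_chart[OF g \<Omega> \<kappa>])
  show "metric_on (snd \<kappa> ` fst \<kappa>) (metric_in (rescale \<Omega> g) \<kappa>)"
    unfolding metric_in_rescale by (rule metric_cmetric)
next
  fix \<kappa> \<kappa>' p assume k: "\<kappa> \<in> A" "\<kappa>' \<in> A" "p \<in> fst \<kappa> \<inter> fst \<kappa>'"
  let ?D = "matrix (frechet_derivative (transition \<kappa> \<kappa>') (at (snd \<kappa> p)))"
  have "g \<kappa> p = transpose ?D ** g \<kappa>' p ** ?D" using g k unfolding local_metric_def Let_def by blast
  then show "let D = ?D in rescale \<Omega> g \<kappa> p = transpose D ** rescale \<Omega> g \<kappa>' p ** D"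
    unfolding Let_def rescale_def by (simp add: matrix_scalar_ac scalar_matrix_assoc[symmetric])
qed

text \<open>The reverse transition map is a left inverse, so by the chain rule the Jacobian is
  invertible. The slice condition holds because in either chart the points of \<open>S\<close> are
  those with vanishing third coordinate.\<close>

lemma transition_pullback:
  assumes g: "local_metric A g" and \<kappa>: "\<kappa> \<in> slice_charts A S" and \<kappa>': "\<kappa>' \<in> slice_charts A S"
  shows "slice_pullback (snd \<kappa> ` (fst \<kappa> \<inter> fst \<kappa>')) (snd \<kappa>' ` fst \<kappa>') (transition \<kappa> \<kappa>') (metric_in g \<kappa>) (metric_in g \<kappa>')"
proof -
  let ?X = "snd \<kappa> ` (fst \<kappa> \<inter> fst \<kappa>')" and ?X' = "snd \<kappa>' ` (fst \<kappa> \<inter> fst \<kappa>')"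
  let ?\<phi> = "transition \<kappa> \<kappa>'" and ?\<phi>' = "transition \<kappa>' \<kappa>"
  note kA = slice_chartD[OF \<kappa>] slice_chartD[OF \<kappa>']
  have comp: "smooth_on ?X ?\<phi>" "smooth_on ?X' ?\<phi>'"
    using A kA by (auto simp: smooth_structure_def compatible_def Int_commute)
  have X: "open ?X" by (rule smooth_on_open[OF comp(1)])
  have pt: "\<exists>q. q \<in> fst \<kappa> \<and> q \<in> fst \<kappa>' \<and> x = snd \<kappa> q \<and> chart_inv \<kappa> x = q \<and> ?\<phi> x = snd \<kappa>' q \<and> chart_inv \<kappa>' (?\<phi> x) = q \<and> ?\<phi>' (?\<phi> x) = x"
    if "x \<in> ?X" for x
    using that chart_inv_left[OF kA(1)] chart_inv_left[OF kA(2)] by (auto simp: transition_def)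
  have d\<phi>: "?\<phi> differentiable (at x)" if "x \<in> ?X" for x by (rule smooth_on_diff[OF comp(1) that])
  have d': "(\<lambda>z. ?\<phi> z $ j) differentiable (at x)" if "x \<in> ?X" for x j by (rule differentiable_nth[OF d\<phi>[OF that]])
  show ?thesis
  proof
    show "open ?X" by (rule X)
    show "smooth_on ?X (\<lambda>x. ?\<phi> x $ i)" for i by (rule smooth_on_nth[OF comp(1)])
    show "?\<phi> x \<in> snd \<kappa>' ` fst \<kappa>'" if "x \<in> ?X" for x using pt[OF that] by auto
    show "metric_on (snd \<kappa>' ` fst \<kappa>') (metric_in g \<kappa>')" using g kA by (simp add: local_metric_def)
  next
    fix x assume x: "x \<in> ?X"
    have \<phi>x: "?\<phi> x \<in> ?X'" using pt[OF x] by auto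
    let ?D = "(\<chi> i a. pd a (\<lambda>z. ?\<phi> z $ i) x) :: real^3^3" and ?D' = "(\<chi> i a. pd a (\<lambda>z. ?\<phi>' z $ i) (?\<phi> x)) :: real^3^3"
    have "(\<Sum>j\<in>UNIV. pd j (\<lambda>z. ?\<phi>' z $ i) (?\<phi> x) * pd a (\<lambda>z. ?\<phi> z $ j) x) = kd i a" for i a
    proof -
      have "pd a (\<lambda>z. ?\<phi>' (?\<phi> z) $ i) x = pd a (\<lambda>z. z $ i) x"
      proof (rule pd_cong_open[OF X x])
        fix z assume "z \<in> ?X"
        then have "?\<phi>' (?\<phi> z) = z" using pt by blast
        then show "?\<phi>' (?\<phi> z) $ i = z $ i" by (rule arg_cong)
      qed
      moreover have "pd a (\<lambda>z. ?\<phi>' (?\<phi> z) $ i) x = (\<Sum>j\<in>UNIV. pd j (\<lambda>z. ?\<phi>' z $ i) (?\<phi> x) * pd a (\<lambda>z. ?\<phi> z $ j) x)"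
        by (rule pd_comp(1)[of ?\<phi> x "\<lambda>z. ?\<phi>' z $ i", OF d'[OF x] differentiable_nth[OF smooth_on_diff[OF comp(2) \<phi>x]]])
      ultimately show ?thesis by (simp add: eq_commute)
    qed
    then have "?D' ** ?D = mat 1" by (simp add: vec_eq_iff matrix_matrix_mult_def mat_def)
    then have "det ?D' * det ?D = 1" by (simp only: det_mul[symmetric] det_I)
    then show "det ?D \<noteq> 0" by auto
  next
    fix x a b assume x: "x \<in> ?X"
    obtain q where q: "q \<in> fst \<kappa> \<inter> fst \<kappa>'" "x = snd \<kappa> q" "chart_inv \<kappa> x = q" "chart_inv \<kappa>' (?\<phi> x) = q" using pt[OF x] by blast
    let ?D = "matrix (frechet_derivative ?\<phi> (at x))"
    have D: "?D $ i $ a = pd a (\<lambda>z. ?\<phi> z $ i) x" for i a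
      unfolding pd_nth[OF d\<phi>[OF x]] by (simp add: matrix_def pd_def)
    have "g \<kappa> q = transpose ?D ** g \<kappa>' q ** ?D"
      using g kA q unfolding local_metric_def Let_def by blast
    then have "metric_in g \<kappa> x = transpose ?D ** metric_in g \<kappa>' (?\<phi> x) ** ?D" by (simp add: metric_in_def q(3,4))
    then have "metric_in g \<kappa> x $ a $ b = (\<Sum>j\<in>UNIV. (\<Sum>i\<in>UNIV. ?D $ i $ a * metric_in g \<kappa>' (?\<phi> x) $ i $ j) * ?D $ j $ b)"
      by (simp add: matrix_matrix_mult_def transpose_def)
    also have "\<dots> = (\<Sum>i\<in>UNIV. \<Sum>j\<in>UNIV. ?D $ i $ a * ?D $ j $ b * metric_in g \<kappa>' (?\<phi> x) $ i $ j)"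
      unfolding sum_distrib_right by (subst sum.swap) (simp only: mult_ac)
    finally show "metric_in g \<kappa> x $ a $ b = (\<Sum>i\<in>UNIV. \<Sum>j\<in>UNIV. pd a (\<lambda>z. ?\<phi> z $ i) x * pd b (\<lambda>z. ?\<phi> z $ j) x * metric_in g \<kappa>' (?\<phi> x) $ i $ j)"
      by (simp only: D)
  next
    fix y assume "y \<in> slice_of ?X"
    then obtain q where q: "q \<in> fst \<kappa>" "q \<in> fst \<kappa>'" "slice_emb y = snd \<kappa> q" "?\<phi> (slice_emb y) = snd \<kappa>' q"
      using pt[OF slice_ofD] by blast
    have "snd \<kappa> q $ 3 = 0" using q(3)[symmetric] by simp
    then have "q \<in> S" using slice_chart_iff[OF \<kappa> q(1)] by simp
    then show "?\<phi> (slice_emb y) $ 3 = 0" using slice_chart_iff[OF \<kappa>' q(2)] q(4) by simp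
  qed
qed

lemma smooth_funs_onD: "f \<in> smooth_funs_on A S \<Longrightarrow> \<kappa> \<in> slice_charts A S \<Longrightarrow> smooth_on (slice_of (snd \<kappa> ` fst \<kappa>)) (f \<circ> slice_param \<kappa>)"
  by (simp add: smooth_funs_on_def slice_dom_eq)

text \<open>Chart independence, which gives the definite description in \<open>sqlap\<close> its
  value.\<close>

lemma sqlap_coord_indep:
  assumes g: "local_metric A g" and f: "f \<in> smooth_funs_on A S"
    and \<kappa>: "\<kappa> \<in> slice_charts A S" and \<kappa>': "\<kappa>' \<in> slice_charts A S" and p: "p \<in> fst \<kappa>" "p \<in> fst \<kappa>'" "p \<in> S"
  shows "sqlap_coord (metric_in g \<kappa>) (f \<circ> slice_param \<kappa>) (slice_coord \<kappa> p)
    = sqlap_coord (metric_in g \<kappa>') (f \<circ> slice_param \<kappa>') (slice_coord \<kappa>' p)"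
proof -
  let ?X = "snd \<kappa> ` (fst \<kappa> \<inter> fst \<kappa>')" and ?\<phi> = "transition \<kappa> \<kappa>'"
  interpret slice_pullback ?X "snd \<kappa>' ` fst \<kappa>'" ?\<phi> "metric_in g \<kappa>" "metric_in g \<kappa>'"
    by (rule transition_pullback[OF g \<kappa> \<kappa>'])
  note kA = slice_chartD[OF \<kappa>] slice_chartD[OF \<kappa>']
  let ?y = "slice_coord \<kappa> p"
  have e: "slice_emb ?y = snd \<kappa> p" by (rule slice_coord_emb(1)[OF \<kappa> p(1,3)])
  have y: "?y \<in> V" using p by (simp add: slice_of_def e)
  have y0: "?y \<in> slice_of (snd \<kappa> ` fst \<kappa>)" using p by (simp add: slice_of_def e)
  have \<psi>y: "\<psi> ?y = slice_coord \<kappa>' p"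
    by (simp only: slice_map_def e transition_def comp_def chart_inv_left[OF kA(1) p(1)], simp only: slice_coord_def)
  have ff: "(f \<circ> slice_param \<kappa>) z = (f \<circ> slice_param \<kappa>') (\<psi> z)" if z: "z \<in> V" for z
  proof -
    obtain q where q: "q \<in> fst \<kappa>" "q \<in> fst \<kappa>'" "slice_emb z = snd \<kappa> q" using slice_ofD[OF z] by auto
    have 1: "slice_emb (\<psi> z) = snd \<kappa>' q"
      unfolding emb_\<psi>[OF z] q(3) by (simp add: transition_def chart_inv_left[OF kA(1) q(1)])
    show ?thesis
      by (simp only: slice_param_def comp_def 1 q(3) chart_inv_left[OF kA(1) q(1)] chart_inv_left[OF kA(2) q(2)])
  qed
  have m: "metric_on (snd \<kappa> ` fst \<kappa>) (metric_in g \<kappa>)" using g kA by (simp add: local_metric_def)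
  have y': "slice_coord \<kappa>' p \<in> W" using \<psi>_W[OF y] \<psi>y by simp
  show ?thesis
    unfolding sqlap_coord_op4[OF m y0 smooth_funs_onD[OF f \<kappa>]] sqlap_coord_op4[OF G' y' smooth_funs_onD[OF f \<kappa>']]
    unfolding \<psi>y[symmetric] by (rule op4_slice_pull[OF y ff smooth_funs_onD[OF f \<kappa>']])
qed

lemma sqlap_eq:
  assumes g: "local_metric A g" and f: "f \<in> smooth_funs_on A S"
    and \<kappa>: "\<kappa> \<in> slice_charts A S" and p: "p \<in> fst \<kappa>" "p \<in> S"
  shows "sqlap A S g f p = sqlap_coord (metric_in g \<kappa>) (f \<circ> slice_param \<kappa>) (slice_coord \<kappa> p)"
proof -
  have "(THE v. \<forall>\<kappa>\<in>slice_charts A S. p \<in> fst \<kappa> \<longrightarrow> v = sqlap_coord (metric_in g \<kappa>) (f \<circ> slice_param \<kappa>) (slice_coord \<kappa> p))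
     = sqlap_coord (metric_in g \<kappa>) (f \<circ> slice_param \<kappa>) (slice_coord \<kappa> p)"
  proof (rule the_equality)
    show "\<forall>\<kappa>'\<in>slice_charts A S. p \<in> fst \<kappa>' \<longrightarrow>
        sqlap_coord (metric_in g \<kappa>) (f \<circ> slice_param \<kappa>) (slice_coord \<kappa> p)
        = sqlap_coord (metric_in g \<kappa>') (f \<circ> slice_param \<kappa>') (slice_coord \<kappa>' p)"
      by (intro ballI impI) (rule sqlap_coord_indep[OF g f \<kappa> _ p(1) _ p(2)])
  qed (use \<kappa> p(1) in blast)
  then show ?thesis using p(2) by (simp add: sqlap_def)
qed

lemma sqlap_smooth:
  assumes g: "local_metric A g" and f: "f \<in> smooth_funs_on A S"
  shows "sqlap A S g f \<in> smooth_funs_on A S"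
  unfolding smooth_funs_on_def
proof (intro CollectI conjI ballI)
  show "sqlap A S g f \<in> extensional S" by (simp add: sqlap_def)
  fix \<kappa> assume \<kappa>: "\<kappa> \<in> slice_charts A S"
  let ?X = "snd \<kappa> ` fst \<kappa>" and ?G = "metric_in g \<kappa>"
  have m: "metric_on ?X ?G" using g slice_chartD[OF \<kappa>] by (simp add: local_metric_def)
  have "smooth_on (slice_of ?X) (op4 (tan_part ?G) (second_ff0 ?G) (Qf ?G) (f \<circ> slice_param \<kappa>))"
    by (rule smooth_op4[OF metric_tan_part[OF m] tfree_second_ff0[OF m] tfree_Qf[OF m] smooth_funs_onD[OF f \<kappa>]])
  then show "smooth_on (slice_dom \<kappa>) (sqlap A S g f \<circ> slice_param \<kappa>)"
    unfolding slice_dom_eq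
  proof (rule smooth_on_cong)
    fix y assume y: "y \<in> slice_of ?X"
    note s = slice_param_in[OF \<kappa> y[folded slice_dom_eq]]
    show "op4 (tan_part ?G) (second_ff0 ?G) (Qf ?G) (f \<circ> slice_param \<kappa>) y = (sqlap A S g f \<circ> slice_param \<kappa>) y"
      using sqlap_eq[OF g f \<kappa> s(1,2)] s(3) sqlap_coord_op4[OF m y smooth_funs_onD[OF f \<kappa>]] by simp
  qed
qed

lemma smooth_funs_on_restrict:
  assumes \<Omega>: "smooth_fun A \<Omega>" and \<kappa>: "\<kappa> \<in> slice_charts A S"
  shows "smooth_on (slice_dom \<kappa>) (\<lambda>y. \<Omega> (slice_param \<kappa> y))"
proof -
  have "smooth_on (snd \<kappa> ` fst \<kappa>) (\<Omega> \<circ> chart_inv \<kappa>)" using \<Omega> slice_chartD[OF \<kappa>] by (simp add: smooth_fun_def)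
  from smooth_slice[OF this] show ?thesis by (simp add: slice_dom_eq slice_param_def)
qed

lemma smooth_funs_onI:
  assumes "\<And>\<kappa>. \<kappa> \<in> slice_charts A S \<Longrightarrow> smooth_on (slice_dom \<kappa>) (\<lambda>y. F (slice_param \<kappa> y))"
  shows "(\<lambda>q\<in>S. F q) \<in> smooth_funs_on A S"
  unfolding smooth_funs_on_def
proof (intro CollectI conjI ballI)
  show "(\<lambda>q\<in>S. F q) \<in> extensional S" by simp
  fix \<kappa> assume \<kappa>: "\<kappa> \<in> slice_charts A S"
  show "smooth_on (slice_dom \<kappa>) ((\<lambda>q\<in>S. F q) \<circ> slice_param \<kappa>)"
    by (rule smooth_on_cong[OF assms[OF \<kappa>]]) (simp add: slice_param_in(2)[OF \<kappa>])
qed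

lemma smooth_funs_on_param: "f \<in> smooth_funs_on A S \<Longrightarrow> \<kappa> \<in> slice_charts A S \<Longrightarrow> smooth_on (slice_dom \<kappa>) (\<lambda>y. f (slice_param \<kappa> y))"
  by (simp add: smooth_funs_on_def comp_def)

lemma slice_chart_at: "p \<in> S \<Longrightarrow> \<exists>\<kappa>\<in>slice_charts A S. p \<in> fst \<kappa>"
  using S by (simp add: embedded_surface_def)

lemma sqlap_rescale:
  assumes g: "local_metric A g" and \<Omega>: "positive_fun A \<Omega>" and f: "f \<in> smooth_funs_on A S" and p: "p \<in> S"
  shows "sqlap A S (rescale \<Omega> g) (\<lambda>q\<in>S. \<Omega> q * f q) p = \<Omega> p powr (-3) * sqlap A S g f p"
proof -
  obtain \<kappa> where \<kappa>: "\<kappa> \<in> slice_charts A S" "p \<in> fst \<kappa>" using slice_chart_at[OF p] by blast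
  note kA = slice_chartD[OF \<kappa>(1)]
  let ?X = "snd \<kappa> ` fst \<kappa>"
  interpret conformal3 ?X "metric_in g \<kappa>" "\<Omega> \<circ> chart_inv \<kappa>" by (rule conformal_chart[OF g \<Omega> kA])
  let ?y = "slice_coord \<kappa> p"
  have y: "?y \<in> V" using slice_coord_emb(2)[OF \<kappa> p] by (simp add: slice_dom_eq)
  have \<Omega>s: "smooth_fun A \<Omega>" using \<Omega> by (simp add: positive_fun_def)
  let ?f = "\<lambda>q\<in>S. \<Omega> q * f q"
  have fh: "?f \<in> smooth_funs_on A S"
    by (intro smooth_funs_onI smooth_on_mult smooth_funs_on_restrict[OF \<Omega>s] smooth_funs_on_param[OF f])
  have fs: "smooth_on V (f \<circ> slice_param \<kappa>)" by (rule smooth_funs_onD[OF f \<kappa>(1)])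
  have wp: "(\<Omega> \<circ> chart_inv \<kappa>) (slice_emb ?y) = \<Omega> p"
    using slice_coord_emb(3)[OF \<kappa> p] by (simp add: slice_param_def)
  have "sqlap A S (rescale \<Omega> g) ?f p = sqlap_coord (cmetric (\<Omega> \<circ> chart_inv \<kappa>) (metric_in g \<kappa>)) (?f \<circ> slice_param \<kappa>) ?y"
    using sqlap_eq[OF local_metric_rescale[OF g \<Omega>] fh \<kappa> p] by (simp only: metric_in_rescale)
  also have "\<dots> = sqlap_coord (cmetric (\<Omega> \<circ> chart_inv \<kappa>) (metric_in g \<kappa>)) (\<lambda>y. (\<Omega> \<circ> chart_inv \<kappa>) (slice_emb y) * (f \<circ> slice_param \<kappa>) y) ?y"
  proof (rule sqlap_coord_cong[OF metric_cmetric refl y])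
    fix z assume z: "z \<in> V"
    then have "slice_param \<kappa> z \<in> S" by (intro slice_param_in(2)[OF \<kappa>(1)]) (simp add: slice_dom_eq)
    then show "(?f \<circ> slice_param \<kappa>) z = (\<Omega> \<circ> chart_inv \<kappa>) (slice_emb z) * (f \<circ> slice_param \<kappa>) z"
      by (simp add: slice_param_def)
  qed (rule smooth_on_mult[OF ws fs])
  also have "\<dots> = inverse (\<Omega> p) ^ 3 * sqlap_coord (metric_in g \<kappa>) (f \<circ> slice_param \<kappa>) ?y"
    using sqlap_coord_conformal[OF y fs] wp by simp
  also have "sqlap_coord (metric_in g \<kappa>) (f \<circ> slice_param \<kappa>) ?y = sqlap A S g f p"
    by (rule sqlap_eq[OF g f \<kappa> p, symmetric])
  also have "inverse (\<Omega> p) ^ 3 = \<Omega> p powr (-3)"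
    using \<Omega> by (simp add: positive_fun_def powr_neg_numeral inverse_eq_divide power_one_over)
  finally show ?thesis .
qed

section \<open>Passage to densities\<close>

lemma class_metric: "g \<in> C \<Longrightarrow> local_metric A g"
  using C by (auto simp: conformal_class_def intro: riemannian_local_metric)

text \<open>Both metrics are multiples of the same reference metric, and the quotient of their
  factors relates them.\<close>

lemma class_rescale:
  assumes "g \<in> C" "g' \<in> C"
  obtains \<Omega> where "positive_fun A \<Omega>" "\<And>\<kappa> p. \<kappa> \<in> A \<Longrightarrow> p \<in> fst \<kappa> \<Longrightarrow> g' \<kappa> p = rescale \<Omega> g \<kappa> p"
proof -
  obtain g0 where g0: "C = {g. riemannian_metric A g \<and> (\<exists>\<Omega>. positive_fun A \<Omega> \<and> (\<forall>\<kappa>\<in>A. \<forall>p\<in>fst \<kappa>. g \<kappa> p = rescale \<Omega> g0 \<kappa> p))}"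
    using C unfolding conformal_class_def by blast
  obtain \<Omega>1 where 1: "positive_fun A \<Omega>1" "\<And>\<kappa> p. \<kappa> \<in> A \<Longrightarrow> p \<in> fst \<kappa> \<Longrightarrow> g \<kappa> p = rescale \<Omega>1 g0 \<kappa> p"
    using assms(1) unfolding g0 by blast
  obtain \<Omega>2 where 2: "positive_fun A \<Omega>2" "\<And>\<kappa> p. \<kappa> \<in> A \<Longrightarrow> p \<in> fst \<kappa> \<Longrightarrow> g' \<kappa> p = rescale \<Omega>2 g0 \<kappa> p"
    using assms(2) unfolding g0 by blast
  have pos: "\<Omega>1 p > 0" "\<Omega>2 p > 0" for p using 1(1) 2(1) by (simp_all add: positive_fun_def)
  have "positive_fun A (\<lambda>p. \<Omega>2 p / \<Omega>1 p)"
    unfolding positive_fun_def smooth_fun_def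
  proof (intro conjI ballI allI)
    fix \<kappa> assume "\<kappa> \<in> A"
    then have s: "smooth_on (snd \<kappa> ` fst \<kappa>) (\<Omega>1 \<circ> chart_inv \<kappa>)" "smooth_on (snd \<kappa> ` fst \<kappa>) (\<Omega>2 \<circ> chart_inv \<kappa>)"
      using 1(1) 2(1) by (simp_all add: positive_fun_def smooth_fun_def)
    have "(\<Omega>1 \<circ> chart_inv \<kappa>) x \<noteq> 0" for x using pos(1)[of "chart_inv \<kappa> x"] by simp
    from smooth_on_divide[OF s(2,1) this]
    show "smooth_on (snd \<kappa> ` fst \<kappa>) ((\<lambda>p. \<Omega>2 p / \<Omega>1 p) \<circ> chart_inv \<kappa>)" by (simp add: comp_def)
  qed (simp add: pos)
  moreover have "g' \<kappa> p = rescale (\<lambda>p. \<Omega>2 p / \<Omega>1 p) g \<kappa> p" if "\<kappa> \<in> A" "p \<in> fst \<kappa>" for \<kappa> p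
    using 1(2)[OF that] 2(2)[OF that] pos[of p] by (simp add: rescale_def power_divide)
  ultimately show ?thesis by (rule that)
qed

text \<open>A metric is a function of all charts and points. Metrics that agree on the chart domains
  can still be different objects, and \<open>class_rescale\<close> provides only such
  agreement.\<close>

lemma sqlap_metric_cong:
  assumes g: "local_metric A g" and g': "local_metric A g'" and eq: "\<And>\<kappa> p. \<kappa> \<in> A \<Longrightarrow> p \<in> fst \<kappa> \<Longrightarrow> g' \<kappa> p = g \<kappa> p"
    and f: "f \<in> smooth_funs_on A S" and p: "p \<in> S"
  shows "sqlap A S g' f p = sqlap A S g f p"
proof -
  obtain \<kappa> where \<kappa>: "\<kappa> \<in> slice_charts A S" "p \<in> fst \<kappa>" using slice_chart_at[OF p] by blast
  note kA = slice_chartD[OF \<kappa>(1)]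
  have m: "metric_on (snd \<kappa> ` fst \<kappa>) (metric_in g \<kappa>)" using g kA by (simp add: local_metric_def)
  have y: "slice_coord \<kappa> p \<in> slice_of (snd \<kappa> ` fst \<kappa>)" using slice_coord_emb(2)[OF \<kappa> p] by (simp add: slice_dom_eq)
  show ?thesis
    unfolding sqlap_eq[OF g f \<kappa> p] sqlap_eq[OF g' f \<kappa> p]
    by (rule sqlap_coord_cong[OF m _ y refl smooth_funs_onD[OF f \<kappa>(1)]])
       (simp add: metric_in_def eq[OF kA] chart_inv_in[OF kA])
qed

text \<open>Factors relative to one representative become factors relative to the other on
  multiplication or division by \<open>\<omega>\<close>.\<close>

lemma density_class_cong:
  assumes \<omega>: "\<omega> \<in> smooth_funs_on A S" "\<And>p. p \<in> S \<Longrightarrow> \<omega> p > 0"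
    and h: "\<And>\<kappa> p. p \<in> S \<Longrightarrow> h' \<kappa> p = (\<omega> p)\<^sup>2 *\<^sub>R h \<kappa> p" and u: "\<And>p. p \<in> S \<Longrightarrow> u' p = \<omega> p powr w * u p"
  shows "density_class A C S w h' u' = density_class A C S w h u"
proof (intro equalityI subsetI)
  fix k assume "k \<in> density_class A C S w h' u'"
  then obtain h2 f2 \<omega>2 where k: "k = (h2, f2)" "h2 \<in> induced A S ` C" "f2 \<in> extensional S" "\<omega>2 \<in> smooth_funs_on A S"
    "\<And>p. p \<in> S \<Longrightarrow> \<omega>2 p > 0" "\<And>\<kappa> p. p \<in> S \<Longrightarrow> h2 \<kappa> p = (\<omega>2 p)\<^sup>2 *\<^sub>R h' \<kappa> p" "\<And>p. p \<in> S \<Longrightarrow> f2 p = \<omega>2 p powr w * u' p"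
    by (auto simp: density_class_def)
  have s: "(\<lambda>p\<in>S. \<omega>2 p * \<omega> p) \<in> smooth_funs_on A S"
    by (intro smooth_funs_onI smooth_on_mult smooth_funs_on_param k \<omega>)
  have "\<forall>p\<in>S. f2 p = (\<lambda>p\<in>S. \<omega>2 p * \<omega> p) p powr w * u p"
    using k(5,7) \<omega>(2) u by (simp add: powr_mult less_imp_le)
  moreover have "\<forall>\<kappa>. \<forall>p\<in>S. h2 \<kappa> p = ((\<lambda>p\<in>S. \<omega>2 p * \<omega> p) p)\<^sup>2 *\<^sub>R h \<kappa> p"
    using k(6) h by (simp add: power_mult_distrib)
  moreover have "\<forall>p\<in>S. (\<lambda>p\<in>S. \<omega>2 p * \<omega> p) p > 0" using k(5) \<omega>(2) by simp
  ultimately show "k \<in> density_class A C S w h u"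
    using k(1-3) s unfolding density_class_def by blast
next
  fix k assume "k \<in> density_class A C S w h u"
  then obtain h2 f2 \<omega>2 where k: "k = (h2, f2)" "h2 \<in> induced A S ` C" "f2 \<in> extensional S" "\<omega>2 \<in> smooth_funs_on A S"
    "\<And>p. p \<in> S \<Longrightarrow> \<omega>2 p > 0" "\<And>\<kappa> p. p \<in> S \<Longrightarrow> h2 \<kappa> p = (\<omega>2 p)\<^sup>2 *\<^sub>R h \<kappa> p" "\<And>p. p \<in> S \<Longrightarrow> f2 p = \<omega>2 p powr w * u p"
    by (auto simp: density_class_def)
  have nz: "\<omega> p \<noteq> 0" if "p \<in> S" for p using \<omega>(2)[OF that] by simp
  have s: "(\<lambda>p\<in>S. \<omega>2 p / \<omega> p) \<in> smooth_funs_on A S"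
    by (intro smooth_funs_onI smooth_on_divide smooth_funs_on_param k \<omega> nz slice_param_in(2))
  have "\<forall>p\<in>S. f2 p = (\<lambda>p\<in>S. \<omega>2 p / \<omega> p) p powr w * u' p"
    using k(5,7) \<omega>(2) u nz by (simp add: powr_divide less_imp_le)
  moreover have "\<forall>\<kappa>. \<forall>p\<in>S. h2 \<kappa> p = ((\<lambda>p\<in>S. \<omega>2 p / \<omega> p) p)\<^sup>2 *\<^sub>R h' \<kappa> p"
    using k(6) h nz by (simp add: power_divide)
  moreover have "\<forall>p\<in>S. (\<lambda>p\<in>S. \<omega>2 p / \<omega> p) p > 0" using k(5) \<omega>(2) by simp
  ultimately show "k \<in> density_class A C S w h' u'"
    using k(1-3) s unfolding density_class_def by blast
qed

lemma density_class_refl: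
  assumes "g \<in> C" "f \<in> smooth_funs_on A S"
  shows "(induced A S g, f) \<in> density_class A C S w (induced A S g) f"
proof -
  have "(\<lambda>p\<in>S. 1) \<in> smooth_funs_on A S"
    by (intro smooth_funs_onI smooth_on_const slice_dom_open slice_chartD)
  then show ?thesis using assms unfolding density_class_def smooth_funs_on_def
    by (auto intro!: bexI[of _ "\<lambda>p\<in>S. 1"])
qed

text \<open>Two metrics of the class that induce conformal metrics on the surface with factor \<open>\<omega>\<close> differ by a
  conformal factor that restricts to \<open>\<omega>\<close>; so the conformal covariance applies to representatives.\<close>

lemma sqlap_density_class:
  assumes g: "g \<in> C" "g' \<in> C" and f: "f \<in> smooth_funs_on A S" "f' \<in> smooth_funs_on A S"
    and eq: "density_class A C S 1 (induced A S g) f = density_class A C S 1 (induced A S g') f'"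
  shows "density_class A C S (-3) (induced A S g') (sqlap A S g' f') = density_class A C S (-3) (induced A S g) (sqlap A S g f)"
proof -
  note m = class_metric[OF g(1)] class_metric[OF g(2)]
  have "(induced A S g', f') \<in> density_class A C S 1 (induced A S g) f"
    unfolding eq by (rule density_class_refl[OF g(2) f(2)])
  then obtain \<omega> where \<omega>: "\<omega> \<in> smooth_funs_on A S" "\<And>p. p \<in> S \<Longrightarrow> \<omega> p > 0"
    and h: "\<And>\<kappa> p. p \<in> S \<Longrightarrow> induced A S g' \<kappa> p = (\<omega> p)\<^sup>2 *\<^sub>R induced A S g \<kappa> p" and ff: "\<And>p. p \<in> S \<Longrightarrow> f' p = \<omega> p powr 1 * f p"
    unfolding density_class_def by blast
  obtain \<Omega> where \<Omega>: "positive_fun A \<Omega>" "\<And>\<kappa> p. \<kappa> \<in> A \<Longrightarrow> p \<in> fst \<kappa> \<Longrightarrow> g' \<kappa> p = rescale \<Omega> g \<kappa> p"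
    using class_rescale[OF g] by metis
  \<comment> \<open>Both factors scale the same induced metric. Its first diagonal component is
    positive, so the squares of the factors agree, and positivity gives the factors
    themselves.\<close>
  have \<omega>\<Omega>: "\<omega> p = \<Omega> p" if p: "p \<in> S" for p
  proof -
    obtain \<kappa> where \<kappa>: "\<kappa> \<in> slice_charts A S" "p \<in> fst \<kappa>" using slice_chart_at[OF p] by blast
    note kA = slice_chartD[OF \<kappa>(1)]
    have x: "snd \<kappa> p \<in> snd \<kappa> ` fst \<kappa>" using \<kappa>(2) by simp
    have "metric_on (snd \<kappa> ` fst \<kappa>) (metric_in g \<kappa>)" using m(1) kA by (simp add: local_metric_def)
    from metric_pos[OF this x, of "axis 1 1"] have "g \<kappa> p $ 1 $ 1 > 0"
      by (simp add: metric_in_def chart_inv_left[OF kA \<kappa>(2)] inner_axis' matrix_vector_mult_basis column_def axis_eq_0_iff)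
    moreover have "induced A S g' \<kappa> p $ 1 $ 1 = (\<omega> p)\<^sup>2 * induced A S g \<kappa> p $ 1 $ 1" using h[OF p, of \<kappa>] by simp
    then have "g' \<kappa> p $ 1 $ 1 = (\<omega> p)\<^sup>2 * g \<kappa> p $ 1 $ 1" using \<kappa> p by (simp add: induced_def)
    moreover have "g' \<kappa> p $ 1 $ 1 = (\<Omega> p)\<^sup>2 * g \<kappa> p $ 1 $ 1" using \<Omega>(2)[OF kA \<kappa>(2)] by (simp add: rescale_def)
    ultimately have "(\<omega> p)\<^sup>2 = (\<Omega> p)\<^sup>2" by simp
    then show ?thesis using \<omega>(2)[OF p] \<Omega>(1) by (simp add: positive_fun_def power2_eq_iff_nonneg less_imp_le)
  qed
  have f': "f' = (\<lambda>q\<in>S. \<Omega> q * f q)"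
  proof (rule extensionalityI[of _ S])
    show "f' \<in> extensional S" using f(2) by (simp add: smooth_funs_on_def)
  qed (simp_all add: ff \<omega>\<Omega>[symmetric] less_imp_le[OF \<omega>(2)])
  have u: "sqlap A S g' f' p = \<omega> p powr (-3) * sqlap A S g f p" if p: "p \<in> S" for p
  proof -
    have "sqlap A S g' f' p = sqlap A S (rescale \<Omega> g) f' p"
      by (rule sqlap_metric_cong[OF local_metric_rescale[OF m(1) \<Omega>(1)] m(2) \<Omega>(2) f(2) p])
    then show ?thesis unfolding f' using sqlap_rescale[OF m(1) \<Omega>(1) f(1) p] by (simp add: \<omega>\<Omega>[OF p])
  qed
  show ?thesis by (rule density_class_cong[OF \<omega> h u])
qed

end

text \<open>The formula is meaningful on the manifold only if every slice chart gives the same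
  value, which is the first clause. Covariance under an ambient rescaling does not by itself give a
  map on classes, because a density class mentions only induced metrics; hence the last
  clause.\<close>

theorem lemma6p1:
  fixes A :: "('m::{t2_space, second_countable_topology}) chart set"
    and C :: "'m metric set" and S :: "'m set"
  assumes "smooth_structure A" and "conformal_class A C" and "embedded_surface A S"
  shows "(\<forall>g\<in>C. \<forall>f\<in>smooth_funs_on A S.
             sqlap A S g f \<in> smooth_funs_on A S \<and>
             (\<forall>\<kappa>\<in>slice_charts A S. \<forall>p\<in>fst \<kappa> \<inter> S.
                sqlap A S g f p =
                sqlap_coord (metric_in g \<kappa>) (f \<circ> slice_param \<kappa>) (slice_coord \<kappa> p)))
       \<and> (\<forall>g\<in>C. \<forall>\<Omega>. positive_fun A \<Omega> \<longrightarrow> (\<forall>f\<in>smooth_funs_on A S. \<forall>p\<in>S.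
             sqlap A S (rescale \<Omega> g) (\<lambda>q\<in>S. \<Omega> q * f q) p = \<Omega> p powr (-3) * sqlap A S g f p))
       \<and> (\<exists>D \<in> densities A C S 1 \<rightarrow> densities A C S (-3).
             \<forall>g\<in>C. \<forall>f\<in>smooth_funs_on A S.
               D (density_class A C S 1 (induced A S g) f)
               = density_class A C S (-3) (induced A S g) (sqlap A S g f))"
proof (intro conjI ballI allI impI)
  note ctx = assms
  note m = class_metric[OF ctx]
  show "sqlap A S g f \<in> smooth_funs_on A S" if "g \<in> C" "f \<in> smooth_funs_on A S" for g f
    by (rule sqlap_smooth[OF ctx m[OF that(1)] that(2)])
  show "sqlap A S g f p = sqlap_coord (metric_in g \<kappa>) (f \<circ> slice_param \<kappa>) (slice_coord \<kappa> p)"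
    if "g \<in> C" "f \<in> smooth_funs_on A S" "\<kappa> \<in> slice_charts A S" "p \<in> fst \<kappa> \<inter> S" for g f \<kappa> p
    using sqlap_eq[OF ctx m[OF that(1)] that(2,3)] that(4) by simp
  show "sqlap A S (rescale \<Omega> g) (\<lambda>q\<in>S. \<Omega> q * f q) p = \<Omega> p powr (-3) * sqlap A S g f p"
    if "g \<in> C" "positive_fun A \<Omega>" "f \<in> smooth_funs_on A S" "p \<in> S" for g \<Omega> f p
    by (rule sqlap_rescale[OF ctx m[OF that(1)] that(2-4)])
  \<comment> \<open>A density is a set of pairs, so the operator is defined through a chosen
    representative; \<open>sqlap_density_class\<close> shows that the choice does not affect the
    result.\<close>
  define rep where "rep c = (SOME gf. fst gf \<in> C \<and> snd gf \<in> smooth_funs_on A S \<and> c = density_class A C S 1 (induced A S (fst gf)) (snd gf))" for c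
  define D where "D c = density_class A C S (-3) (induced A S (fst (rep c))) (sqlap A S (fst (rep c)) (snd (rep c)))" for c
  have D: "D (density_class A C S 1 (induced A S g) f) = density_class A C S (-3) (induced A S g) (sqlap A S g f)"
    if g: "g \<in> C" and f: "f \<in> smooth_funs_on A S" for g f
  proof -
    let ?c = "density_class A C S 1 (induced A S g) f"
    have "fst (rep ?c) \<in> C \<and> snd (rep ?c) \<in> smooth_funs_on A S \<and> ?c = density_class A C S 1 (induced A S (fst (rep ?c))) (snd (rep ?c))"
      unfolding rep_def by (rule someI[of _ "(g, f)"]) (simp add: g f)
    then have r: "fst (rep ?c) \<in> C" "snd (rep ?c) \<in> smooth_funs_on A S"
      "?c = density_class A C S 1 (induced A S (fst (rep ?c))) (snd (rep ?c))" by blast+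
    show ?thesis unfolding D_def by (rule sqlap_density_class[OF ctx g r(1) f r(2,3)])
  qed
  moreover have "D \<in> densities A C S 1 \<rightarrow> densities A C S (-3)"
  proof
    fix c assume "c \<in> densities A C S 1"
    then obtain g f where c: "c = density_class A C S 1 (induced A S g) f" "g \<in> C" "f \<in> smooth_funs_on A S"
      by (auto simp: densities_def)
    have "D c = density_class A C S (-3) (induced A S g) (sqlap A S g f)" unfolding c(1) by (rule D[OF c(2,3)])
    moreover have "sqlap A S g f \<in> smooth_funs_on A S" by (rule sqlap_smooth[OF ctx m[OF c(2)] c(3)])
    ultimately show "D c \<in> densities A C S (-3)" unfolding densities_def using c(2) by blast
  qed
  ultimately show "\<exists>D \<in> densities A C S 1 \<rightarrow> densities A C S (-3).
             \<forall>g\<in>C. \<forall>f\<in>smooth_funs_on A S.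
               D (density_class A C S 1 (induced A S g) f)
               = density_class A C S (-3) (induced A S g) (sqlap A S g f)"
    by blast
qed

end
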